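(* Let $X$ be a complex Hilbert space and $T\in B(X)$ with spectral radius $r(T)=1$. Let $E=\sigma(T)\cap\{z\in\mathbb{C}:|z|=1\}$ and suppose that no point of $E$ is a limit point of $\sigma(T)$ (so $E$ is a clopen subset of $\sigma(T)$). If the restriction of $T$ to the spectral subspace $M_E$ for the clopen subset $E$ of $\sigma(T)$ is an algebraic operator, then $T$ is null-orbit reflexive. In particular, every compact operator and every algebraic operator on a complex Hilbert space is null-orbit reflexive. Hence every operator on a finite-dimensional complex normed space is null-orbit reflexive.
   Context: $B(X)$ is the set of bounded linear operators on $X$; $\sigma(T)$ is the spectrum and $r(T)=\max\{|\lambda|:\lambda\in\sigma(T)\}$. The spectral subspace $M_E$ is the range of the Riesz idempotent (holomorphic functional calculus) of $T$ associated with the clopen set $E\subseteq\sigma(T)$. An operator $A$ is algebraic if $p(A)=0$ for some nonzero polynomial $p$. $\mathrm{nullOrb}(T)=\{0,1,T,T^2,\ldots\}$, where $1$ is the identity. $\mathrm{nullOrbRef}(T)$ is the set of all bounded operators $S$ such that, for every vector $x$, $Sx$ lies in the norm closure of $\mathrm{nullOrb}(T)x=\{Ax:A\in\mathrm{nullOrb}(T)\}$. $T$ is null-orbit reflexive if $\mathrm{nullOrbRef}(T)$ equals the strong-operator-topology closure of $\mathrm{nullOrb}(T)$. *)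

theory Defs
  imports "HOL-Complex_Analysis.Complex_Analysis"
begin

section \<open>Complex normed spaces and Hilbert spaces\<close>

text \<open>The distribution only has type classes for real normed and real inner product spaces.
  A complex normed space is a real one whose scalar multiplication extends to the complex
  numbers, with a complex homogeneous norm.\<close>

class complex_normed_vector = real_normed_vector +
  fixes scaleC :: "complex \<Rightarrow> 'a \<Rightarrow> 'a" (infixr "*\<^sub>C" 75)
  assumes scaleC_add_right: "c *\<^sub>C (x + y) = c *\<^sub>C x + c *\<^sub>C y"
    and scaleC_add_left: "(c + d) *\<^sub>C x = c *\<^sub>C x + d *\<^sub>C x"
    and scaleC_scaleC: "c *\<^sub>C (d *\<^sub>C x) = (c * d) *\<^sub>C x"
    and scaleC_one: "1 *\<^sub>C x = x"
    and scaleR_scaleC: "r *\<^sub>R x = complex_of_real r *\<^sub>C x"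
    and norm_scaleC: "norm (c *\<^sub>C x) = cmod c * norm x"

global_interpretation complex_vector:
  vector_space "scaleC :: complex \<Rightarrow> 'a \<Rightarrow> 'a :: complex_normed_vector"
  by unfold_locales (simp_all add: scaleC_add_right scaleC_add_left scaleC_scaleC scaleC_one)

text \<open>The last axiom says that the norm is the one induced by the inner product, and it
  contains positive definiteness, because \<^const>\<open>norm\<close> is already a norm.\<close>

class chilbert_space = complex_normed_vector + banach +
  fixes cinner :: "'a \<Rightarrow> 'a \<Rightarrow> complex"
  assumes cinner_commute: "cinner x y = cnj (cinner y x)"
    and cinner_add_left: "cinner (x + y) z = cinner x z + cinner y z"
    and cinner_scaleC_left: "cinner (c *\<^sub>C x) y = c * cinner x y"
    and cinner_self: "cinner x x = complex_of_real ((norm x)\<^sup>2)"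

definition complex_finite_dimensional :: "'a::complex_normed_vector itself \<Rightarrow> bool" where
  "complex_finite_dimensional _ \<longleftrightarrow>
     (\<exists>B :: 'a set. finite B \<and> complex_vector.span B = UNIV)"


section \<open>Bounded complex-linear operators\<close>

lemma bounded_linear_scaleC: "bounded_linear (\<lambda>x. c *\<^sub>C (x :: 'a :: complex_normed_vector))"
proof (rule bounded_linear_intro[where K = "cmod c"])
  show "c *\<^sub>C (r *\<^sub>R x) = r *\<^sub>R (c *\<^sub>C x)" for r and x :: 'a
    by (simp add: scaleR_scaleC scaleC_scaleC mult.commute)
qed (simp_all add: scaleC_add_right norm_scaleC)

instantiation blinfun :: (real_normed_vector, complex_normed_vector) complex_normed_vector
begin

definition scaleC_blinfun :: "complex \<Rightarrow> 'a \<Rightarrow>\<^sub>L 'b \<Rightarrow> 'a \<Rightarrow>\<^sub>L 'b" where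
  "scaleC c f = Blinfun (\<lambda>x. c *\<^sub>C blinfun_apply f x)"

lemma scaleC_blinfun_apply: "blinfun_apply (c *\<^sub>C f) x = c *\<^sub>C blinfun_apply f x"
  for f :: "'a \<Rightarrow>\<^sub>L 'b"
  unfolding scaleC_blinfun_def
  by (subst bounded_linear_Blinfun_apply)
     (auto intro: bounded_linear_compose[OF bounded_linear_scaleC] blinfun.bounded_linear_right)

instance
proof
  fix c d :: complex and r :: real and f g :: "'a \<Rightarrow>\<^sub>L 'b"
  show "c *\<^sub>C (f + g) = c *\<^sub>C f + c *\<^sub>C g"
    by (rule blinfun_eqI) (simp add: scaleC_blinfun_apply blinfun.add_left scaleC_add_right)
  show "(c + d) *\<^sub>C f = c *\<^sub>C f + d *\<^sub>C f"
    by (rule blinfun_eqI) (simp add: scaleC_blinfun_apply blinfun.add_left scaleC_add_left)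
  show "c *\<^sub>C (d *\<^sub>C f) = (c * d) *\<^sub>C f"
    by (rule blinfun_eqI) (simp add: scaleC_blinfun_apply scaleC_scaleC)
  show "1 *\<^sub>C f = f"
    by (rule blinfun_eqI) (simp add: scaleC_blinfun_apply scaleC_one)
  show "r *\<^sub>R f = complex_of_real r *\<^sub>C f"
    by (rule blinfun_eqI) (simp add: scaleC_blinfun_apply blinfun.scaleR_left scaleR_scaleC)
  have le: "norm (c *\<^sub>C f) \<le> cmod c * norm f" for c and f :: "'a \<Rightarrow>\<^sub>L 'b"
  proof (rule norm_blinfun_bound)
    fix x
    show "norm (blinfun_apply (c *\<^sub>C f) x) \<le> cmod c * norm f * norm x"
      using mult_left_mono[OF norm_blinfun[of f x], of "cmod c"]
      by (simp add: scaleC_blinfun_apply norm_scaleC mult.assoc)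
  qed simp
  show "norm (c *\<^sub>C f) = cmod c * norm f"
  proof (cases "c = 0")
    case True
    with le[of 0 f] show ?thesis by simp
  next
    case False
    have "f = inverse c *\<^sub>C (c *\<^sub>C f)"
      by (rule blinfun_eqI) (simp add: scaleC_blinfun_apply scaleC_scaleC scaleC_one False)
    with le[of "inverse c" "c *\<^sub>C f"] have "norm f \<le> norm (c *\<^sub>C f) / cmod c"
      by (simp add: norm_inverse divide_inverse mult.commute)
    with le[of c f] False show ?thesis by (simp add: field_simps)
  qed
qed

end

text \<open>\<^typ>\<open>'a \<Rightarrow>\<^sub>L 'a\<close> consists of the bounded \<^emph>\<open>real\<close>-linear maps; the algebra
  \<open>B(X)\<close> is the following subset.\<close>

definition bounded_ops :: "('a::complex_normed_vector \<Rightarrow>\<^sub>L 'a) set" where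
  "bounded_ops = {T. \<forall>c x. blinfun_apply T (c *\<^sub>C x) = c *\<^sub>C blinfun_apply T x}"

definition op_power :: "('a::complex_normed_vector \<Rightarrow>\<^sub>L 'a) \<Rightarrow> nat \<Rightarrow> ('a \<Rightarrow>\<^sub>L 'a)" where
  "op_power T n = ((\<lambda>S. T o\<^sub>L S) ^^ n) id_blinfun"

definition compact_op :: "('a::complex_normed_vector \<Rightarrow>\<^sub>L 'a) \<Rightarrow> bool" where
  "compact_op T \<longleftrightarrow> T \<in> bounded_ops \<and> compact (closure (blinfun_apply T ` cball 0 1))"

definition poly_op :: "complex poly \<Rightarrow> ('a::complex_normed_vector \<Rightarrow>\<^sub>L 'a) \<Rightarrow> ('a \<Rightarrow>\<^sub>L 'a)" where
  "poly_op p T = (\<Sum>i\<le>degree p. coeff p i *\<^sub>C op_power T i)"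

definition algebraic_op :: "('a::complex_normed_vector \<Rightarrow>\<^sub>L 'a) \<Rightarrow> bool" where
  "algebraic_op T \<longleftrightarrow> T \<in> bounded_ops \<and> (\<exists>p. p \<noteq> 0 \<and> poly_op p T = 0)"

text \<open>For a \<open>T\<close>-invariant subspace \<open>M\<close>, \<open>p(T|M)\<close> is the restriction of \<open>p(T)\<close> to \<open>M\<close>, so
  this says that the restriction of \<open>T\<close> to \<open>M\<close> is algebraic.\<close>

definition algebraic_on :: "('a::complex_normed_vector \<Rightarrow>\<^sub>L 'a) \<Rightarrow> 'a set \<Rightarrow> bool" where
  "algebraic_on T M \<longleftrightarrow> (\<exists>p. p \<noteq> 0 \<and> (\<forall>x\<in>M. blinfun_apply (poly_op p T) x = 0))"


section \<open>Spectrum and spectral subspaces\<close>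

definition is_inverse_op ::
    "('a::complex_normed_vector \<Rightarrow>\<^sub>L 'a) \<Rightarrow> ('a \<Rightarrow>\<^sub>L 'a) \<Rightarrow> bool" where
  "is_inverse_op A B \<longleftrightarrow>
     B \<in> bounded_ops \<and> A o\<^sub>L B = id_blinfun \<and> B o\<^sub>L A = id_blinfun"

definition spectrum :: "('a::complex_normed_vector \<Rightarrow>\<^sub>L 'a) \<Rightarrow> complex set" where
  "spectrum T = {z. \<not> (\<exists>B. is_inverse_op (z *\<^sub>C id_blinfun - T) B)}"

text \<open>On a nonzero Banach space the spectrum is compact and nonempty, so the supremum is a
  maximum.\<close>

definition spectral_radius :: "('a::complex_normed_vector \<Rightarrow>\<^sub>L 'a) \<Rightarrow> real" where
  "spectral_radius T = Sup (cmod ` spectrum T)"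

definition resolvent :: "('a::complex_normed_vector \<Rightarrow>\<^sub>L 'a) \<Rightarrow> complex \<Rightarrow> ('a \<Rightarrow>\<^sub>L 'a)" where
  "resolvent T z = (THE B. is_inverse_op (z *\<^sub>C id_blinfun - T) B)"

text \<open>A cycle (list of closed paths) in the resolvent set that winds once around \<open>E\<close> and not
  at all around the rest of the spectrum. A single closed path would not suffice for a general
  clopen \<open>E\<close>.\<close>

definition separating_cycle ::
    "('a::complex_normed_vector \<Rightarrow>\<^sub>L 'a) \<Rightarrow> complex set \<Rightarrow> (real \<Rightarrow> complex) list \<Rightarrow> bool" where
  "separating_cycle T E \<Gamma> \<longleftrightarrow>
     (\<forall>\<gamma>\<in>set \<Gamma>. valid_path \<gamma> \<and> pathfinish \<gamma> = pathstart \<gamma> \<and>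
        path_image \<gamma> \<inter> spectrum T = {}) \<and>
     (\<forall>z\<in>spectrum T. (\<Sum>\<gamma>\<leftarrow>\<Gamma>. winding_number \<gamma> z) = (if z \<in> E then 1 else 0))"

text \<open>The integral of the resolvent along a cycle, in the form of \<^const>\<open>contour_integral\<close>,
  which is only available for complex-valued integrands.\<close>

definition resolvent_integral ::
    "('a::complex_normed_vector \<Rightarrow>\<^sub>L 'a) \<Rightarrow> (real \<Rightarrow> complex) list \<Rightarrow> ('a \<Rightarrow>\<^sub>L 'a)" where
  "resolvent_integral T \<Gamma> =
     (\<Sum>\<gamma>\<leftarrow>\<Gamma>. integral {0..1}
        (\<lambda>t. vector_derivative \<gamma> (at t within {0..1}) *\<^sub>C resolvent T (\<gamma> t)))"

text \<open>For clopen \<open>E\<close> a separating cycle exists, and by Cauchy's theorem the integral does not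
  depend on its choice.\<close>

definition riesz_idempotent ::
    "('a::complex_normed_vector \<Rightarrow>\<^sub>L 'a) \<Rightarrow> complex set \<Rightarrow> ('a \<Rightarrow>\<^sub>L 'a)" where
  "riesz_idempotent T E =
     (1 / (2 * of_real pi * \<i>)) *\<^sub>C resolvent_integral T (SOME \<Gamma>. separating_cycle T E \<Gamma>)"

definition spectral_subspace :: "('a::complex_normed_vector \<Rightarrow>\<^sub>L 'a) \<Rightarrow> complex set \<Rightarrow> 'a set" where
  "spectral_subspace T E = range (blinfun_apply (riesz_idempotent T E))"


section \<open>Null-orbit reflexivity\<close>

definition nullOrb :: "('a::complex_normed_vector \<Rightarrow>\<^sub>L 'a) \<Rightarrow> ('a \<Rightarrow>\<^sub>L 'a) set" where
  "nullOrb T = insert 0 (range (op_power T))"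

definition nullOrbRef :: "('a::complex_normed_vector \<Rightarrow>\<^sub>L 'a) \<Rightarrow> ('a \<Rightarrow>\<^sub>L 'a) set" where
  "nullOrbRef T =
     {S \<in> bounded_ops. \<forall>x. blinfun_apply S x \<in> closure ((\<lambda>A. blinfun_apply A x) ` nullOrb T)}"

definition null_orbit_reflexive :: "('a::complex_normed_vector \<Rightarrow>\<^sub>L 'a) \<Rightarrow> bool" where
  "null_orbit_reflexive T \<longleftrightarrow>
     nullOrbRef T = (subtopology strong_operator_topology bounded_ops) closure_of (nullOrb T)"

end

theory Submission
  imports Defs "HOL-Computational_Algebra.Fundamental_Theorem_Algebra"
begin

text \<open>Suppose the norms of \<open>T\<^sup>n p(T)\<close> decay geometrically for some \<open>p \<noteq> 0\<close>, and take \<open>p\<close> of minimal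
  degree. Then all roots of \<open>p\<close> have modulus at least 1. By Baire's theorem an \<open>S\<close> in
  \<open>nullOrbRef T\<close> either lies in \<open>nullOrb T\<close>, or for generic \<open>x\<close> the vector \<open>S x\<close> is a cluster point
  of the sequence \<open>T\<^sup>n x\<close>. A root outside the unit circle or a multiple root on it makes these
  orbits escape to infinity on a nonempty open set, which excludes the second case. Otherwise
  \<open>T\<^sup>n = (\<Sum>l. l\<^sup>n D\<^sub>l) + o(1)\<close> over the simple unimodular roots \<open>l\<close>, so \<open>S = (\<Sum>l. \<nu>\<^sub>l D\<^sub>l)\<close>; a
  vector with \<open>D\<^sub>l x \<noteq> 0\<close> for all nonzero \<open>D\<^sub>l\<close> shows that powers of the roots approximate all
  \<open>\<nu>\<^sub>l\<close> simultaneously, and \<open>S\<close> is a norm limit of powers of \<open>T\<close>.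

  For algebraic \<open>T\<close> the hypothesis holds with \<open>p(T) = 0\<close>. In the other cases let \<open>Q\<close> be the
  integral of the resolvent over a circle of radius \<open>r < 1\<close> that avoids the spectrum: the norms of
  \<open>T\<^sup>n Q\<close> are \<open>O(r\<^sup>n)\<close>, so it suffices that \<open>p(T) (1 - Q) = 0\<close>. If \<open>P\<close> is the Riesz idempotent of
  the peripheral spectrum then \<open>P (1 - Q) = 1 - Q\<close>; if \<open>T\<close> is compact then \<open>1 - Q\<close> is a compact
  idempotent, hence of finite rank.\<close>

section \<open>The algebra of bounded operators\<close>

text \<open>Minimality of \<open>p\<close> acts through its quotients
  \<open>q = p / (X - l)\<close>: \<open>T^n p(T)\<close> decays while \<open>T^n q(T)\<close> does
  not. For \<open>\<bar>l\<bar> < 1\<close> this is contradictory; for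
  \<open>\<bar>l\<bar> \<ge> 1\<close> it makes the limit of \<open>l^(-n) T^n q(T)\<close> nonzero,
  which is what drives the orbits to infinity.

  The Baire part runs in any complete complex normed space. Completeness is a hypothesis on
  \<open>UNIV\<close> and not a type class, because the finite-dimensional space is a bare normed
  space whose completeness is itself derived.

  \<open>riesz_idempotent\<close> rests on an arbitrary choice of cycle. It enters through the
  one-sided relation \<open>P (1 - Q) = 1 - Q\<close>, which turns \<open>p(T) P = 0\<close> into
  \<open>p(T) (1 - Q) = 0\<close>. Then \<open>p(T) = p(T) Q\<close>, and the decay of
  \<open>T^n Q\<close> passes to \<open>T^n p(T)\<close>. Cauchy's theorem and residues are applied
  to the scalar functions \<open>cinner (R(z) x) y\<close>, where \<open>R\<close> is the resolvent;
  these determine the operators.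

  For compact \<open>T\<close> the operator \<open>1 - Q\<close> is compact because it is
  \<open>T\<close> times a bounded operator, and idempotent because two radii \<open>a < b\<close>
  in a spectral gap yield a bound \<open>(a / b)^n\<close> for \<open>Q (1 - Q)\<close>.\<close>

lemma scaleC_left_zero [simp]: "0 *\<^sub>C x = (0 :: 'a::complex_normed_vector)"
  using scaleC_add_left[of 0 0 x] by simp

lemma scaleC_right_zero [simp]: "c *\<^sub>C (0 :: 'a::complex_normed_vector) = 0"
  using scaleC_add_right[of c 0 "0 :: 'a"] by simp

lemma scaleC_minus_left: "(- c) *\<^sub>C x = - (c *\<^sub>C (x :: 'a::complex_normed_vector))"
  using scaleC_add_left[of "- c" c x] by (simp add: eq_neg_iff_add_eq_0)

lemma scaleC_minus_right: "c *\<^sub>C (- x) = - (c *\<^sub>C (x :: 'a::complex_normed_vector))"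
  using scaleC_add_right[of c "- x" x] by (simp add: eq_neg_iff_add_eq_0)

lemma scaleC_diff_left: "(c - d) *\<^sub>C x = c *\<^sub>C x - d *\<^sub>C (x :: 'a::complex_normed_vector)"
  using scaleC_add_left[of c "- d" x] by (simp add: scaleC_minus_left)

lemma scaleC_diff_right: "c *\<^sub>C (x - y) = c *\<^sub>C x - c *\<^sub>C (y :: 'a::complex_normed_vector)"
  using scaleC_add_right[of c x "- y"] by (simp add: scaleC_minus_right)

lemma scaleC_sum_right: "c *\<^sub>C (\<Sum>i\<in>I. f i) = (\<Sum>i\<in>I. c *\<^sub>C (f i :: 'a::complex_normed_vector))"
  by (induction I rule: infinite_finite_induct) (auto simp: scaleC_add_right)

lemma bounded_bilinear_scaleC:
  "bounded_bilinear (scaleC :: complex \<Rightarrow> 'a \<Rightarrow> 'a::complex_normed_vector)"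
proof
  show "\<exists>K. \<forall>a (b :: 'a). norm (a *\<^sub>C b) \<le> norm a * norm b * K"
    by (rule exI[of _ 1]) (simp add: norm_scaleC)
qed (auto simp: scaleC_add_left scaleC_add_right scaleR_scaleC scaleC_scaleC mult.commute scaleR_conv_of_real)

lemmas scaleC_simps = scaleC_add_left scaleC_add_right scaleC_diff_left scaleC_diff_right
  scaleC_minus_left scaleC_minus_right scaleC_scaleC scaleC_one scaleC_blinfun_apply

lemma blinfun_sum_apply: "blinfun_apply (\<Sum>i\<in>I. f i) x = (\<Sum>i\<in>I. blinfun_apply (f i) x)"
  by (induction I rule: infinite_finite_induct) (auto simp: blinfun.add_left)

lemma bounded_opsD: "T \<in> bounded_ops \<Longrightarrow> blinfun_apply T (c *\<^sub>C x) = c *\<^sub>C blinfun_apply T x"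
  by (simp add: bounded_ops_def)

lemma bounded_ops_closed [simp, intro]:
  "id_blinfun \<in> bounded_ops" "0 \<in> bounded_ops"
  "A \<in> bounded_ops \<Longrightarrow> B \<in> bounded_ops \<Longrightarrow> A o\<^sub>L B \<in> bounded_ops"
  "A \<in> bounded_ops \<Longrightarrow> B \<in> bounded_ops \<Longrightarrow> A + B \<in> bounded_ops"
  "A \<in> bounded_ops \<Longrightarrow> B \<in> bounded_ops \<Longrightarrow> A - B \<in> bounded_ops"
  "A \<in> bounded_ops \<Longrightarrow> - A \<in> bounded_ops"
  "A \<in> bounded_ops \<Longrightarrow> c *\<^sub>C A \<in> bounded_ops"
  by (auto simp: bounded_ops_def blinfun.bilinear_simps scaleC_simps mult.commute)

lemma bounded_ops_sum [intro]: "(\<And>i. i \<in> I \<Longrightarrow> f i \<in> bounded_ops) \<Longrightarrow> (\<Sum>i\<in>I. f i) \<in> bounded_ops"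
  by (induction I rule: infinite_finite_induct) auto

lemma blinfun_compose_id [simp]: "A o\<^sub>L id_blinfun = A" "id_blinfun o\<^sub>L A = A"
  by (auto intro!: blinfun_eqI)

lemma blinfun_compose_assoc: "(A o\<^sub>L B) o\<^sub>L C = A o\<^sub>L (B o\<^sub>L C)"
  by (auto intro!: blinfun_eqI)

lemma compose_scaleC_left: "(c *\<^sub>C A) o\<^sub>L B = c *\<^sub>C (A o\<^sub>L B)"
  by (auto intro!: blinfun_eqI simp: scaleC_blinfun_apply)

lemma compose_scaleC_right: "A \<in> bounded_ops \<Longrightarrow> A o\<^sub>L (c *\<^sub>C B) = c *\<^sub>C (A o\<^sub>L B)"
  by (auto intro!: blinfun_eqI simp: scaleC_blinfun_apply bounded_opsD)

lemmas compose_add_left = bounded_bilinear.add_left[OF bounded_bilinear_blinfun_compose]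
lemmas compose_add_right = bounded_bilinear.add_right[OF bounded_bilinear_blinfun_compose]
lemmas compose_diff_left = bounded_bilinear.diff_left[OF bounded_bilinear_blinfun_compose]
lemmas compose_diff_right = bounded_bilinear.diff_right[OF bounded_bilinear_blinfun_compose]
lemmas compose_minus_left = bounded_bilinear.minus_left[OF bounded_bilinear_blinfun_compose]
lemmas compose_minus_right = bounded_bilinear.minus_right[OF bounded_bilinear_blinfun_compose]
lemmas compose_sum_left = bounded_bilinear.sum_left[OF bounded_bilinear_blinfun_compose]
lemmas compose_sum_right = bounded_bilinear.sum_right[OF bounded_bilinear_blinfun_compose]
lemmas compose_simps = compose_add_left compose_add_right compose_diff_left compose_diff_right
  compose_minus_left compose_minus_right

lemma bounded_ops_limit:
  assumes "\<And>n. X n \<in> bounded_ops" "X \<longlonglongrightarrow> L" shows "L \<in> bounded_ops"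
proof -
  have "blinfun_apply L (c *\<^sub>C x) = c *\<^sub>C blinfun_apply L x" for c x
  proof (rule LIMSEQ_unique)
    show "(\<lambda>n. blinfun_apply (X n) (c *\<^sub>C x)) \<longlonglongrightarrow> blinfun_apply L (c *\<^sub>C x)"
      by (intro bounded_linear.tendsto[OF blinfun.bounded_linear_left] assms)
    show "(\<lambda>n. blinfun_apply (X n) (c *\<^sub>C x)) \<longlonglongrightarrow> c *\<^sub>C blinfun_apply L x"
      using bounded_linear.tendsto[OF bounded_linear_scaleC
          bounded_linear.tendsto[OF blinfun.bounded_linear_left assms(2)]] assms(1)
      by (simp add: bounded_opsD)
  qed
  then show ?thesis by (simp add: bounded_ops_def)
qed

lemma norm_blinfun_compose_mono: "norm (A o\<^sub>L B) \<le> a * b" if "norm A \<le> a" "norm B \<le> b"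
  by (rule order_trans[OF norm_blinfun_compose])
    (meson mult_mono norm_ge_zero order_trans that)

lemma op_power_0 [simp]: "op_power T 0 = id_blinfun"
  and op_power_Suc: "op_power T (Suc n) = T o\<^sub>L op_power T n"
  by (simp_all add: op_power_def)

lemma op_power_add: "op_power T (m + n) = op_power T m o\<^sub>L op_power T n"
  by (induction m) (simp_all add: op_power_Suc blinfun_compose_assoc)

lemma op_power_Suc2: "op_power T (Suc n) = op_power T n o\<^sub>L T"
  using op_power_add[of T n 1] by (simp add: op_power_Suc)

lemma op_power_in_bounded_ops [simp, intro]: "T \<in> bounded_ops \<Longrightarrow> op_power T n \<in> bounded_ops"
  by (induction n) (auto simp: op_power_Suc)

lemma op_power_commute:
  assumes "A o\<^sub>L T = T o\<^sub>L A" shows "A o\<^sub>L op_power T n = op_power T n o\<^sub>L A"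
proof (induction n)
  case (Suc n)
  have "A o\<^sub>L op_power T (Suc n) = (A o\<^sub>L T) o\<^sub>L op_power T n"
    by (simp add: op_power_Suc blinfun_compose_assoc)
  also have "\<dots> = op_power T (Suc n) o\<^sub>L A"
    by (simp add: assms op_power_Suc blinfun_compose_assoc Suc)
  finally show ?case .
qed auto

lemma norm_op_power_le: "norm (op_power T n) \<le> norm T ^ n"
proof (induction n)
  case 0
  show ?case by (simp add: norm_blinfun_id_le)
next
  case (Suc n)
  then show ?case
    by (simp add: op_power_Suc norm_blinfun_compose_mono)
qed

section \<open>Polynomials of an operator\<close>

lemma poly_op_altdef:
  assumes "degree p \<le> n" shows "poly_op p T = (\<Sum>i\<le>n. coeff p i *\<^sub>C op_power T i)"
  unfolding poly_op_def
  by (rule sum.mono_neutral_left) (use assms in \<open>auto simp: coeff_eq_0\<close>)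

lemma poly_op_0 [simp]: "poly_op 0 T = 0"
  by (simp add: poly_op_def)

lemma poly_op_pCons:
  assumes T: "T \<in> bounded_ops"
  shows "poly_op (pCons a p) T = a *\<^sub>C id_blinfun + (T o\<^sub>L poly_op p T)"
proof -
  have "poly_op (pCons a p) T = (\<Sum>i\<le>Suc (degree p). coeff (pCons a p) i *\<^sub>C op_power T i)"
    by (rule poly_op_altdef) (simp add: degree_pCons_le)
  also have "\<dots> = a *\<^sub>C id_blinfun + (\<Sum>i\<le>degree p. coeff p i *\<^sub>C op_power T (Suc i))"
    by (subst sum.atMost_Suc_shift) simp
  also have "\<dots> = a *\<^sub>C id_blinfun + (T o\<^sub>L poly_op p T)"
    using T by (simp add: poly_op_def compose_sum_right compose_scaleC_right op_power_Suc)
  finally show ?thesis .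
qed

lemma poly_op_in_bounded_ops [simp, intro]: "T \<in> bounded_ops \<Longrightarrow> poly_op p T \<in> bounded_ops"
  by (auto simp: poly_op_def)

lemma poly_op_1 [simp]: "poly_op 1 T = id_blinfun"
  by (simp add: poly_op_def scaleC_one)

lemma poly_op_linear: "T \<in> bounded_ops \<Longrightarrow> poly_op [:-a, 1:] T = T - a *\<^sub>C id_blinfun"
  by (simp add: poly_op_pCons scaleC_simps)

lemma poly_op_add: "poly_op (p + q) T = poly_op p T + poly_op q T"
  using degree_add_le_max[of p q]
  by (simp add: poly_op_altdef[of _ "max (degree p) (degree q)"] scaleC_add_left sum.distrib)

lemma poly_op_smult: "poly_op (smult c p) T = c *\<^sub>C poly_op p T"
  by (simp add: poly_op_altdef[of "smult c p" "degree p"] poly_op_def scaleC_sum_right scaleC_scaleC)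

lemma poly_op_sum: "poly_op (\<Sum>i\<in>I. p i) T = (\<Sum>i\<in>I. poly_op (p i) T)"
  by (induction I rule: infinite_finite_induct) (auto simp: poly_op_add)

lemma poly_op_mult:
  assumes T: "T \<in> bounded_ops"
  shows "poly_op (p * q) T = poly_op p T o\<^sub>L poly_op q T"
proof (induction p)
  case (pCons a p)
  have "pCons a p * q = smult a q + pCons 0 (p * q)" by simp
  then show ?case
    by (simp add: poly_op_add poly_op_smult poly_op_pCons[OF T] pCons compose_simps
        compose_scaleC_left blinfun_compose_assoc)
qed auto

lemma poly_op_commute:
  "T \<in> bounded_ops \<Longrightarrow> poly_op p T o\<^sub>L poly_op q T = poly_op q T o\<^sub>L poly_op p T"
  by (metis poly_op_mult mult.commute)

lemma poly_op_X: "T \<in> bounded_ops \<Longrightarrow> poly_op [:0, 1:] T = T"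
  using poly_op_linear[of T 0] by simp

lemma poly_op_commute_self: "T \<in> bounded_ops \<Longrightarrow> poly_op p T o\<^sub>L T = T o\<^sub>L poly_op p T"
  using poly_op_commute[of T p "[:0, 1:]"] by (simp add: poly_op_X)

lemma poly_op_power_commute:
  "T \<in> bounded_ops \<Longrightarrow> poly_op p T o\<^sub>L op_power T n = op_power T n o\<^sub>L poly_op p T"
  by (simp add: op_power_commute poly_op_commute_self)

section \<open>Operators with geometrically small polynomial multiples of the powers\<close>

text \<open>With \<open>A = p(T)\<close> this says that the powers of \<open>T\<close> satisfy the
  linear recurrence with characteristic polynomial \<open>p\<close> up to a geometrically small
  error.\<close>

definition geom_decay :: "('a::complex_normed_vector \<Rightarrow>\<^sub>L 'a) \<Rightarrow> ('a \<Rightarrow>\<^sub>L 'a) \<Rightarrow> bool" where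
  "geom_decay T A \<longleftrightarrow> (\<exists>K r. 0 \<le> r \<and> r < 1 \<and> (\<forall>n. norm (op_power T n o\<^sub>L A) \<le> K * r ^ n))"

text \<open>The bound at \<open>n = 0\<close> forces \<open>K \<ge> 0\<close>, and raising the rate
  to at least \<open>1/2\<close> makes it positive.\<close>

lemma geom_decayE:
  assumes "geom_decay T A"
  obtains K r where "0 \<le> K" "0 < r" "r < 1" "\<And>n. norm (op_power T n o\<^sub>L A) \<le> K * r ^ n"
proof -
  from assms obtain K r where *: "0 \<le> r" "r < 1" "\<And>n. norm (op_power T n o\<^sub>L A) \<le> K * r ^ n"
    by (auto simp: geom_decay_def)
  have "norm (op_power T 0 o\<^sub>L A) \<le> K" using *(3)[of 0] by simp
  then have K: "0 \<le> K" by (rule order_trans[OF norm_ge_zero])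
  have "norm (op_power T n o\<^sub>L A) \<le> K * max r (1/2) ^ n" for n
    by (rule order_trans[OF *(3)]) (use K * in \<open>auto intro!: mult_left_mono power_mono\<close>)
  then show ?thesis using that[of K "max r (1/2)"] K * by auto
qed

lemma geom_decay_scaleC:
  assumes "T \<in> bounded_ops" "geom_decay T A"
  shows "geom_decay T (c *\<^sub>C A)"
proof -
  obtain K r where *: "0 \<le> K" "0 < r" "r < 1" "\<And>n. norm (op_power T n o\<^sub>L A) \<le> K * r ^ n"
    using assms(2) by (rule geom_decayE) blast
  have "norm (op_power T n o\<^sub>L (c *\<^sub>C A)) \<le> (cmod c * K) * r ^ n" for n
    using mult_left_mono[OF *(4)[of n], of "cmod c"] assms
    by (simp add: compose_scaleC_right norm_scaleC mult.assoc)
  then show ?thesis using *(2,3) unfolding geom_decay_def by (metis less_imp_le)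
qed

text \<open>Since \<open>T^(n+1) A = l T^n A + T^n (T - l) A\<close>, the norms \<open>a_n\<close>
  of \<open>T^n A\<close> satisfy \<open>a_(n+1) \<le> \<bar>l\<bar> a_n + K r^n\<close>, which
  decays at every rate above both \<open>\<bar>l\<bar>\<close> and \<open>r\<close>. Hence a minimal
  \<open>p\<close> has no root in the open unit disc.\<close>

lemma geom_decay_strip_root:
  assumes T: "T \<in> bounded_ops" and l: "cmod l < 1"
    and dec: "geom_decay T ((T - l *\<^sub>C id_blinfun) o\<^sub>L A)"
  shows "geom_decay T A"
proof -
  obtain K r where K: "0 \<le> K" and r: "0 < r" "r < 1"
    and bnd: "\<And>n. norm (op_power T n o\<^sub>L ((T - l *\<^sub>C id_blinfun) o\<^sub>L A)) \<le> K * r ^ n"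
    using dec by (rule geom_decayE) metis
  define s where "s = (max r (cmod l) + 1) / 2"
  have s: "s < 1" "r \<le> s" "cmod l < s" "0 < s" using r l by (auto simp: s_def)
  \<comment> \<open>The first entry starts the induction; the second gives
    \<open>K \<le> M (s - \<bar>l\<bar>)\<close>, the room required by the inductive step.\<close>
  define M where "M = max (norm A) (K / (s - cmod l))"
  have "norm (op_power T n o\<^sub>L A) \<le> M * s ^ n" for n
  proof (induction n)
    case (Suc n)
    have "op_power T (Suc n) o\<^sub>L A
        = l *\<^sub>C (op_power T n o\<^sub>L A) + (op_power T n o\<^sub>L ((T - l *\<^sub>C id_blinfun) o\<^sub>L A))"
      using T by (simp add: op_power_Suc2 compose_simps compose_scaleC_left compose_scaleC_right
          blinfun_compose_assoc)
    then have "norm (op_power T (Suc n) o\<^sub>L A) \<le> cmod l * norm (op_power T n o\<^sub>L A) + K * r ^ n"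
      using bnd[of n] by (metis norm_triangle_le norm_scaleC add_left_mono)
    also have "\<dots> \<le> cmod l * (M * s ^ n) + (M * (s - cmod l)) * s ^ n"
    proof (intro add_mono mult_left_mono mult_mono power_mono)
      have "K / (s - cmod l) \<le> M" by (simp add: M_def)
      then show "K \<le> M * (s - cmod l)" using s by (simp add: divide_le_eq)
    qed (use Suc K r s in \<open>auto simp: M_def le_max_iff_disj\<close>)
    also have "\<dots> = M * s ^ Suc n" by (simp add: algebra_simps)
    finally show ?case .
  qed (simp add: M_def)
  then show ?thesis using s unfolding geom_decay_def by (metis less_imp_le)
qed

text \<open>The pointwise limit is linear and inherits the uniform bound of the Cauchy sequence;
  letting \<open>m\<close> tend to infinity in the Cauchy estimate upgrades pointwise to norm
  convergence. The codomain is complete by hypothesis and not by class, so that finite-dimensional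
  normed spaces are covered.\<close>

lemma complete_imp_blinfun_Cauchy_convergent:
  fixes X :: "nat \<Rightarrow> 'a::real_normed_vector \<Rightarrow>\<^sub>L 'b::real_normed_vector"
  assumes compl: "complete (UNIV :: 'b set)" and X: "Cauchy X"
  obtains L where "X \<longlonglongrightarrow> L"
proof -
  have "\<exists>y. (\<lambda>n. blinfun_apply (X n) x) \<longlonglongrightarrow> y" for x
  proof -
    have "Cauchy (\<lambda>n. blinfun_apply (X n) x)"
      by (rule bounded_linear.Cauchy[OF blinfun.bounded_linear_left X])
    then show ?thesis using compl unfolding complete_def by auto
  qed
  then obtain v where v: "\<And>x. (\<lambda>n. blinfun_apply (X n) x) \<longlonglongrightarrow> v x" by metis
  from Cauchy_Bseq[OF X] obtain M where M: "\<And>n. norm (X n) \<le> M" by (metis BseqE)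
  have "bounded_linear v"
  proof (rule bounded_linear_intro[where K = M])
    fix x y
    show "v (x + y) = v x + v y"
      by (rule LIMSEQ_unique[OF v]) (auto simp: blinfun.add_right intro!: tendsto_add v)
  next
    fix c x
    show "v (c *\<^sub>R x) = c *\<^sub>R v x"
      by (rule LIMSEQ_unique[OF v]) (auto simp: blinfun.scaleR_right intro!: tendsto_scaleR v)
  next
    fix x
    show "norm (v x) \<le> norm x * M"
    proof (rule LIMSEQ_le_const2[OF tendsto_norm[OF v]], intro exI allI impI)
      fix n
      show "norm (blinfun_apply (X n) x) \<le> norm x * M"
        by (rule order_trans[OF norm_blinfun]) (simp add: M mult.commute[of "norm x"] mult_right_mono)
    qed
  qed
  then have app: "blinfun_apply (Blinfun v) = v" by (rule bounded_linear_Blinfun_apply)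
  have "X \<longlonglongrightarrow> Blinfun v"
  proof (rule LIMSEQ_I)
    fix e :: real assume "0 < e"
    then obtain N where N: "\<And>m n. m \<ge> N \<Longrightarrow> n \<ge> N \<Longrightarrow> norm (X m - X n) < e / 2"
      using X unfolding Cauchy_iff by (metis half_gt_zero)
    have "norm (X n - Blinfun v) \<le> e / 2" if n: "n \<ge> N" for n
    proof (rule norm_blinfun_bound)
      fix x
      have "(\<lambda>m. norm (blinfun_apply (X n) x - blinfun_apply (X m) x)) \<longlonglongrightarrow> norm (blinfun_apply (X n) x - v x)"
        by (intro tendsto_intros v)
      then have "norm (blinfun_apply (X n) x - v x) \<le> e / 2 * norm x"
      proof (rule LIMSEQ_le_const2, intro exI allI impI)
        fix m assume "N \<le> m"
        then have "norm (X n - X m) \<le> e / 2" using N[OF n] by (simp add: less_imp_le)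
        then show "norm (blinfun_apply (X n) x - blinfun_apply (X m) x) \<le> e / 2 * norm x"
          unfolding blinfun.diff_left[symmetric]
          by (meson norm_blinfun order_trans mult_right_mono norm_ge_zero)
      qed
      then show "norm (blinfun_apply (X n - Blinfun v) x) \<le> e / 2 * norm x"
        by (simp add: blinfun.diff_left app)
    qed (use \<open>0 < e\<close> in simp)
    then show "\<exists>N. \<forall>n\<ge>N. norm (X n - Blinfun v) < e"
      using \<open>0 < e\<close> by (intro exI[of _ N] allI impI le_less_trans[OF \<open>\<And>n. N \<le> n \<Longrightarrow> _\<close>]) auto
  qed
  then show ?thesis by (rule that)
qed

text \<open>If \<open>(T - l) B\<close> decays and \<open>\<bar>l\<bar> \<ge> 1\<close>, then \<open>l\<^sup>-\<^sup>n T\<^sup>n B\<close> is a Cauchy sequence.\<close>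

lemma geom_decay_limit:
  fixes T :: "'a::complex_normed_vector \<Rightarrow>\<^sub>L 'a"
  assumes compl: "complete (UNIV :: 'a set)" and T: "T \<in> bounded_ops" and l: "cmod l \<ge> 1"
    and dec: "geom_decay T ((T - l *\<^sub>C id_blinfun) o\<^sub>L B)" and BT: "B o\<^sub>L T = T o\<^sub>L B"
    and B: "B \<in> bounded_ops"
  obtains D K r where "D o\<^sub>L T = l *\<^sub>C D" "D \<in> bounded_ops" "0 \<le> K" "0 < r" "r < 1"
    "\<And>n. norm ((op_power T n o\<^sub>L B) - l ^ n *\<^sub>C D) \<le> K * r ^ n"
proof -
  obtain K r where K: "0 \<le> K" and r: "0 < r" "r < 1"
    and bnd: "\<And>n. norm (op_power T n o\<^sub>L ((T - l *\<^sub>C id_blinfun) o\<^sub>L B)) \<le> K * r ^ n"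
    using dec by (rule geom_decayE) metis
  have l0: "l \<noteq> 0" using l by auto
  define X where "X n = inverse l ^ n *\<^sub>C (op_power T n o\<^sub>L B)" for n
  \<comment> \<open>A majorant of the tail after \<open>X n\<close>: each increment of
    \<open>X\<close> is at most \<open>q n - q (Suc n)\<close>, so the estimates telescope.
    Multiplied by \<open>\<bar>l\<bar>^n\<close> it becomes the final bound
    \<open>K / (1 - r) * r^n\<close>.\<close>
  define q where "q n = K / (1 - r) * (r ^ n / cmod l ^ n)" for n
  have lX: "l ^ n *\<^sub>C X n = op_power T n o\<^sub>L B" for n
    using l0 by (simp add: X_def scaleC_simps power_inverse)
  have step: "norm (X n - X (Suc n)) \<le> q n - q (Suc n)" for n
  proof -
    have "X (Suc n) - X n = inverse l ^ Suc n *\<^sub>C (op_power T n o\<^sub>L ((T - l *\<^sub>C id_blinfun) o\<^sub>L B))"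
      using T l0 by (simp add: X_def op_power_Suc2 compose_simps compose_scaleC_left compose_scaleC_right
          blinfun_compose_assoc scaleC_simps)
    then have "norm (X n - X (Suc n)) = inverse (cmod l) ^ Suc n
        * norm (op_power T n o\<^sub>L ((T - l *\<^sub>C id_blinfun) o\<^sub>L B))"
      by (subst norm_minus_commute) (simp add: norm_scaleC norm_power norm_inverse norm_mult)
    also have "\<dots> \<le> inverse (cmod l) ^ Suc n * (K * r ^ n)"
      using bnd by (intro mult_left_mono) auto
    also have "\<dots> \<le> inverse (cmod l) ^ n * (K * r ^ n)"
      using K r l by (intro mult_right_mono power_decreasing) (auto simp: inverse_le_1_iff)
    also have "\<dots> = q n * (1 - r)"
      using r l0 by (simp add: q_def power_inverse divide_inverse)
    also have "\<dots> \<le> q n * (1 - r / cmod l)"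
    proof (rule mult_left_mono)
      have "r / cmod l \<le> r / 1" using l r by (intro divide_left_mono) auto
      then show "1 - r \<le> 1 - r / cmod l" by simp
    qed (use K r in \<open>auto simp: q_def\<close>)
    also have "\<dots> = q n - q (Suc n)" by (simp add: q_def diff_divide_distrib algebra_simps)
    finally show ?thesis .
  qed
  have tele: "norm (X n - X (n + m)) \<le> q n - q (n + m)" for n m
  proof (induction m)
    case (Suc m)
    have "norm (X n - X (n + Suc m)) \<le> norm (X n - X (n + m)) + norm (X (n + m) - X (Suc (n + m)))"
      using norm_triangle_ineq[of "X n - X (n + m)" "X (n + m) - X (Suc (n + m))"] by simp
    also have "\<dots> \<le> q n - q (n + Suc m)" using Suc step[of "n + m"] by simp
    finally show ?case .
  qed simp
  have q0: "0 \<le> q n" for n using K r by (auto simp: q_def)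
  have near: "norm (X n - X (n + m)) \<le> q n" for n m
    using tele[of n m] q0[of "n + m"] by linarith
  have "(\<lambda>n. K / (1 - r) * (r / cmod l) ^ n) \<longlonglongrightarrow> K / (1 - r) * 0"
    using r l by (intro tendsto_mult tendsto_const LIMSEQ_power_zero) (auto simp: divide_less_eq)
  then have qlim: "q \<longlonglongrightarrow> 0" by (simp add: q_def[abs_def] power_divide)
  have "Cauchy X"
  proof (rule CauchyI')
    fix e :: real assume "0 < e"
    then obtain N where N: "\<And>n. n \<ge> N \<Longrightarrow> q n < e"
      using qlim q0 by (force dest!: LIMSEQ_D)
    show "\<exists>M. \<forall>m\<ge>M. \<forall>n>m. dist (X m) (X n) < e"
      using N near by (metis dist_norm le_less_trans less_imp_le le_Suc_ex)
  qed
  then obtain D where D: "X \<longlonglongrightarrow> D"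
    using complete_imp_blinfun_Cauchy_convergent[OF compl] by metis
  have "D o\<^sub>L T = l *\<^sub>C D"
  proof (rule LIMSEQ_unique)
    show "(\<lambda>n. X n o\<^sub>L T) \<longlonglongrightarrow> (D o\<^sub>L T)"
      by (intro bounded_bilinear.tendsto[OF bounded_bilinear_blinfun_compose] D tendsto_const)
    have "X n o\<^sub>L T = l *\<^sub>C X (Suc n)" for n
      using l0 BT by (simp add: X_def op_power_Suc2 compose_scaleC_left scaleC_simps blinfun_compose_assoc)
    then show "(\<lambda>n. X n o\<^sub>L T) \<longlonglongrightarrow> l *\<^sub>C D"
      using bounded_linear.tendsto[OF bounded_linear_scaleC LIMSEQ_Suc[OF D]] by simp
  qed
  moreover have "D \<in> bounded_ops"
    by (rule bounded_ops_limit[OF _ D]) (use T B in \<open>auto simp: X_def\<close>)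
  moreover have "norm ((op_power T n o\<^sub>L B) - l ^ n *\<^sub>C D) \<le> K / (1 - r) * r ^ n" for n
  proof -
    have "(\<lambda>m. norm (X n - X (m + n))) \<longlonglongrightarrow> norm (X n - D)"
      by (intro tendsto_intros LIMSEQ_ignore_initial_segment D)
    then have "norm (X n - D) \<le> q n"
      by (rule LIMSEQ_le_const2) (metis near add.commute)
    then have "cmod l ^ n * norm (X n - D) \<le> cmod l ^ n * q n" by (intro mult_left_mono) auto
    moreover have "cmod l ^ n * norm (X n - D) = norm ((op_power T n o\<^sub>L B) - l ^ n *\<^sub>C D)"
      by (simp flip: lX norm_power norm_scaleC scaleC_diff_right)
    ultimately show ?thesis using l0 by (simp add: q_def)
  qed
  moreover have "0 \<le> K / (1 - r)" using K r by simp
  ultimately show ?thesis using r by (intro that)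
qed

section \<open>The Baire argument\<close>

lemma Baire_countable_closed_cover:
  fixes O' :: "'a::metric_space set"
  assumes "complete (UNIV :: 'a set)" "countable \<G>" "\<And>F. F \<in> \<G> \<Longrightarrow> closed F"
    and "open O'" "O' \<noteq> {}" "O' \<subseteq> \<Union>\<G>"
  shows "\<exists>F\<in>\<G>. interior F \<noteq> {}"
proof (rule ccontr)
  assume neg: "\<not> ?thesis"
  have "Met_TC.mcomplete TYPE('a)"
    using assms(1) by (simp add: mcomplete_iff_complete)
  then have "interior (\<Union>\<G>) = {}"
    using Met_TC.metric_Baire_category_alt[of \<G>] neg assms(2,3) by simp
  moreover have "O' \<subseteq> interior (\<Union>\<G>)" using assms by (simp add: interior_maximal)
  ultimately show False using assms(5) by auto
qed

text \<open>Every \<open>x\<close> is a multiple of a difference of two points of \<open>O'\<close>,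
  on both of which \<open>A\<close> vanishes.\<close>

lemma blinfun_kernel_interior:
  fixes A :: "'a::real_normed_vector \<Rightarrow>\<^sub>L 'b::real_normed_vector"
  assumes "open O'" "O' \<noteq> {}" "\<And>x. x \<in> O' \<Longrightarrow> blinfun_apply A x = 0"
  shows "A = 0"
proof (rule blinfun_eqI)
  fix x :: 'a
  obtain a e where a: "a \<in> O'" and e: "e > 0" "ball a e \<subseteq> O'"
    using assms(1,2) by (metis all_not_in_conv openE)
  \<comment> \<open>Small enough to keep \<open>a + t x\<close> in the ball; the summand 1 covers
    \<open>x = 0\<close>.\<close>
  define t where "t = e / (2 * (norm x + 1))"
  have "0 < norm x + 1" using norm_ge_zero[of x] by linarith
  then have t: "t > 0" using e by (simp add: t_def)
  have "t * norm x < t * (2 * (norm x + 1))"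
    using t norm_ge_zero[of x] by (intro mult_strict_left_mono) (use \<open>0 < norm x + 1\<close> in simp_all)
  also have "\<dots> = e" using \<open>0 < norm x + 1\<close> by (simp add: t_def)
  finally have "a + t *\<^sub>R x \<in> O'" using e t by (auto simp: dist_norm subset_iff)
  then have "blinfun_apply A (a + t *\<^sub>R x) = 0" "blinfun_apply A a = 0" using assms(3) a by auto
  then show "blinfun_apply A x = blinfun_apply 0 x"
    using t by (simp add: blinfun.bilinear_simps)
qed

lemma open_blinfun_nonzero:
  "open {x. blinfun_apply (A :: 'a::real_normed_vector \<Rightarrow>\<^sub>L 'b::real_normed_vector) x \<noteq> 0}"
  by (intro open_Collect_neq continuous_intros)

text \<open>The kernel of a nonzero operator is closed without interior. The induction therefore
  shrinks \<open>O'\<close> to its nonempty open part off one kernel at a time.\<close>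

lemma blinfun_finite_generic_point:
  fixes D :: "'i \<Rightarrow> 'a::real_normed_vector \<Rightarrow>\<^sub>L 'b::real_normed_vector"
  assumes "finite I" "\<And>i. i \<in> I \<Longrightarrow> D i \<noteq> 0" "open O'" "O' \<noteq> {}"
  shows "\<exists>x\<in>O'. \<forall>i\<in>I. blinfun_apply (D i) x \<noteq> 0"
  using assms
proof (induction I arbitrary: O' rule: finite_induct)
  case (insert i I)
  have "O' \<inter> {x. blinfun_apply (D i) x \<noteq> 0} \<noteq> {}"
    using blinfun_kernel_interior[OF insert.prems(2,3), of "D i"] insert.prems(1) by auto
  then show ?case
    using insert.IH[of "O' \<inter> {x. blinfun_apply (D i) x \<noteq> 0}"] insert.prems open_blinfun_nonzero
    by (auto simp: open_Int)
qed auto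

text \<open>The countably many closed sets \<open>ker (S - A)\<close>, with \<open>A\<close> in the
  orbit, have empty interior, so they cannot cover \<open>O'\<close>. At a point \<open>x\<close>
  outside all of them \<open>S x\<close> lies in the closure of the orbit of \<open>x\<close> but
  differs from each of its members, so it is approximated by arbitrarily late ones.\<close>

lemma nullOrbRef_cluster_point:
  fixes T :: "'a::complex_normed_vector \<Rightarrow>\<^sub>L 'a"
  assumes compl: "complete (UNIV :: 'a set)" and S: "S \<in> nullOrbRef T" "S \<notin> nullOrb T"
    and O': "open O'" "O' \<noteq> {}"
  shows "\<exists>x\<in>O'. \<forall>e>0. \<forall>N. \<exists>n\<ge>N. norm (blinfun_apply (op_power T n) x - blinfun_apply S x) < e"
proof -
  have "\<not> O' \<subseteq> \<Union> ((\<lambda>A. {x. blinfun_apply (S - A) x = 0}) ` nullOrb T)"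
  proof
    assume cover: "O' \<subseteq> \<Union> ((\<lambda>A. {x. blinfun_apply (S - A) x = 0}) ` nullOrb T)"
    have "countable (nullOrb T)" by (simp add: nullOrb_def)
    then have cnt: "countable ((\<lambda>A. {x. blinfun_apply (S - A) x = 0}) ` nullOrb T)" by simp
    have cl: "closed {x. blinfun_apply (S - A) x = 0}" for A
      by (intro closed_Collect_eq continuous_intros)
    have "\<exists>F\<in>(\<lambda>A. {x. blinfun_apply (S - A) x = 0}) ` nullOrb T. interior F \<noteq> {}"
      by (rule Baire_countable_closed_cover[OF compl cnt _ O' cover]) (use cl in auto)
    then obtain A where A: "A \<in> nullOrb T" "interior {x. blinfun_apply (S - A) x = 0} \<noteq> {}"
      by auto
    have "S - A = 0"
      by (rule blinfun_kernel_interior[OF open_interior A(2)]) (use interior_subset in blast)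
    with A S show False by simp
  qed
  then obtain x where x: "x \<in> O'" and ne: "\<And>A. A \<in> nullOrb T \<Longrightarrow> blinfun_apply S x \<noteq> blinfun_apply A x"
    by (auto simp: blinfun.diff_left)
  have "\<exists>n\<ge>N. norm (blinfun_apply (op_power T n) x - blinfun_apply S x) < e" if "e > 0" for e N
  proof -
    \<comment> \<open>The zero vector and the first \<open>N\<close> orbit points form a finite,
      hence closed set that misses \<open>S x\<close>, so \<open>S x\<close> lies in the closure of
      the tail.\<close>
    define F where "F = insert 0 ((\<lambda>n. blinfun_apply (op_power T n) x) ` {..<N})"
    have "finite F" by (simp add: F_def)
    define G where "G = (\<lambda>n. blinfun_apply (op_power T n) x) ` {N..}"
    have split: "(\<lambda>A. blinfun_apply A x) ` nullOrb T = F \<union> G"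
    proof -
      have "range (op_power T) = op_power T ` ({..<N} \<union> {N..})"
        by (rule arg_cong[of _ _ "(`) _"]) auto
      then show ?thesis by (simp add: nullOrb_def F_def G_def image_Un image_image)
    qed
    have "blinfun_apply S x \<in> closure (F \<union> G)"
      using S unfolding nullOrbRef_def split[symmetric] by auto
    also have "closure (F \<union> G) = F \<union> closure G"
      using finite_imp_closed[OF \<open>finite F\<close>] by (simp only: closure_Un closure_closed)
    finally have "blinfun_apply S x \<in> closure G"
      using ne[of 0] ne[of "op_power T _"] by (auto simp: F_def nullOrb_def)
    then show ?thesis
      using that by (auto simp: closure_approachable G_def dist_norm)
  qed
  then show ?thesis using x by blast
qed

text \<open>A cluster point of \<open>T^n x\<close> keeps \<open>T^n x\<close>, and with it
  \<open>B T^n x\<close>, bounded for infinitely many \<open>n\<close>. The auxiliary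
  \<open>B\<close> is there because escape will be visible only after applying a polynomial in
  \<open>T\<close>.\<close>

lemma nullOrbRef_escaping_orbits:
  fixes T :: "'a::complex_normed_vector \<Rightarrow>\<^sub>L 'a"
  assumes compl: "complete (UNIV :: 'a set)" and S: "S \<in> nullOrbRef T"
    and O': "open O'" "O' \<noteq> {}"
    and esc: "\<And>x. x \<in> O' \<Longrightarrow> filterlim (\<lambda>n. norm (blinfun_apply (B o\<^sub>L op_power T n) x)) at_top sequentially"
  shows "S \<in> nullOrb T"
proof (rule ccontr)
  assume "S \<notin> nullOrb T"
  then obtain x where x: "x \<in> O'"
    and cl: "\<And>e N. e > 0 \<Longrightarrow> \<exists>n\<ge>N. norm (blinfun_apply (op_power T n) x - blinfun_apply S x) < e"
    using nullOrbRef_cluster_point[OF compl S _ O'] by blast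
  define M where "M = norm B * (norm (blinfun_apply S x) + 1)"
  have "eventually (\<lambda>n. norm (blinfun_apply (B o\<^sub>L op_power T n) x) > M) sequentially"
    using esc[OF x] by (simp add: filterlim_at_top_dense)
  then obtain N where N: "\<And>n. n \<ge> N \<Longrightarrow> norm (blinfun_apply (B o\<^sub>L op_power T n) x) > M"
    by (auto simp: eventually_sequentially)
  obtain n where n: "n \<ge> N" "norm (blinfun_apply (op_power T n) x - blinfun_apply S x) < 1"
    using cl[of 1 N] by auto
  have "norm (blinfun_apply (op_power T n) x) \<le> norm (blinfun_apply S x) + 1"
    using n(2) norm_triangle_ineq2[of "blinfun_apply (op_power T n) x" "blinfun_apply S x"] by linarith
  then have "norm (blinfun_apply (B o\<^sub>L op_power T n) x) \<le> M"
    unfolding M_def by (simp add: order_trans[OF norm_blinfun] mult_left_mono)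
  with N[OF n(1)] show False by simp
qed

text \<open>Fix \<open>x0\<close> with \<open>B x0\<close> nonzero and let \<open>c\<close> be its
  scalar. If \<open>B x\<close> is a multiple of \<open>B x0\<close>, a translate of
  \<open>x\<close> lies in the kernel of \<open>B\<close>, hence in that of \<open>A\<close>, so
  \<open>c\<close> serves for \<open>x\<close>. Otherwise \<open>B x\<close> and \<open>B x0\<close>
  are independent, and evaluating at \<open>x + x0\<close> equates both scalars.\<close>

lemma locally_dependent_imp_scalar_multiple:
  fixes A B :: "'a::complex_normed_vector \<Rightarrow>\<^sub>L 'a"
  assumes ops: "A \<in> bounded_ops" "B \<in> bounded_ops"
    and dep: "\<And>x. \<exists>c. blinfun_apply A x = c *\<^sub>C blinfun_apply B x"
  shows "\<exists>c. A = c *\<^sub>C B"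
proof (cases "B = 0")
  case True
  then have "A = 0" using dep by (auto intro!: blinfun_eqI)
  with True show ?thesis by auto
next
  case False
  then obtain x0 where x0: "blinfun_apply B x0 \<noteq> 0" by (metis blinfun_eqI zero_blinfun.rep_eq)
  obtain c where c: "blinfun_apply A x0 = c *\<^sub>C blinfun_apply B x0" using dep by blast
  have "blinfun_apply A x = c *\<^sub>C blinfun_apply B x" for x
  proof (cases "\<exists>a. blinfun_apply B x = a *\<^sub>C blinfun_apply B x0")
    case True
    then obtain a where a: "blinfun_apply B x = a *\<^sub>C blinfun_apply B x0" by blast
    have "blinfun_apply B (x - a *\<^sub>C x0) = 0" using ops a by (simp add: blinfun.diff_right bounded_opsD)
    then have "blinfun_apply A (x - a *\<^sub>C x0) = 0" using dep[of "x - a *\<^sub>C x0"] by auto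
    then show ?thesis using ops a c
      by (simp add: blinfun.diff_right bounded_opsD scaleC_scaleC mult.commute)
  next
    case indep: False
    obtain d where d: "blinfun_apply A x = d *\<^sub>C blinfun_apply B x" using dep by blast
    obtain e where e: "blinfun_apply A (x + x0) = e *\<^sub>C blinfun_apply B (x + x0)" using dep by blast
    have eq: "(d - e) *\<^sub>C blinfun_apply B x = (e - c) *\<^sub>C blinfun_apply B x0"
      using c d e by (simp add: blinfun.add_right scaleC_simps algebra_simps)
    have "d = e"
    proof (rule ccontr)
      assume "d \<noteq> e"
      then have "blinfun_apply B x = inverse (d - e) *\<^sub>C ((d - e) *\<^sub>C blinfun_apply B x)"
        by (simp add: scaleC_scaleC scaleC_one)
      with indep show False unfolding eq by (auto simp: scaleC_scaleC)
    qed
    with eq have "(e - c) *\<^sub>C blinfun_apply B x0 = 0" by simp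
    then have "cmod (e - c) * norm (blinfun_apply B x0) = 0" by (metis norm_scaleC norm_zero)
    with x0 \<open>d = e\<close> d show ?thesis by simp
  qed
  then have "A = c *\<^sub>C B" by (intro blinfun_eqI) (simp add: scaleC_blinfun_apply)
  then show ?thesis ..
qed

text \<open>The strong closure of the orbit lies in \<open>nullOrbRef T\<close> for every
  \<open>T\<close>, because evaluations are strongly continuous. For the converse a norm limit
  suffices, the norm topology being finer.\<close>

lemma null_orbit_reflexiveI:
  assumes T: "T \<in> bounded_ops" and lim: "\<And>S. S \<in> nullOrbRef T \<Longrightarrow> S \<in> closure (nullOrb T)"
  shows "null_orbit_reflexive T"
  unfolding null_orbit_reflexive_def
proof (intro equalityI subsetI)
  fix S assume S: "S \<in> nullOrbRef T"
  have "\<exists>A\<in>nullOrb T. A \<in> U" if "S \<in> U" "openin (subtopology strong_operator_topology bounded_ops) U" for U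
  proof -
    obtain V where V: "openin strong_operator_topology V" "U = V \<inter> bounded_ops"
      using \<open>openin _ U\<close> by (auto simp: openin_subtopology)
    have "open V"
      using openin_continuous_map_preimage[OF strong_operator_topology_weaker_than_euclidean V(1)] by simp
    then have "V \<inter> nullOrb T \<noteq> {}"
      using lim[OF S] \<open>S \<in> U\<close> V(2) open_Int_closure_eq_empty[of V "nullOrb T"] by blast
    then obtain A where "A \<in> nullOrb T" "A \<in> V" by blast
    moreover have "nullOrb T \<subseteq> bounded_ops" using T by (auto simp: nullOrb_def)
    ultimately show ?thesis using V(2) by blast
  qed
  then show "S \<in> subtopology strong_operator_topology bounded_ops closure_of nullOrb T"
    using S by (auto simp: in_closure_of nullOrbRef_def strong_operator_topology_topspace)
next
  fix S assume S: "S \<in> subtopology strong_operator_topology bounded_ops closure_of nullOrb T"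
  then have SB: "S \<in> bounded_ops" by (simp add: in_closure_of)
  have meets: "\<exists>A. A \<in> nullOrb T \<and> A \<in> U"
    if "openin (subtopology strong_operator_topology bounded_ops) U" "S \<in> U" for U
    using S that unfolding in_closure_of by blast
  have "blinfun_apply S x \<in> closure ((\<lambda>A. blinfun_apply A x) ` nullOrb T)" for x
    unfolding closure_approachable
  proof (intro allI impI)
    fix e :: real assume "e > 0"
    have "openin strong_operator_topology {A \<in> topspace strong_operator_topology. blinfun_apply A x \<in> ball (blinfun_apply S x) e}"
      by (rule openin_continuous_map_preimage[OF strong_operator_topology_continuous_evaluation]) simp
    then have "openin (subtopology strong_operator_topology bounded_ops)
        ({A. blinfun_apply A x \<in> ball (blinfun_apply S x) e} \<inter> bounded_ops)"
      by (auto simp: openin_subtopology strong_operator_topology_topspace)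
    moreover have "S \<in> {A. blinfun_apply A x \<in> ball (blinfun_apply S x) e} \<inter> bounded_ops"
      using \<open>e > 0\<close> SB by simp
    ultimately have "\<exists>A. A \<in> nullOrb T \<and> A \<in> {A. blinfun_apply A x \<in> ball (blinfun_apply S x) e} \<inter> bounded_ops"
      by (intro meets)
    then obtain A where "A \<in> nullOrb T" "blinfun_apply A x \<in> ball (blinfun_apply S x) e" by blast
    then show "\<exists>y\<in>(\<lambda>A. blinfun_apply A x) ` nullOrb T. dist y (blinfun_apply S x) < e"
      by (auto simp: dist_commute)
  qed
  then show "S \<in> nullOrbRef T"
    using SB by (simp add: nullOrbRef_def)
qed

section \<open>Null-orbit reflexivity from geometric decay\<close>

lemma poly_op_split_root:
  assumes "T \<in> bounded_ops"
  shows "poly_op ([:-l, 1:] * q) T = (T - l *\<^sub>C id_blinfun) o\<^sub>L poly_op q T"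
  using assms by (simp only: poly_op_mult poly_op_linear)

text \<open>Here \<open>T^n q(T) = l^n D + O(r^n)\<close>, and \<open>D\<close> is nonzero since
  otherwise \<open>T^n q(T)\<close> would decay. So \<open>q(T) T^n x\<close> grows like
  \<open>\<bar>l\<bar>^n\<close> on the open set where \<open>D x\<close> is nonzero.\<close>

lemma geom_decay_root_gt_1:
  fixes T :: "'a::complex_normed_vector \<Rightarrow>\<^sub>L 'a"
  assumes compl: "complete (UNIV :: 'a set)" and T: "T \<in> bounded_ops" and S: "S \<in> nullOrbRef T"
    and l: "cmod l > 1" and dec: "geom_decay T (poly_op ([:-l, 1:] * q) T)"
    and ndec: "\<not> geom_decay T (poly_op q T)"
  shows "S \<in> nullOrb T"
proof -
  have l1: "cmod l \<ge> 1" using l by simp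
  obtain D K r where D: "0 \<le> K" "0 < r" "r < 1"
    "\<And>n. norm ((op_power T n o\<^sub>L poly_op q T) - l ^ n *\<^sub>C D) \<le> K * r ^ n"
    by (rule geom_decay_limit[OF compl T l1 dec[unfolded poly_op_split_root[OF T]]
          poly_op_commute_self[OF T] poly_op_in_bounded_ops[OF T]]) blast
  have "D \<noteq> 0"
    using D ndec unfolding geom_decay_def by (metis diff_zero scaleC_right_zero less_imp_le)
  show ?thesis
  proof (rule nullOrbRef_escaping_orbits[OF compl S open_blinfun_nonzero])
    show "{x. blinfun_apply D x \<noteq> 0} \<noteq> {}"
      using \<open>D \<noteq> 0\<close> by (auto intro: blinfun_eqI)
    fix x assume "x \<in> {x. blinfun_apply D x \<noteq> 0}"
    then have Dx: "0 < norm (blinfun_apply D x)" by simp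
    show "filterlim (\<lambda>n. norm (blinfun_apply (poly_op q T o\<^sub>L op_power T n) x)) at_top sequentially"
    proof (rule filterlim_at_top_mono)
      have "filterlim (\<lambda>n. norm (blinfun_apply D x) * cmod l ^ n) at_top sequentially"
        using filterlim_compose[OF filterlim_norm_at_top filterlim_realpow_sequentially_gt1[OF l]]
        by (intro filterlim_tendsto_pos_mult_at_top[OF tendsto_const Dx]) (simp add: norm_power)
      then show "filterlim (\<lambda>n. - (K * norm x) + norm (blinfun_apply D x) * cmod l ^ n) at_top sequentially"
        by (rule filterlim_tendsto_add_at_top[OF tendsto_const])
      show "\<forall>\<^sub>F n in sequentially. - (K * norm x) + norm (blinfun_apply D x) * cmod l ^ n
          \<le> norm (blinfun_apply (poly_op q T o\<^sub>L op_power T n) x)"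
      proof (rule always_eventually, rule allI)
        fix n
        let ?R = "(op_power T n o\<^sub>L poly_op q T) - l ^ n *\<^sub>C D"
        have "norm ?R \<le> K * 1" using D by (intro order_trans[OF D(4)] mult_left_mono power_le_one) auto
        then have "norm (blinfun_apply ?R x) \<le> K * norm x"
          by (intro order_trans[OF norm_blinfun] mult_right_mono) auto
        moreover have "blinfun_apply (poly_op q T o\<^sub>L op_power T n) x
            = blinfun_apply ?R x + l ^ n *\<^sub>C blinfun_apply D x"
          by (simp add: poly_op_power_commute[OF T] blinfun.diff_left scaleC_blinfun_apply)
        ultimately show "- (K * norm x) + norm (blinfun_apply D x) * cmod l ^ n
          \<le> norm (blinfun_apply (poly_op q T o\<^sub>L op_power T n) x)"
          using norm_diff_ineq[of "l ^ n *\<^sub>C blinfun_apply D x" "blinfun_apply ?R x"]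
          by (simp add: norm_scaleC norm_power add.commute mult.commute)
      qed
    qed
  qed
qed

text \<open>With \<open>B = q(T)\<close> and \<open>A = (T - l) B\<close>, the recurrence
  \<open>T^(n+1) B = l T^n B + T^n A\<close> has a forcing term close to \<open>l^n D\<close>. This
  is resonance: \<open>T^n B\<close> behaves like \<open>n l^(n-1) D\<close> and grows linearly
  where \<open>D x\<close> is nonzero.\<close>

lemma geom_decay_double_root:
  fixes T :: "'a::complex_normed_vector \<Rightarrow>\<^sub>L 'a"
  assumes compl: "complete (UNIV :: 'a set)" and T: "T \<in> bounded_ops" and S: "S \<in> nullOrbRef T"
    and l: "cmod l = 1" and dec: "geom_decay T (poly_op ([:-l, 1:] * ([:-l, 1:] * q)) T)"
    and ndec: "\<not> geom_decay T (poly_op ([:-l, 1:] * q) T)"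
  shows "S \<in> nullOrb T"
proof -
  have l1: "cmod l \<ge> 1" using l by simp
  define A where "A = poly_op ([:-l, 1:] * q) T"
  define B where "B = poly_op q T"
  have AB: "A = (T - l *\<^sub>C id_blinfun) o\<^sub>L B" by (simp only: A_def B_def poly_op_split_root[OF T])
  have [simp]: "A \<in> bounded_ops" "B \<in> bounded_ops" using T by (simp_all add: A_def B_def)
  obtain D K r where D: "0 \<le> K" "0 < r" "r < 1"
    "\<And>n. norm ((op_power T n o\<^sub>L A) - l ^ n *\<^sub>C D) \<le> K * r ^ n"
    unfolding A_def
    by (rule geom_decay_limit[OF compl T l1 dec[unfolded poly_op_split_root[OF T, of l "[:-l, 1:] * q"]]
          poly_op_commute_self[OF T] poly_op_in_bounded_ops[OF T]]) blast
  have "D \<noteq> 0"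
    using D ndec unfolding geom_decay_def A_def by (metis diff_zero scaleC_right_zero less_imp_le)
  \<comment> \<open>The deviation from the resonant growth, multiplied by \<open>l\<close> to avoid
    the exponent \<open>n - 1\<close>. It satisfies
    \<open>Y (Suc n) = l (Y n + (T^n A - l^n D))\<close>, so with \<open>\<bar>l\<bar> = 1\<close>
    its norm grows at most by the summable \<open>K r^n\<close>.\<close>
  define Y where "Y n = l *\<^sub>C (op_power T n o\<^sub>L B) - (of_nat n * l ^ n) *\<^sub>C D" for n
  define M where "M = norm B + K / (1 - r)"
  have "norm (Y n) \<le> norm B + K * (1 - r ^ n) / (1 - r)" for n
  proof (induction n)
    case 0
    then show ?case using l by (simp add: Y_def norm_scaleC)
  next
    case (Suc n)
    have "Y (Suc n) = l *\<^sub>C (Y n + ((op_power T n o\<^sub>L A) - l ^ n *\<^sub>C D))"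
      using T by (simp add: Y_def AB op_power_Suc2 compose_simps compose_scaleC_left compose_scaleC_right
          blinfun_compose_assoc scaleC_simps algebra_simps)
    then have "norm (Y (Suc n)) \<le> norm (Y n) + K * r ^ n"
      using D(4)[of n] l norm_triangle_ineq[of "Y n" "(op_power T n o\<^sub>L A) - l ^ n *\<^sub>C D"]
      by (simp add: norm_scaleC)
    also have "\<dots> \<le> norm B + K * (1 - r ^ n) / (1 - r) + K * r ^ n" using Suc by simp
    also have "\<dots> = norm B + K * (1 - r ^ Suc n) / (1 - r)" using D by (simp add: field_simps)
    finally show ?case .
  qed
  moreover have "norm B + K * (1 - r ^ n) / (1 - r) \<le> M" for n
    unfolding M_def using D by (intro add_left_mono divide_right_mono) (auto intro!: mult_left_le)
  ultimately have Y: "norm (Y n) \<le> M" for n using order_trans by blast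
  show ?thesis
  proof (rule nullOrbRef_escaping_orbits[OF compl S open_blinfun_nonzero])
    show "{x. blinfun_apply D x \<noteq> 0} \<noteq> {}"
      using \<open>D \<noteq> 0\<close> by (auto intro: blinfun_eqI)
    fix x assume "x \<in> {x. blinfun_apply D x \<noteq> 0}"
    then have Dx: "0 < norm (blinfun_apply D x)" by simp
    show "filterlim (\<lambda>n. norm (blinfun_apply (B o\<^sub>L op_power T n) x)) at_top sequentially"
    proof (rule filterlim_at_top_mono)
      have "filterlim (\<lambda>n. norm (blinfun_apply D x) * real n) at_top sequentially"
        by (rule filterlim_tendsto_pos_mult_at_top[OF tendsto_const Dx filterlim_real_sequentially])
      then show "filterlim (\<lambda>n. - (M * norm x) + norm (blinfun_apply D x) * real n) at_top sequentially"
        by (rule filterlim_tendsto_add_at_top[OF tendsto_const])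
      show "\<forall>\<^sub>F n in sequentially. - (M * norm x) + norm (blinfun_apply D x) * real n
          \<le> norm (blinfun_apply (B o\<^sub>L op_power T n) x)"
      proof (rule always_eventually, rule allI)
        fix n
        have "norm (blinfun_apply (Y n) x) \<le> M * norm x"
          using Y by (intro order_trans[OF norm_blinfun] mult_right_mono) auto
        moreover have "l *\<^sub>C blinfun_apply (B o\<^sub>L op_power T n) x
            = blinfun_apply (Y n) x + (of_nat n * l ^ n) *\<^sub>C blinfun_apply D x"
          using poly_op_power_commute[OF T, of q n]
          by (simp add: Y_def B_def blinfun.diff_left scaleC_blinfun_apply)
        then have "norm (blinfun_apply (B o\<^sub>L op_power T n) x)
            = norm (blinfun_apply (Y n) x + (of_nat n * l ^ n) *\<^sub>C blinfun_apply D x)"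
          using l by (metis norm_scaleC mult_1)
        ultimately show "- (M * norm x) + norm (blinfun_apply D x) * real n
          \<le> norm (blinfun_apply (B o\<^sub>L op_power T n) x)"
          using norm_diff_ineq[of "(of_nat n * l ^ n) *\<^sub>C blinfun_apply D x" "blinfun_apply (Y n) x"] l
          by (simp add: norm_scaleC norm_power norm_mult add.commute mult.commute)
      qed
    qed
  qed
qed

text \<open>The summands are the Lagrange basis polynomials of the nodes \<open>L\<close>. Their sum
  and 1 have degree below \<open>card L\<close> and agree at every node.\<close>

lemma Lagrange_partition_of_unity:
  fixes L :: "complex set"
  assumes "finite L" "L \<noteq> {}"
  shows "(\<Sum>l\<in>L. smult (inverse (\<Prod>z\<in>L - {l}. l - z)) (\<Prod>z\<in>L - {l}. [:-z, 1:])) = 1"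
proof (rule poly_eqI_degree[where A = L])
  fix x assume x: "x \<in> L"
  have "poly (smult (inverse (\<Prod>z\<in>L - {l}. l - z)) (\<Prod>z\<in>L - {l}. [:-z, 1:])) x = (if l = x then 1 else 0)"
    if "l \<in> L" for l
  proof (cases "l = x")
    case True
    then show ?thesis using assms by (simp add: poly_prod)
  next
    case False
    then have "(\<Prod>z\<in>L - {l}. poly [:-z, 1:] x) = 0"
      using assms x by (intro prod_zero) auto
    with False show ?thesis by (simp add: poly_prod)
  qed
  then show "poly (\<Sum>l\<in>L. smult (inverse (\<Prod>z\<in>L - {l}. l - z)) (\<Prod>z\<in>L - {l}. [:-z, 1:])) x = poly 1 x"
    using x assms by (simp add: poly_sum sum.delta')
next
  have "card L > 0" using assms by (simp add: card_gt_0_iff)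
  then show "degree (1 :: complex poly) < card L" by simp
  have "degree (smult (inverse (\<Prod>z\<in>L - {l}. l - z)) (\<Prod>z\<in>L - {l}. [:-z, 1:])) \<le> card L - 1" if "l \<in> L" for l
  proof -
    have "degree (\<Prod>z\<in>L - {l}. [:-z, 1:]) \<le> (\<Sum>z\<in>L - {l}. degree [:-z, 1:])"
      using degree_prod_sum_le[of "L - {l}" "\<lambda>z. [:-z, 1:]"] assms by (simp add: o_def)
    also have "\<dots> = card L - 1" using that assms by simp
    finally show ?thesis by (meson degree_smult_le order_trans)
  qed
  then have "degree (\<Sum>l\<in>L. smult (inverse (\<Prod>z\<in>L - {l}. l - z)) (\<Prod>z\<in>L - {l}. [:-z, 1:])) \<le> card L - 1"
    by (intro degree_sum_le assms)
  then show "degree (\<Sum>l\<in>L. smult (inverse (\<Prod>z\<in>L - {l}. l - z)) (\<Prod>z\<in>L - {l}. [:-z, 1:])) < card L"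
    using \<open>card L > 0\<close> by linarith
qed

text \<open>For the Lagrange polynomial \<open>q l\<close> of a root, \<open>(X - l) * q l\<close>
  is a scalar multiple of \<open>p\<close>, so \<open>T^n q_l(T) = l^n D_l + o(1)\<close>. The
  \<open>q l\<close> sum to 1, so adding these expansions gives \<open>T^n\<close> itself.\<close>

lemma geom_decay_imp_decomposition:
  fixes T :: "'a::complex_normed_vector \<Rightarrow>\<^sub>L 'a"
  assumes compl: "complete (UNIV :: 'a set)" and T: "T \<in> bounded_ops"
    and p: "p \<noteq> 0" "rsquarefree p" "geom_decay T (poly_op p T)"
    and unimod: "\<And>l. poly p l = 0 \<Longrightarrow> cmod l = 1"
  shows "\<exists>D. (\<forall>l. poly p l = 0 \<longrightarrow> D l \<in> bounded_ops \<and> D l o\<^sub>L T = l *\<^sub>C D l) \<and>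
    (\<lambda>n. op_power T n - (\<Sum>l | poly p l = 0. l ^ n *\<^sub>C D l)) \<longlonglongrightarrow> 0"
proof -
  define L where "L = {l. poly p l = 0}"
  have fin: "finite L" using p by (simp add: L_def poly_roots_finite)
  define q where "q l = smult (inverse (\<Prod>z\<in>L - {l}. l - z)) (\<Prod>z\<in>L - {l}. [:-z, 1:])" for l
  have p_eq: "p = smult (lead_coeff p) (\<Prod>z\<in>L. [:-z, 1:])"
    using complex_poly_decompose_rsquarefree[OF p(2)] by (simp add: L_def)
  have "\<exists>D. D \<in> bounded_ops \<and> D o\<^sub>L T = l *\<^sub>C D \<and>
      (\<lambda>n. (op_power T n o\<^sub>L poly_op (q l) T) - l ^ n *\<^sub>C D) \<longlonglongrightarrow> 0" if l: "l \<in> L" for l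
  proof -
    define c where "c = inverse (\<Prod>z\<in>L - {l}. l - z)"
    have prod_eq: "[:-l, 1:] * (\<Prod>z\<in>L - {l}. [:-z, 1:]) = (\<Prod>z\<in>L. [:-z, 1:])"
      by (rule prod.remove[OF fin l, symmetric])
    have "[:-l, 1:] * q l = smult c (\<Prod>z\<in>L. [:-z, 1:])"
      unfolding q_def c_def[symmetric] mult_smult_right prod_eq ..
    also have "\<dots> = smult (c / lead_coeff p) p"
      using p(1) by (subst (3) p_eq) simp
    finally have "poly_op ([:-l, 1:] * q l) T = (c / lead_coeff p) *\<^sub>C poly_op p T"
      by (simp only: poly_op_smult)
    then have "geom_decay T (poly_op ([:-l, 1:] * q l) T)"
      using geom_decay_scaleC[OF T p(3)] by simp
    then have dec: "geom_decay T ((T - l *\<^sub>C id_blinfun) o\<^sub>L poly_op (q l) T)"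
      by (simp only: poly_op_split_root[OF T])
    have l1: "cmod l \<ge> 1" using unimod l by (simp add: L_def)
    obtain D K r where D: "D o\<^sub>L T = l *\<^sub>C D" "D \<in> bounded_ops" "0 \<le> K" "0 < r" "r < 1"
      "\<And>n. norm ((op_power T n o\<^sub>L poly_op (q l) T) - l ^ n *\<^sub>C D) \<le> K * r ^ n"
      by (rule geom_decay_limit[OF compl T l1 dec
          poly_op_commute_self[OF T] poly_op_in_bounded_ops[OF T]]) blast
    have "(\<lambda>n. K * r ^ n) \<longlonglongrightarrow> K * 0"
      using D(4,5) by (intro tendsto_mult tendsto_const LIMSEQ_power_zero) auto
    then have "(\<lambda>n. (op_power T n o\<^sub>L poly_op (q l) T) - l ^ n *\<^sub>C D) \<longlonglongrightarrow> 0"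
      by (intro Lim_null_comparison[OF always_eventually, OF allI, OF D(6)]) simp
    with D(1,2) show ?thesis by blast
  qed
  then have "\<exists>D. \<forall>l\<in>L. D l \<in> bounded_ops \<and> D l o\<^sub>L T = l *\<^sub>C D l \<and>
      (\<lambda>n. (op_power T n o\<^sub>L poly_op (q l) T) - l ^ n *\<^sub>C D l) \<longlonglongrightarrow> 0"
    by (intro bchoice ballI)
  then obtain D where D: "\<And>l. l \<in> L \<Longrightarrow> D l \<in> bounded_ops" "\<And>l. l \<in> L \<Longrightarrow> D l o\<^sub>L T = l *\<^sub>C D l"
    "\<And>l. l \<in> L \<Longrightarrow> (\<lambda>n. (op_power T n o\<^sub>L poly_op (q l) T) - l ^ n *\<^sub>C D l) \<longlonglongrightarrow> 0"
    by blast
  have "(\<lambda>n. op_power T n - (\<Sum>l\<in>L. l ^ n *\<^sub>C D l)) \<longlonglongrightarrow> 0"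
  proof (cases "L = {}")
    case True
    \<comment> \<open>Without roots \<open>p\<close> is a nonzero constant, and the decay hypothesis
      concerns the powers of \<open>T\<close> themselves.\<close>
    then have const: "p = [:lead_coeff p:]" using p_eq by simp
    have "poly_op p T = lead_coeff p *\<^sub>C id_blinfun"
      by (subst const) (simp add: poly_op_pCons[OF T])
    then have "inverse (lead_coeff p) *\<^sub>C poly_op p T = id_blinfun"
      using p(1) by (simp add: scaleC_scaleC scaleC_one)
    then have "geom_decay T id_blinfun"
      using geom_decay_scaleC[OF T p(3), of "inverse (lead_coeff p)"] by simp
    then obtain K r where r: "0 \<le> r" "r < 1" and bnd: "\<And>n. norm (op_power T n) \<le> K * r ^ n"
      unfolding geom_decay_def blinfun_compose_id by blast
    have "(\<lambda>n. K * r ^ n) \<longlonglongrightarrow> K * 0"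
      using r by (intro tendsto_mult tendsto_const LIMSEQ_power_zero) auto
    then have "(\<lambda>n. op_power T n) \<longlonglongrightarrow> 0"
      by (intro Lim_null_comparison[OF always_eventually, OF allI, OF bnd]) simp
    then show ?thesis using True by simp
  next
    case False
    have "(\<Sum>l\<in>L. poly_op (q l) T) = id_blinfun"
      using Lagrange_partition_of_unity[OF fin False] unfolding q_def[symmetric]
      by (simp flip: poly_op_sum)
    then have "op_power T n - (\<Sum>l\<in>L. l ^ n *\<^sub>C D l)
        = (\<Sum>l\<in>L. (op_power T n o\<^sub>L poly_op (q l) T) - l ^ n *\<^sub>C D l)" for n
      by (simp add: sum_subtractf compose_sum_right[symmetric])
    then show ?thesis using tendsto_sum[of L, OF D(3)] by simp
  qed
  then show ?thesis using D(1,2) unfolding L_def by (intro exI[of _ D]) simp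
qed

lemma geom_decay_cluster_closure:
  fixes T :: "'a::complex_normed_vector \<Rightarrow>\<^sub>L 'a"
  assumes compl: "complete (UNIV :: 'a set)" and T: "T \<in> bounded_ops"
    and S: "S \<in> nullOrbRef T" "S \<notin> nullOrb T"
    and fin: "finite L" and unimod: "\<And>l. l \<in> L \<Longrightarrow> cmod l = 1"
    and D: "\<And>l. l \<in> L \<Longrightarrow> D l \<in> bounded_ops" "\<And>l. l \<in> L \<Longrightarrow> D l o\<^sub>L T = l *\<^sub>C D l"
    and lim: "(\<lambda>n. op_power T n - (\<Sum>l\<in>L. l ^ n *\<^sub>C D l)) \<longlonglongrightarrow> 0"
  shows "S \<in> closure (nullOrb T)"
proof -
  have Sops: "S \<in> bounded_ops" using S by (simp add: nullOrbRef_def)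
  define E where "E n = op_power T n - (\<Sum>l\<in>L. l ^ n *\<^sub>C D l)" for n
  have E: "E \<longlonglongrightarrow> 0" using lim by (simp add: E_def[abs_def])
  have Dpow: "D l o\<^sub>L op_power T n = l ^ n *\<^sub>C D l" if "l \<in> L" for l n
  proof (induction n)
    case (Suc n)
    have "D l o\<^sub>L op_power T (Suc n) = (D l o\<^sub>L T) o\<^sub>L op_power T n"
      by (simp add: op_power_Suc blinfun_compose_assoc)
    then show ?case using Suc D(2)[OF that] by (simp add: compose_scaleC_left scaleC_scaleC)
  qed (simp add: scaleC_one)
  have Bseq: "Bseq E" using E by (intro convergent_imp_Bseq convergentI)
  obtain M0 where M0: "\<And>n. norm (E n) \<le> M0" using Bseq by (metis BseqE)
  define M where "M = M0 + (\<Sum>l\<in>L. norm (D l)) + norm S + 1"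
  have "norm (E 0) \<le> M0" by (rule M0)
  then have M_pos: "M \<ge> 1"
    unfolding M_def
    using sum_nonneg[of L "\<lambda>l. norm (D l)", OF norm_ge_zero] norm_ge_zero[of S] norm_ge_zero[of "E 0"]
    by linarith
  have pow_bdd: "norm (op_power T n) + norm S \<le> M" for n
  proof -
    have "norm (\<Sum>l\<in>L. l ^ n *\<^sub>C D l) \<le> (\<Sum>l\<in>L. norm (D l))"
      by (rule sum_norm_le) (simp add: norm_scaleC norm_power unimod)
    then show ?thesis
      using M0[of n] norm_triangle_ineq[of "E n" "\<Sum>l\<in>L. l ^ n *\<^sub>C D l"] by (simp add: E_def M_def)
  qed
  \<comment> \<open>Baire provides cluster points at a dense set of vectors only. The uniform bound
    \<open>M\<close> on the norms of \<open>T^n - S\<close> carries the property from a nearby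
    \<open>y\<close> to every \<open>x\<close>.\<close>
  have cluster: "\<exists>n\<ge>N. norm (blinfun_apply (op_power T n) x - blinfun_apply S x) < e"
    if "e > 0" for x e N
  proof -
    have "x \<in> ball x (e / (2 * M))" using \<open>e > 0\<close> M_pos by simp
    then have ne: "ball x (e / (2 * M)) \<noteq> {}" by blast
    obtain y where y: "y \<in> ball x (e / (2 * M))"
      and yc: "\<And>e N. e > 0 \<Longrightarrow> \<exists>n\<ge>N. norm (blinfun_apply (op_power T n) y - blinfun_apply S y) < e"
      using nullOrbRef_cluster_point[OF compl S open_ball ne] by blast
    obtain n where n: "n \<ge> N" "norm (blinfun_apply (op_power T n) y - blinfun_apply S y) < e / 2"
      using yc[of "e / 2" N] \<open>e > 0\<close> by auto
    have "norm (op_power T n - S) \<le> M"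
      using pow_bdd[of n] norm_triangle_ineq4[of "op_power T n" S] by linarith
    then have "norm (blinfun_apply (op_power T n - S) (x - y)) \<le> M * norm (x - y)"
      by (intro order_trans[OF norm_blinfun] mult_right_mono) auto
    also have "\<dots> \<le> M * (e / (2 * M))"
      using y M_pos by (intro mult_left_mono) (auto simp: dist_norm)
    also have "\<dots> = e / 2" using M_pos by simp
    finally have "norm (blinfun_apply (op_power T n - S) (x - y)) \<le> e / 2" .
    moreover have "blinfun_apply (op_power T n) x - blinfun_apply S x
        = blinfun_apply (op_power T n - S) (x - y) + (blinfun_apply (op_power T n) y - blinfun_apply S y)"
      by (simp add: blinfun.diff_left blinfun.diff_right)
    ultimately have "norm (blinfun_apply (op_power T n) x - blinfun_apply S x) < e"
      using n(2) norm_triangle_ineq[of "blinfun_apply (op_power T n - S) (x - y)"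
          "blinfun_apply (op_power T n) y - blinfun_apply S y"] by simp
    with n(1) show ?thesis by blast
  qed
  have seq: "\<exists>f. filterlim f at_top sequentially \<and> (\<lambda>k. blinfun_apply (op_power T (f k)) x) \<longlonglongrightarrow> blinfun_apply S x" for x
  proof -
    have "\<exists>f. \<forall>k. f k \<ge> k \<and> norm (blinfun_apply (op_power T (f k)) x - blinfun_apply S x) < inverse (of_nat (Suc k))"
      using cluster[of "inverse (of_nat (Suc _))"] by (intro choice) auto
    then obtain f where f: "\<And>k. f k \<ge> k"
      "\<And>k. norm (blinfun_apply (op_power T (f k)) x - blinfun_apply S x) < inverse (of_nat (Suc k))" by blast
    have "(\<lambda>k. blinfun_apply (op_power T (f k)) x - blinfun_apply S x) \<longlonglongrightarrow> 0"
      using f(2) by (intro Lim_null_comparison[OF always_eventually LIMSEQ_inverse_real_of_nat])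
        (auto intro: less_imp_le)
    then have "(\<lambda>k. blinfun_apply (op_power T (f k)) x) \<longlonglongrightarrow> blinfun_apply S x"
      by (rule LIM_zero_cancel)
    moreover have "filterlim f at_top sequentially"
      by (rule filterlim_at_top_mono[OF filterlim_ident always_eventually]) (use f(1) in auto)
    ultimately show ?thesis by blast
  qed
  have DS_lim: "(\<lambda>k. l ^ f k *\<^sub>C blinfun_apply (D l) x) \<longlonglongrightarrow> blinfun_apply (D l o\<^sub>L S) x"
    if "l \<in> L" "(\<lambda>k. blinfun_apply (op_power T (f k)) x) \<longlonglongrightarrow> blinfun_apply S x" for f l x
  proof -
    have "blinfun_apply (D l) (blinfun_apply (op_power T (f k)) x) = l ^ f k *\<^sub>C blinfun_apply (D l) x" for k
      using arg_cong[OF Dpow[OF that(1), of "f k"], of "\<lambda>A. blinfun_apply A x"]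
      by (simp add: scaleC_blinfun_apply)
    then show ?thesis
      using blinfun.tendsto[OF tendsto_const that(2), of "D l"] by simp
  qed
  have "\<exists>c. D l o\<^sub>L S = c *\<^sub>C D l" if l: "l \<in> L" for l
  proof (rule locally_dependent_imp_scalar_multiple)
    fix x
    obtain f where f: "(\<lambda>k. blinfun_apply (op_power T (f k)) x) \<longlonglongrightarrow> blinfun_apply S x"
      using seq by blast
    \<comment> \<open>Since \<open>D_l T^n x = l^n D_l x\<close> with
      \<open>\<bar>l\<bar> = 1\<close>, all these vectors lie on a compact circle of multiples of
      \<open>D_l x\<close>, and so does the limit \<open>D_l S x\<close>.\<close>
    define C where "C = (\<lambda>c. c *\<^sub>C blinfun_apply (D l) x) ` sphere 0 1"
    have cC: "compact C" unfolding C_def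
      by (intro compact_continuous_image linear_continuous_on compact_sphere
          bounded_bilinear.bounded_linear_left[OF bounded_bilinear_scaleC])
    have inC: "l ^ f k *\<^sub>C blinfun_apply (D l) x \<in> C" for k
      using unimod[OF l] by (auto simp: C_def norm_power)
    have "blinfun_apply (D l o\<^sub>L S) x \<in> C"
      by (rule closed_sequentially[OF compact_imp_closed[OF cC] _ DS_lim[OF l f]]) (use inC in simp)
    then show "\<exists>c. blinfun_apply (D l o\<^sub>L S) x = c *\<^sub>C blinfun_apply (D l) x"
      by (auto simp: C_def)
  qed (use D(1) Sops l in auto)
  then obtain \<nu> where \<nu>: "\<And>l. l \<in> L \<Longrightarrow> D l o\<^sub>L S = \<nu> l *\<^sub>C D l" by metis
  \<comment> \<open>\<open>1 - G\<close> sends \<open>T^n\<close> to the error \<open>E n\<close>,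
    which tends to 0. Hence \<open>S = G S\<close>, and the scalars \<open>\<nu> l\<close> give the
    explicit form of \<open>S\<close>.\<close>
  define G where "G = (\<Sum>l\<in>L. D l)"
  have GT: "(id_blinfun - G) o\<^sub>L op_power T n = E n" for n
    by (simp add: E_def G_def compose_diff_left compose_sum_left Dpow)
  have "(id_blinfun - G) o\<^sub>L S = 0"
  proof (rule blinfun_eqI)
    fix x
    obtain f where f: "filterlim f at_top sequentially"
      "(\<lambda>k. blinfun_apply (op_power T (f k)) x) \<longlonglongrightarrow> blinfun_apply S x"
      using seq by blast
    have "(\<lambda>k. blinfun_apply (id_blinfun - G) (blinfun_apply (op_power T (f k)) x))
        \<longlonglongrightarrow> blinfun_apply (id_blinfun - G) (blinfun_apply S x)"
      by (intro blinfun.tendsto tendsto_const f)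
    also have "(\<lambda>k. blinfun_apply (id_blinfun - G) (blinfun_apply (op_power T (f k)) x))
        = (\<lambda>k. blinfun_apply (E (f k)) x)"
      by (simp flip: GT)
    finally have "(\<lambda>k. blinfun_apply (E (f k)) x) \<longlonglongrightarrow> blinfun_apply ((id_blinfun - G) o\<^sub>L S) x" by simp
    moreover have "(\<lambda>k. blinfun_apply (E (f k)) x) \<longlonglongrightarrow> blinfun_apply 0 x"
      by (intro blinfun.tendsto tendsto_const filterlim_compose[OF E f(1)])
    ultimately show "blinfun_apply ((id_blinfun - G) o\<^sub>L S) x = blinfun_apply 0 x"
      by (rule LIMSEQ_unique)
  qed
  then have S_eq: "S = (\<Sum>l\<in>L. \<nu> l *\<^sub>C D l)"
    by (simp add: compose_diff_left G_def compose_sum_left \<nu>)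
  \<comment> \<open>A single vector that detects every nonzero \<open>D l\<close>: one subsequence
    \<open>f\<close> obtained from it then forces \<open>l ^ f k\<close> to converge to
    \<open>\<nu> l\<close> for all these \<open>l\<close> at once.\<close>
  have "\<exists>x\<in>UNIV. \<forall>l\<in>{l \<in> L. D l \<noteq> 0}. blinfun_apply (D l) x \<noteq> 0"
    by (rule blinfun_finite_generic_point) (use fin in auto)
  then obtain x where x: "\<And>l. l \<in> L \<Longrightarrow> D l \<noteq> 0 \<Longrightarrow> blinfun_apply (D l) x \<noteq> 0"
    by blast
  obtain f where f: "filterlim f at_top sequentially"
    "(\<lambda>k. blinfun_apply (op_power T (f k)) x) \<longlonglongrightarrow> blinfun_apply S x"
    using seq by blast
  have "(\<lambda>k. l ^ f k *\<^sub>C D l) \<longlonglongrightarrow> \<nu> l *\<^sub>C D l" if l: "l \<in> L" for l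
  proof (cases "D l = 0")
    case False
    then have Dx: "blinfun_apply (D l) x \<noteq> 0" using x l by blast
    have "(\<lambda>k. l ^ f k *\<^sub>C blinfun_apply (D l) x) \<longlonglongrightarrow> \<nu> l *\<^sub>C blinfun_apply (D l) x"
      using DS_lim[OF l f(2)] \<nu>[OF l] by (simp add: scaleC_blinfun_apply)
    then have "(\<lambda>k. norm ((l ^ f k - \<nu> l) *\<^sub>C blinfun_apply (D l) x)) \<longlonglongrightarrow> 0"
      by (simp add: scaleC_diff_left LIM_zero_iff tendsto_norm_zero_iff)
    then have "(\<lambda>k. cmod (l ^ f k - \<nu> l) * norm (blinfun_apply (D l) x) * inverse (norm (blinfun_apply (D l) x)))
        \<longlonglongrightarrow> 0 * inverse (norm (blinfun_apply (D l) x))"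
      unfolding norm_scaleC by (intro tendsto_mult tendsto_const)
    then have "(\<lambda>k. l ^ f k - \<nu> l) \<longlonglongrightarrow> 0"
      using Dx by (simp add: mult.assoc tendsto_norm_zero_iff)
    then have "(\<lambda>k. l ^ f k) \<longlonglongrightarrow> \<nu> l" by (rule LIM_zero_cancel)
    then show ?thesis
      by (intro bounded_bilinear.tendsto[OF bounded_bilinear_scaleC] tendsto_const)
  qed simp
  then have "(\<lambda>k. E (f k) + (\<Sum>l\<in>L. l ^ f k *\<^sub>C D l)) \<longlonglongrightarrow> 0 + S"
    unfolding S_eq by (intro tendsto_add tendsto_sum filterlim_compose[OF E f(1)])
  then have "(\<lambda>k. op_power T (f k)) \<longlonglongrightarrow> S" by (simp add: E_def)
  then show ?thesis
    unfolding closure_sequential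
    by (intro exI[of _ "\<lambda>k. op_power T (f k)"]) (simp add: nullOrb_def)
qed

theorem geom_decay_imp_null_orbit_reflexive:
  fixes T :: "'a::complex_normed_vector \<Rightarrow>\<^sub>L 'a"
  assumes compl: "complete (UNIV :: 'a set)" and T: "T \<in> bounded_ops"
    and ex: "p0 \<noteq> 0" "geom_decay T (poly_op p0 T)"
  shows "null_orbit_reflexive T"
proof (rule null_orbit_reflexiveI[OF T], rule ccontr)
  fix S assume S: "S \<in> nullOrbRef T" and "S \<notin> closure (nullOrb T)"
  then have S': "S \<notin> nullOrb T" using closure_subset by blast
  define P where "P p \<longleftrightarrow> p \<noteq> 0 \<and> geom_decay T (poly_op p T)" for p
  obtain p where p: "P p" and min: "\<And>q. P q \<Longrightarrow> degree p \<le> degree q"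
    using ex_has_least_nat[of P p0 degree] ex by (auto simp: P_def)
  \<comment> \<open>Cancelling a linear factor lowers the degree, so minimality of \<open>p\<close>
    denies decay to the quotient.\<close>
  have split: "\<not> geom_decay T (poly_op q T)" if "p = [:-l, 1:] * q" for l q
  proof
    assume "geom_decay T (poly_op q T)"
    moreover have "q \<noteq> 0" using p that by (auto simp: P_def)
    ultimately have "degree p \<le> degree q" by (intro min) (simp add: P_def)
    moreover have "degree p = 1 + degree q"
      unfolding that using \<open>q \<noteq> 0\<close> by (subst degree_mult_eq) auto
    ultimately show False by simp
  qed
  have unimod: "cmod l = 1" if "poly p l = 0" for l
  proof -
    have "[:-l, 1:] dvd p" using that by (simp only: poly_eq_0_iff_dvd)
    then obtain q where q: "p = [:-l, 1:] * q" unfolding dvd_def by blast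
    have dec: "geom_decay T (poly_op ([:-l, 1:] * q) T)" using p q by (simp add: P_def)
    have "\<not> cmod l < 1"
      using geom_decay_strip_root[OF T _ dec[unfolded poly_op_split_root[OF T]]] split[OF q] by blast
    moreover have "\<not> cmod l > 1"
      using geom_decay_root_gt_1[OF compl T S _ dec split[OF q]] S' by blast
    ultimately show ?thesis by linarith
  qed
  have "order l p \<le> 1" for l
  proof (rule ccontr)
    assume "\<not> order l p \<le> 1"
    then have "[:-l, 1:] ^ 2 dvd p" by (simp add: order_divides)
    then obtain q where q: "p = [:-l, 1:] * ([:-l, 1:] * q)"
      unfolding power2_eq_square dvd_def mult.assoc by blast
    then have "cmod l = 1" by (intro unimod) simp
    moreover have "geom_decay T (poly_op ([:-l, 1:] * ([:-l, 1:] * q)) T)" using p q by (simp add: P_def)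
    ultimately show False using geom_decay_double_root[OF compl T S _ _ split[OF q]] S' by blast
  qed
  then have sqf: "rsquarefree p"
    using p by (auto simp: rsquarefree_def P_def le_Suc_eq)
  have "p \<noteq> 0" and dec: "geom_decay T (poly_op p T)" using p by (auto simp: P_def)
  obtain D where D: "\<And>l. poly p l = 0 \<Longrightarrow> D l \<in> bounded_ops"
    "\<And>l. poly p l = 0 \<Longrightarrow> D l o\<^sub>L T = l *\<^sub>C D l"
    "(\<lambda>n. op_power T n - (\<Sum>l | poly p l = 0. l ^ n *\<^sub>C D l)) \<longlonglongrightarrow> 0"
    using geom_decay_imp_decomposition[OF compl T \<open>p \<noteq> 0\<close> sqf dec unimod] by blast
  have "S \<in> closure (nullOrb T)"
    by (rule geom_decay_cluster_closure[OF compl T S S' poly_roots_finite[OF \<open>p \<noteq> 0\<close>]])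
      (use unimod D in auto)
  with \<open>S \<notin> closure (nullOrb T)\<close> show False by simp
qed

section \<open>Algebraic operators and finite-dimensional subspaces\<close>

lemma geom_decay_0 [simp]: "geom_decay T 0"
  unfolding geom_decay_def by (intro exI[of _ 0]) auto

lemma algebraic_imp_null_orbit_reflexive:
  fixes T :: "'a::complex_normed_vector \<Rightarrow>\<^sub>L 'a"
  assumes "complete (UNIV :: 'a set)" "algebraic_op T"
  shows "null_orbit_reflexive T"
  using assms geom_decay_imp_null_orbit_reflexive[of T] by (auto simp: algebraic_op_def)

lemma poly_op_monom: "poly_op (monom c i) T = c *\<^sub>C op_power T i"
proof -
  have "poly_op (monom c i) T = (\<Sum>j\<le>i. coeff (monom c i) j *\<^sub>C op_power T j)"
    by (rule poly_op_altdef) (simp add: degree_monom_le)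
  also have "\<dots> = (\<Sum>j\<le>i. if j = i then c *\<^sub>C op_power T j else 0)"
    by (intro sum.cong) auto
  finally show ?thesis by simp
qed

text \<open>The \<open>card F + 1\<close> vectors \<open>T^i x\<close> with
  \<open>i \<le> card F\<close> lie in a span of \<open>card F\<close> generators; a linear relation
  among them is a polynomial. Dependence is a property of the set of vectors, so a coincidence
  \<open>T^i x = T^j x\<close> is treated apart, by \<open>X^i - X^j\<close>.\<close>

lemma annihilating_poly_vector:
  fixes T :: "'a::complex_normed_vector \<Rightarrow>\<^sub>L 'a"
  assumes fin: "finite F" and pow: "\<And>i. blinfun_apply (op_power T i) x \<in> complex_vector.span F"
  shows "\<exists>p. p \<noteq> 0 \<and> blinfun_apply (poly_op p T) x = 0"
proof -
  define g where "g i = blinfun_apply (op_power T i) x" for i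
  define N where "N = card F"
  show ?thesis
  proof (cases "inj_on g {..N}")
    case True
    have "\<not> complex_vector.independent (g ` {..N})"
    proof
      assume "complex_vector.independent (g ` {..N})"
      then have "card (g ` {..N}) \<le> card F"
        using complex_vector.independent_span_bound[OF fin, of "g ` {..N}"] pow by (auto simp: g_def)
      then show False using True by (simp add: card_image N_def)
    qed
    then obtain u v where u: "v \<in> g ` {..N}" "u v \<noteq> 0" "(\<Sum>v\<in>g ` {..N}. u v *\<^sub>C v) = 0"
      using complex_vector.dependent_finite[of "g ` {..N}"] by auto
    define p where "p = (\<Sum>i\<le>N. monom (u (g i)) i)"
    obtain i where i: "i \<le> N" "v = g i" using u by auto
    have "coeff p i = u v"
      using i by (simp add: p_def coeff_sum)
    then have "p \<noteq> 0" using u(2) by auto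
    moreover have "blinfun_apply (poly_op p T) x = (\<Sum>i\<le>N. u (g i) *\<^sub>C g i)"
      by (simp add: p_def poly_op_sum poly_op_monom blinfun_sum_apply scaleC_blinfun_apply g_def)
    then have "blinfun_apply (poly_op p T) x = 0"
      using u(3) by (simp add: sum.reindex[OF True])
    ultimately show ?thesis by blast
  next
    case False
    then obtain i j where ij: "i \<noteq> j" "g i = g j" by (auto simp: inj_on_def)
    define p :: "complex poly" where "p = monom 1 i + monom (-1) j"
    have "coeff p i = 1" using ij by (simp add: p_def)
    then have "p \<noteq> 0" by auto
    moreover have "blinfun_apply (poly_op p T) x = 0"
      using ij(2) by (simp add: p_def poly_op_add poly_op_monom blinfun.add_left blinfun.diff_left scaleC_simps g_def)
    ultimately show ?thesis by blast
  qed
qed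

text \<open>The product of annihilating polynomials of the generators kills each generator, and the
  kernel of its value at \<open>T\<close> is a subspace.\<close>

lemma annihilating_poly_span:
  fixes T :: "'a::complex_normed_vector \<Rightarrow>\<^sub>L 'a"
  assumes T: "T \<in> bounded_ops" and fin: "finite F"
    and inv: "\<And>x. x \<in> complex_vector.span F \<Longrightarrow> blinfun_apply T x \<in> complex_vector.span F"
  shows "\<exists>p. p \<noteq> 0 \<and> (\<forall>x\<in>complex_vector.span F. blinfun_apply (poly_op p T) x = 0)"
proof -
  have pow: "blinfun_apply (op_power T i) x \<in> complex_vector.span F" if "x \<in> complex_vector.span F" for i x
    using that by (induction i) (auto simp: op_power_Suc inv)
  have "\<forall>f\<in>F. \<exists>p. p \<noteq> 0 \<and> blinfun_apply (poly_op p T) f = 0"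
    by (intro ballI annihilating_poly_vector[OF fin] pow complex_vector.span_base)
  then obtain p where p: "\<And>f. f \<in> F \<Longrightarrow> p f \<noteq> 0" "\<And>f. f \<in> F \<Longrightarrow> blinfun_apply (poly_op (p f) T) f = 0"
    by metis
  define P where "P = (\<Prod>f\<in>F. p f)"
  have "blinfun_apply (poly_op P T) f = 0" if "f \<in> F" for f
  proof -
    have "P = (\<Prod>f\<in>F - {f}. p f) * p f"
      unfolding P_def by (simp add: prod.remove[OF fin that] mult.commute)
    then show ?thesis using p(2)[OF that] by (simp add: poly_op_mult[OF T])
  qed
  moreover have "complex_vector.subspace {x. blinfun_apply (poly_op P T) x = 0}"
    using bounded_opsD[OF poly_op_in_bounded_ops[OF T]]
    by (auto simp: complex_vector.subspace_def blinfun.add_right)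
  ultimately have "complex_vector.span F \<subseteq> {x. blinfun_apply (poly_op P T) x = 0}"
    by (intro complex_vector.span_minimal) auto
  moreover have "P \<noteq> 0" using p fin by (simp add: P_def)
  ultimately show ?thesis by blast
qed

section \<open>Completeness of finite-dimensional subspaces\<close>

lemma complex_subspace_infdist_le:
  fixes V :: "'a::complex_normed_vector set"
  assumes V: "complex_vector.subspace V" and v: "v \<in> V"
  shows "cmod k * infdist b V \<le> norm (k *\<^sub>C b + v)"
proof (cases "k = 0")
  case False
  have "- (inverse k *\<^sub>C v) \<in> V"
    using V v by (simp add: complex_vector.subspace_neg complex_vector.subspace_scale)
  then have "infdist b V \<le> norm (b + inverse k *\<^sub>C v)"
    using infdist_le[of "- (inverse k *\<^sub>C v)" V b] by (simp add: dist_norm)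
  then have "cmod k * infdist b V \<le> norm (k *\<^sub>C (b + inverse k *\<^sub>C v))"
    by (simp add: norm_scaleC mult_left_mono)
  then show ?thesis using False by (simp add: scaleC_simps)
qed auto

text \<open>The span of \<open>B\<close> is complete by induction, hence closed, so a new generator
  \<open>b\<close> outside it has positive distance from it. That distance bounds the coefficient of
  \<open>b\<close> by the norm of the whole vector, so along a Cauchy sequence the coefficients and
  the remainders in the span of \<open>B\<close> are both Cauchy.\<close>

lemma complete_complex_span:
  fixes B :: "'a::complex_normed_vector set"
  assumes "finite B" shows "complete (complex_vector.span B)"
  using assms
proof (induction B rule: finite_induct)
  case empty
  then show ?case by (simp add: compact_imp_complete)
next
  case (insert b B)
  let ?V = "complex_vector.span B"
  show ?case
  proof (cases "b \<in> ?V")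
    case True
    then show ?thesis using insert by (simp add: complex_vector.span_redundant)
  next
    case False
    have V: "complex_vector.subspace ?V" by simp
    have "0 \<in> ?V" by (simp add: complex_vector.span_zero)
    then have d: "infdist b ?V > 0"
      using infdist_pos_not_in_closed[OF complete_imp_closed[OF insert.IH] _ False] by blast
    show ?thesis
      unfolding complete_def
    proof (intro allI impI, elim conjE)
      fix X :: "nat \<Rightarrow> 'a" assume "\<forall>n. X n \<in> complex_vector.span (insert b B)" and X: "Cauchy X"
      then have "\<exists>k. \<forall>n. X n - k n *\<^sub>C b \<in> ?V"
        by (intro choice) (auto simp: complex_vector.span_breakdown_eq)
      then obtain k where k: "\<And>n. X n - k n *\<^sub>C b \<in> ?V" by blast
      have kd: "cmod (k m - k n) * infdist b ?V \<le> norm (X m - X n)" for m n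
      proof -
        have "(X m - k m *\<^sub>C b) - (X n - k n *\<^sub>C b) \<in> ?V"
          by (rule complex_vector.span_diff[OF k k])
        from complex_subspace_infdist_le[OF V this, of "k m - k n" b] show ?thesis
          by (simp add: scaleC_simps algebra_simps)
      qed
      have "Cauchy k"
      proof (rule metric_CauchyI)
        fix e :: real assume "e > 0"
        then obtain M where M: "\<And>m n. m \<ge> M \<Longrightarrow> n \<ge> M \<Longrightarrow> dist (X m) (X n) < e * infdist b ?V"
          using metric_CauchyD[OF X, of "e * infdist b ?V"] d by auto
        show "\<exists>M. \<forall>m\<ge>M. \<forall>n\<ge>M. dist (k m) (k n) < e"
        proof (intro exI[of _ M] allI impI)
          fix m n assume "m \<ge> M" "n \<ge> M"
          then have "cmod (k m - k n) * infdist b ?V < e * infdist b ?V"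
            using le_less_trans[OF kd[of m n]] M[of m n] by (simp add: dist_norm)
          then show "dist (k m) (k n) < e" using d by (simp add: dist_norm)
        qed
      qed
      then obtain k0 where k0: "k \<longlonglongrightarrow> k0" using Cauchy_convergent convergentD by blast
      then have kb: "(\<lambda>n. k n *\<^sub>C b) \<longlonglongrightarrow> k0 *\<^sub>C b"
        by (intro bounded_bilinear.tendsto[OF bounded_bilinear_scaleC] tendsto_const)
      have Cv: "Cauchy (\<lambda>n. X n - k n *\<^sub>C b)"
      proof (rule metric_CauchyI)
        fix e :: real assume "e > 0"
        then have e2: "e / 2 > 0" by simp
        obtain M1 where M1: "\<And>m n. m \<ge> M1 \<Longrightarrow> n \<ge> M1 \<Longrightarrow> dist (X m) (X n) < e / 2"
          using metric_CauchyD[OF X e2] by blast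
        obtain M2 where M2: "\<And>m n. m \<ge> M2 \<Longrightarrow> n \<ge> M2 \<Longrightarrow> dist (k m *\<^sub>C b) (k n *\<^sub>C b) < e / 2"
          using metric_CauchyD[OF LIMSEQ_imp_Cauchy[OF kb] e2] by blast
        have "dist (X m - k m *\<^sub>C b) (X n - k n *\<^sub>C b) < e" if "m \<ge> max M1 M2" "n \<ge> max M1 M2" for m n
          using M1[of m n] M2[of m n] that norm_triangle_ineq4[of "X m - X n" "k m *\<^sub>C b - k n *\<^sub>C b"]
          by (simp add: dist_norm algebra_simps)
        then show "\<exists>M. \<forall>m\<ge>M. \<forall>n\<ge>M. dist (X m - k m *\<^sub>C b) (X n - k n *\<^sub>C b) < e" by blast
      qed
      obtain v where v: "v \<in> ?V" "(\<lambda>n. X n - k n *\<^sub>C b) \<longlonglongrightarrow> v"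
        by (rule completeE[OF insert.IH _ Cv]) (use k in blast)+
      have "X \<longlonglongrightarrow> v + k0 *\<^sub>C b"
        using tendsto_add[OF v(2) kb] by simp
      moreover have "v + k0 *\<^sub>C b \<in> complex_vector.span (insert b B)"
        using v(1) by (auto simp: complex_vector.span_breakdown_eq intro!: exI[of _ k0])
      ultimately show "\<exists>l\<in>complex_vector.span (insert b B). X \<longlonglongrightarrow> l" by blast
    qed
  qed
qed

lemma finite_dimensional_null_orbit_reflexive:
  fixes T :: "'b::complex_normed_vector \<Rightarrow>\<^sub>L 'b"
  assumes "complex_finite_dimensional TYPE('b)" and T: "T \<in> bounded_ops"
  shows "null_orbit_reflexive T"
proof -
  obtain B :: "'b set" where B: "finite B" "complex_vector.span B = UNIV"
    using assms by (auto simp: complex_finite_dimensional_def)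
  obtain p where "p \<noteq> 0" "\<And>x. blinfun_apply (poly_op p T) x = 0"
    using annihilating_poly_span[OF T B(1)] B(2) by auto
  then have "algebraic_op T"
    using T by (auto simp: algebraic_op_def intro!: exI[of _ p] blinfun_eqI)
  then show ?thesis
    using complete_complex_span[OF B(1)] B(2) by (intro algebraic_imp_null_orbit_reflexive) simp_all
qed

section \<open>The resolvent\<close>

lemma is_inverse_op_unique:
  assumes "is_inverse_op A B" "is_inverse_op A C" shows "B = C"
proof -
  have "B = B o\<^sub>L (A o\<^sub>L C)" using assms by (simp add: is_inverse_op_def)
  also have "\<dots> = (B o\<^sub>L A) o\<^sub>L C" by (simp only: blinfun_compose_assoc)
  also have "\<dots> = C" using assms by (simp add: is_inverse_op_def)
  finally show ?thesis .
qed

lemma is_inverse_op_resolvent: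
  assumes "z \<notin> spectrum T" shows "is_inverse_op (z *\<^sub>C id_blinfun - T) (resolvent T z)"
proof -
  obtain B where B: "is_inverse_op (z *\<^sub>C id_blinfun - T) B"
    using assms unfolding spectrum_def by blast
  show ?thesis
    unfolding resolvent_def
    by (rule theI[where P = "is_inverse_op (z *\<^sub>C id_blinfun - T)", OF B is_inverse_op_unique[OF _ B]])
qed

lemma resolvent_eqI:
  assumes "is_inverse_op (z *\<^sub>C id_blinfun - T) B"
  shows "z \<notin> spectrum T" "resolvent T z = B"
proof -
  show "z \<notin> spectrum T" using assms by (auto simp: spectrum_def)
  then show "resolvent T z = B" using is_inverse_op_unique assms is_inverse_op_resolvent by blast
qed

lemma resolvent_in_bounded_ops: "z \<notin> spectrum T \<Longrightarrow> resolvent T z \<in> bounded_ops"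
  by (rule conjunct1[OF is_inverse_op_resolvent[unfolded is_inverse_op_def]])

lemma
  assumes T: "T \<in> bounded_ops" and z: "z \<notin> spectrum T"
  shows compose_resolvent: "T o\<^sub>L resolvent T z = z *\<^sub>C resolvent T z - id_blinfun"
    and resolvent_compose: "resolvent T z o\<^sub>L T = z *\<^sub>C resolvent T z - id_blinfun"
proof -
  define R where "R = resolvent T z"
  have R: "R \<in> bounded_ops" "(z *\<^sub>C id_blinfun - T) o\<^sub>L R = id_blinfun" "R o\<^sub>L (z *\<^sub>C id_blinfun - T) = id_blinfun"
    using is_inverse_op_resolvent[OF z] unfolding is_inverse_op_def R_def by blast+
  have "z *\<^sub>C R - (T o\<^sub>L R) = id_blinfun"
    using R(2) by (simp only: compose_diff_left compose_scaleC_left blinfun_compose_id)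
  then show "T o\<^sub>L resolvent T z = z *\<^sub>C resolvent T z - id_blinfun"
    unfolding R_def by (metis diff_diff_eq2 add_diff_cancel_left')
  have "z *\<^sub>C R - (R o\<^sub>L T) = id_blinfun"
    using R(3) by (simp only: compose_diff_right compose_scaleC_right[OF R(1)] blinfun_compose_id)
  then show "resolvent T z o\<^sub>L T = z *\<^sub>C resolvent T z - id_blinfun"
    unfolding R_def by (metis diff_diff_eq2 add_diff_cancel_left')
qed

lemma resolvent_identity:
  assumes T: "T \<in> bounded_ops" and z: "z \<notin> spectrum T" and w: "w \<notin> spectrum T"
  shows "resolvent T z - resolvent T w = (w - z) *\<^sub>C (resolvent T z o\<^sub>L resolvent T w)"
proof -
  have "resolvent T z o\<^sub>L (T o\<^sub>L resolvent T w) = (resolvent T z o\<^sub>L T) o\<^sub>L resolvent T w"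
    by (simp add: blinfun_compose_assoc)
  then show ?thesis
    unfolding compose_resolvent[OF T w] resolvent_compose[OF T z]
    using resolvent_in_bounded_ops[OF z]
    by (simp add: compose_diff_left compose_diff_right compose_scaleC_left compose_scaleC_right
        scaleC_diff_left algebra_simps)
qed

lemma neumann_inverse:
  fixes A :: "'a::{complex_normed_vector, banach} \<Rightarrow>\<^sub>L 'a"
  assumes A: "A \<in> bounded_ops" "norm A < 1"
  obtains B where "is_inverse_op (id_blinfun - A) B" "norm B \<le> 1 / (1 - norm A)"
proof -
  have sn: "summable (\<lambda>n. norm (op_power A n))"
    by (rule summable_comparison_test[OF _ summable_geometric[of "norm A"]])
      (use A norm_op_power_le in auto)
  then have s: "summable (op_power A)" by (rule summable_norm_cancel)
  define B where "B = (\<Sum>n. op_power A n)"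
  have Bops: "B \<in> bounded_ops"
    by (rule bounded_ops_limit[OF _ summable_LIMSEQ[OF s, folded B_def]]) (use A in auto)
  have sums: "op_power A sums B" using s by (simp add: B_def summable_sums)
  have shift: "(\<lambda>n. op_power A (Suc n)) sums (B - id_blinfun)"
    using sums by (simp add: sums_Suc_iff)
  have "(\<lambda>n. A o\<^sub>L op_power A n) sums (A o\<^sub>L B)"
    by (rule bounded_linear.sums[OF bounded_bilinear.bounded_linear_right[OF bounded_bilinear_blinfun_compose] sums])
  then have 1: "A o\<^sub>L B = B - id_blinfun"
    using sums_unique2[OF shift] by (simp add: op_power_Suc)
  have "(\<lambda>n. op_power A n o\<^sub>L A) sums (B o\<^sub>L A)"
    by (rule bounded_linear.sums[OF bounded_bilinear.bounded_linear_left[OF bounded_bilinear_blinfun_compose] sums])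
  then have 2: "B o\<^sub>L A = B - id_blinfun"
    using sums_unique2[OF shift] by (simp add: op_power_Suc2)
  have "norm B \<le> (\<Sum>n. norm (op_power A n))" unfolding B_def by (rule summable_norm[OF sn])
  also have "\<dots> \<le> (\<Sum>n. norm A ^ n)"
    by (intro suminf_le sn summable_geometric norm_op_power_le) (use A in auto)
  also have "\<dots> = 1 / (1 - norm A)" using A by (intro suminf_geometric) auto
  finally have "norm B \<le> 1 / (1 - norm A)" .
  moreover have "is_inverse_op (id_blinfun - A) B"
    using Bops 1 2 by (simp add: is_inverse_op_def compose_simps)
  ultimately show ?thesis by (intro that)
qed

text \<open>\<open>z - T\<close> factors as \<open>(z0 - T) (1 - A)\<close> with
  \<open>A = (z0 - z) R(z0)\<close>. The norm of \<open>A\<close> is at most \<open>1/2\<close>, so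
  the Neumann inverse of \<open>1 - A\<close> has norm at most 2.\<close>

lemma resolvent_near:
  fixes T :: "'a::{complex_normed_vector, banach} \<Rightarrow>\<^sub>L 'a"
  assumes T: "T \<in> bounded_ops" and z0: "z0 \<notin> spectrum T"
    and near: "cmod (z - z0) * norm (resolvent T z0) \<le> 1 / 2"
  shows "z \<notin> spectrum T" "norm (resolvent T z) \<le> 2 * norm (resolvent T z0)"
proof -
  define R where "R = resolvent T z0"
  have R: "R \<in> bounded_ops" "R o\<^sub>L (z0 *\<^sub>C id_blinfun - T) = id_blinfun"
    "(z0 *\<^sub>C id_blinfun - T) o\<^sub>L R = id_blinfun"
    using is_inverse_op_resolvent[OF z0] by (auto simp: is_inverse_op_def R_def)
  define A where "A = (z0 - z) *\<^sub>C R"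
  have A: "A \<in> bounded_ops" "norm A \<le> 1 / 2"
    using R near by (auto simp: A_def norm_scaleC norm_minus_commute R_def)
  then obtain B where B: "is_inverse_op (id_blinfun - A) B" "norm B \<le> 1 / (1 - norm A)"
    using neumann_inverse[of A] by auto
  have eq1: "z *\<^sub>C id_blinfun - T = (z0 *\<^sub>C id_blinfun - T) o\<^sub>L (id_blinfun - A)"
    using R T by (simp add: A_def compose_diff_right compose_scaleC_right scaleC_diff_left)
  have "is_inverse_op (z *\<^sub>C id_blinfun - T) (B o\<^sub>L R)"
    unfolding is_inverse_op_def
  proof (intro conjI)
    show "B o\<^sub>L R \<in> bounded_ops" using R B by (auto simp: is_inverse_op_def)
    have "((z0 *\<^sub>C id_blinfun - T) o\<^sub>L (id_blinfun - A)) o\<^sub>L (B o\<^sub>L R)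
        = (z0 *\<^sub>C id_blinfun - T) o\<^sub>L ((id_blinfun - A) o\<^sub>L B) o\<^sub>L R"
      by (simp only: blinfun_compose_assoc)
    then show "(z *\<^sub>C id_blinfun - T) o\<^sub>L (B o\<^sub>L R) = id_blinfun"
      using B R by (simp add: eq1 is_inverse_op_def)
    have "B o\<^sub>L R o\<^sub>L ((z0 *\<^sub>C id_blinfun - T) o\<^sub>L (id_blinfun - A))
        = B o\<^sub>L (R o\<^sub>L (z0 *\<^sub>C id_blinfun - T)) o\<^sub>L (id_blinfun - A)"
      by (simp only: blinfun_compose_assoc)
    then show "B o\<^sub>L R o\<^sub>L (z *\<^sub>C id_blinfun - T) = id_blinfun"
      using B R by (simp add: eq1 is_inverse_op_def)
  qed
  note res = resolvent_eqI[OF this]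
  show "z \<notin> spectrum T" by (rule res)
  have "1 / (1 - norm A) \<le> 2" using A by (simp add: divide_simps)
  then show "norm (resolvent T z) \<le> 2 * norm (resolvent T z0)"
    unfolding res R_def[symmetric] using B by (intro norm_blinfun_compose_mono) auto
qed

lemma resolvent_large:
  fixes T :: "'a::{complex_normed_vector, banach} \<Rightarrow>\<^sub>L 'a"
  assumes T: "T \<in> bounded_ops" and z: "cmod z > norm T"
  shows "z \<notin> spectrum T" "norm (resolvent T z) \<le> 1 / (cmod z - norm T)"
proof -
  have z0: "z \<noteq> 0" and zpos: "cmod z > 0" using z norm_ge_zero[of T] by (auto intro: le_less_trans)
  define A where "A = inverse z *\<^sub>C T"
  have nA: "norm A = norm T / cmod z" by (simp add: A_def norm_scaleC norm_inverse divide_inverse)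
  then have A: "A \<in> bounded_ops" "norm A < 1" using T z zpos by (auto simp: A_def)
  then obtain B where B: "is_inverse_op (id_blinfun - A) B" "norm B \<le> 1 / (1 - norm A)"
    using neumann_inverse[of A] by auto
  have "z *\<^sub>C id_blinfun - T = z *\<^sub>C (id_blinfun - A)"
    using z0 by (simp add: A_def scaleC_simps)
  then have inv: "is_inverse_op (z *\<^sub>C id_blinfun - T) (inverse z *\<^sub>C B)"
    using B(1) z0 A(1) by (auto simp: is_inverse_op_def compose_scaleC_left compose_scaleC_right
        scaleC_scaleC scaleC_one)
  note res = resolvent_eqI[OF inv]
  show "z \<notin> spectrum T" by (rule res)
  have "norm (resolvent T z) = norm B / cmod z"
    unfolding res by (simp add: norm_scaleC norm_inverse divide_inverse)
  also have "\<dots> \<le> 1 / (1 - norm A) / cmod z" by (intro divide_right_mono B) auto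
  also have "\<dots> = 1 / (cmod z - norm T)" using z zpos by (simp add: nA field_simps)
  finally show "norm (resolvent T z) \<le> 1 / (cmod z - norm T)" .
qed

lemma resolvent_ball:
  fixes T :: "'a::{complex_normed_vector, banach} \<Rightarrow>\<^sub>L 'a"
  assumes T: "T \<in> bounded_ops" and z0: "z0 \<notin> spectrum T"
  obtains d where "d > 0" "d * norm (resolvent T z0) \<le> 1 / 2" "ball z0 d \<inter> spectrum T = {}"
    "\<And>z. z \<in> ball z0 d \<Longrightarrow> norm (resolvent T z) \<le> 2 * norm (resolvent T z0)"
proof -
  define d where "d = 1 / (2 * (norm (resolvent T z0) + 1))"
  have pos: "norm (resolvent T z0) + 1 > 0" using norm_ge_zero[of "resolvent T z0"] by linarith
  then have d: "d > 0" by (simp add: d_def)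
  have "d * norm (resolvent T z0) \<le> d * (norm (resolvent T z0) + 1)" using d by simp
  also have "\<dots> = 1 / 2" using pos by (simp add: d_def)
  finally have d2: "d * norm (resolvent T z0) \<le> 1 / 2" .
  have "cmod (z - z0) * norm (resolvent T z0) \<le> 1 / 2" if "z \<in> ball z0 d" for z
    by (rule order_trans[OF mult_right_mono d2])
      (use that in \<open>auto simp: dist_norm norm_minus_commute\<close>)
  from resolvent_near[OF T z0 this] show ?thesis using d d2 by (intro that) auto
qed

lemma closed_spectrum:
  fixes T :: "'a::{complex_normed_vector, banach} \<Rightarrow>\<^sub>L 'a"
  assumes "T \<in> bounded_ops" shows "closed (spectrum T)"
  unfolding closed_def open_contains_ball
proof
  fix z assume "z \<in> - spectrum T"
  then have "z \<notin> spectrum T" by simp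
  then obtain d where "d > 0" "ball z d \<inter> spectrum T = {}"
    by (rule resolvent_ball[OF assms]) blast
  then show "\<exists>e>0. ball z e \<subseteq> - spectrum T" by blast
qed

lemma compact_spectrum:
  fixes T :: "'a::{complex_normed_vector, banach} \<Rightarrow>\<^sub>L 'a"
  assumes T: "T \<in> bounded_ops" shows "compact (spectrum T)"
proof -
  have "spectrum T \<subseteq> cball 0 (norm T)" using resolvent_large(1)[OF T] by force
  then show ?thesis
    using closed_spectrum[OF T] bounded_cball bounded_subset compact_eq_bounded_closed by blast
qed

lemma isCont_resolvent:
  fixes T :: "'a::{complex_normed_vector, banach} \<Rightarrow>\<^sub>L 'a"
  assumes T: "T \<in> bounded_ops" and z0: "z0 \<notin> spectrum T"
  shows "isCont (resolvent T) z0"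
proof -
  obtain d where d: "d > 0" "ball z0 d \<inter> spectrum T = {}"
    and bnd: "\<And>z. z \<in> ball z0 d \<Longrightarrow> norm (resolvent T z) \<le> 2 * norm (resolvent T z0)"
    by (rule resolvent_ball[OF T z0]) blast
  have "((\<lambda>z. resolvent T z - resolvent T z0) \<longlongrightarrow> 0) (at z0)"
  proof (rule Lim_null_comparison)
    have ev: "eventually (\<lambda>z. z \<in> ball z0 d) (at z0)"
      using d(1) by (intro eventually_at_in_open') auto
    show "\<forall>\<^sub>F z in at z0. norm (resolvent T z - resolvent T z0)
        \<le> cmod (z0 - z) * (2 * norm (resolvent T z0) * norm (resolvent T z0))"
      using ev
    proof eventually_elim
      case (elim z)
      then have z: "z \<notin> spectrum T" using d by auto
      show ?case
        unfolding resolvent_identity[OF T z z0] norm_scaleC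
        using bnd[OF elim] by (intro mult_left_mono norm_blinfun_compose_mono) auto
    qed
    have "((\<lambda>z. cmod (z0 - z) * (2 * norm (resolvent T z0) * norm (resolvent T z0))) \<longlongrightarrow>
        cmod (z0 - z0) * (2 * norm (resolvent T z0) * norm (resolvent T z0))) (at z0)"
      by (intro tendsto_intros)
    then show "((\<lambda>z. cmod (z0 - z) * (2 * norm (resolvent T z0) * norm (resolvent T z0))) \<longlongrightarrow> 0) (at z0)"
      by simp
  qed
  then show ?thesis unfolding isCont_def by (rule LIM_zero_cancel)
qed

lemma continuous_on_resolvent:
  fixes T :: "'a::{complex_normed_vector, banach} \<Rightarrow>\<^sub>L 'a"
  assumes "T \<in> bounded_ops" "S \<inter> spectrum T = {}"
  shows "continuous_on S (resolvent T)"
proof (intro continuous_at_imp_continuous_on ballI isCont_resolvent assms(1))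
  fix z assume "z \<in> S" then show "z \<notin> spectrum T" using assms(2) by blast
qed

section \<open>Power series expansion and path integrals of the resolvent\<close>

text \<open>Local primitives make the resolvent integrable along paths whose derivative may be
  unbounded near the finitely many exceptional points.\<close>

lemma resolvent_local_primitive:
  fixes T :: "'a::{complex_normed_vector, banach} \<Rightarrow>\<^sub>L 'a"
  assumes T: "T \<in> bounded_ops" and z0: "z0 \<notin> spectrum T"
  obtains d F where "d > 0"
    "\<And>z. z \<in> ball z0 d \<Longrightarrow> (F has_derivative (\<lambda>h. h *\<^sub>C resolvent T z)) (at z)"
proof -
  define R where "R = resolvent T z0"
  obtain d where d: "d > 0" "d * norm R \<le> 1 / 2" "ball z0 d \<inter> spectrum T = {}"
    and bnd: "\<And>z. z \<in> ball z0 d \<Longrightarrow> norm (resolvent T z) \<le> 2 * norm R"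
    unfolding R_def by (rule resolvent_ball[OF T z0]) blast
  have R: "R \<in> bounded_ops" unfolding R_def by (rule resolvent_in_bounded_ops[OF z0])
  \<comment> \<open>Antiderivatives of the terms in
    \<open>R(z) = \<Sum>n. (z0 - z)^n R(z0)^(n+1)\<close>; differentiating \<open>z0 - z\<close>
    accounts for the minus sign.\<close>
  define f where "f n z = (- ((z0 - z) ^ Suc n / of_nat (Suc n))) *\<^sub>C op_power R (Suc n)" for n z
  \<comment> \<open>The expansion with exact remainder, from iterating the resolvent identity. On
    the ball \<open>\<bar>z0 - z\<bar> * norm R \<le> 1/2\<close>, so the remainder is uniformly of
    order \<open>2^(-n)\<close>.\<close>
  have expand: "resolvent T z = (\<Sum>i<n. (z0 - z) ^ i *\<^sub>C op_power R (Suc i))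
      + (z0 - z) ^ n *\<^sub>C (op_power R n o\<^sub>L resolvent T z)" if z: "z \<in> ball z0 d" for n z
  proof (induction n)
    case (Suc n)
    have zn: "z \<notin> spectrum T" using z d by auto
    have "resolvent T z = R + (z0 - z) *\<^sub>C (R o\<^sub>L resolvent T z)"
      using resolvent_identity[OF T z0 zn] by (simp add: R_def scaleC_diff_left algebra_simps)
    then have "(z0 - z) ^ n *\<^sub>C (op_power R n o\<^sub>L resolvent T z)
        = (z0 - z) ^ n *\<^sub>C (op_power R n o\<^sub>L (R + (z0 - z) *\<^sub>C (R o\<^sub>L resolvent T z)))" by simp
    also have "\<dots> = (z0 - z) ^ n *\<^sub>C op_power R (Suc n)
        + (z0 - z) ^ Suc n *\<^sub>C (op_power R (Suc n) o\<^sub>L resolvent T z)"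
      using R by (simp add: compose_add_right compose_scaleC_right op_power_Suc2 scaleC_add_right
          scaleC_scaleC blinfun_compose_assoc mult.commute)
    finally have step: "(z0 - z) ^ n *\<^sub>C (op_power R n o\<^sub>L resolvent T z)
        = (z0 - z) ^ n *\<^sub>C op_power R (Suc n)
          + (z0 - z) ^ Suc n *\<^sub>C (op_power R (Suc n) o\<^sub>L resolvent T z)" .
    show ?case
      by (rule trans[OF Suc]) (simp only: step sum.lessThan_Suc add.assoc)
  qed (simp add: scaleC_one)
  have "\<exists>F. \<forall>z\<in>ball z0 d. (\<lambda>n. f n z) sums F z \<and>
      (F has_derivative (\<lambda>h. h *\<^sub>C resolvent T z)) (at z within ball z0 d)"
  proof (rule has_derivative_series[where f' = "\<lambda>n z h. (h * (z0 - z) ^ n) *\<^sub>C op_power R (Suc n)"])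
    fix n z
    have "((\<lambda>z. - ((z0 - z) ^ Suc n / of_nat (Suc n))) has_field_derivative (z0 - z) ^ n) (at z within ball z0 d)"
    proof -
      have nz: "of_nat (Suc n) \<noteq> (0 :: complex)" by (simp only: of_nat_eq_0_iff nat.simps simp_thms)
      have "((\<lambda>z. - ((z0 - z) ^ Suc n / of_nat (Suc n))) has_field_derivative
          - (of_nat (Suc n) * (z0 - z) ^ n * (- 1) / of_nat (Suc n))) (at z within ball z0 d)"
        by (auto intro!: derivative_eq_intros simp del: of_nat_Suc power_Suc)
      also have "- (of_nat (Suc n) * (z0 - z) ^ n * (- 1) / of_nat (Suc n)) = (z0 - z) ^ n"
        using nz by (simp del: of_nat_Suc)
      finally show ?thesis .
    qed
    then have "((\<lambda>z. - ((z0 - z) ^ Suc n / of_nat (Suc n))) has_derivative (\<lambda>h. h * (z0 - z) ^ n)) (at z within ball z0 d)"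
      by (simp add: has_field_derivative_def mult_commute_abs)
    then show "(f n has_derivative (\<lambda>h. (h * (z0 - z) ^ n) *\<^sub>C op_power R (Suc n))) (at z within ball z0 d)"
      unfolding f_def
      by (rule bounded_linear.has_derivative[OF bounded_bilinear.bounded_linear_left[OF bounded_bilinear_scaleC]])
  next
    fix e :: real assume "e > 0"
    have "(\<lambda>n. (1 / 2) ^ n * (2 * norm R)) \<longlonglongrightarrow> 0 * (2 * norm R)"
      by (intro tendsto_mult tendsto_const LIMSEQ_power_zero) auto
    then have "\<forall>\<^sub>F n in sequentially. (1 / 2) ^ n * (2 * norm R) < e"
      using \<open>e > 0\<close> by (intro order_tendstoD(2)) auto
    then show "\<forall>\<^sub>F n in sequentially. \<forall>z\<in>ball z0 d. \<forall>h.
        norm ((\<Sum>i<n. (h * (z0 - z) ^ i) *\<^sub>C op_power R (Suc i)) - h *\<^sub>C resolvent T z) \<le> e * norm h"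
    proof eventually_elim
      case (elim n)
      show ?case
      proof (intro ballI allI)
        fix z h assume z: "z \<in> ball z0 d"
        have "(\<Sum>i<n. (h * (z0 - z) ^ i) *\<^sub>C op_power R (Suc i)) - h *\<^sub>C resolvent T z
            = - (h *\<^sub>C ((z0 - z) ^ n *\<^sub>C (op_power R n o\<^sub>L resolvent T z)))"
          by (subst expand[OF z, of n]) (simp add: scaleC_simps scaleC_sum_right)
        also have "norm \<dots> = cmod h * (cmod (z0 - z) ^ n * norm (op_power R n o\<^sub>L resolvent T z))"
          by (simp add: norm_scaleC norm_power norm_mult del: scaleC_scaleC)
        also have "\<dots> \<le> cmod h * (cmod (z0 - z) ^ n * (norm R ^ n * (2 * norm R)))"
          by (intro mult_left_mono norm_blinfun_compose_mono norm_op_power_le bnd z) auto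
        also have "\<dots> = cmod h * ((cmod (z0 - z) * norm R) ^ n * (2 * norm R))"
          by (simp add: power_mult_distrib)
        also have "\<dots> \<le> cmod h * ((1 / 2) ^ n * (2 * norm R))"
        proof (intro mult_left_mono mult_right_mono power_mono)
          have "cmod (z0 - z) * norm R \<le> d * norm R"
            using z by (intro mult_right_mono) (auto simp: dist_norm)
          then show "cmod (z0 - z) * norm R \<le> 1 / 2" using d by linarith
        qed auto
        also have "\<dots> \<le> cmod h * e" using elim by (intro mult_left_mono) auto
        finally show "norm ((\<Sum>i<n. (h * (z0 - z) ^ i) *\<^sub>C op_power R (Suc i)) - h *\<^sub>C resolvent T z) \<le> e * norm h"
          by (simp add: mult.commute)
      qed
    qed
  next
    show "z0 \<in> ball z0 d" using d by simp
    show "(\<lambda>n. f n z0) sums 0" by (simp add: f_def)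
  qed auto
  then obtain F where F: "\<And>z. z \<in> ball z0 d \<Longrightarrow> (F has_derivative (\<lambda>h. h *\<^sub>C resolvent T z)) (at z within ball z0 d)"
    by blast
  have "(F has_derivative (\<lambda>h. h *\<^sub>C resolvent T z)) (at z)" if "z \<in> ball z0 d" for z
    using F[OF that] unfolding at_within_open[OF that open_ball] .
  then show ?thesis using d(1) that by blast
qed

text \<open>Integrability need only be checked on small subintervals. There \<open>g\<close> stays
  in a ball with a primitive \<open>F\<close>, and \<open>F \<circ> g\<close> is continuous and
  differentiable off the finite set \<open>K\<close>, so the fundamental theorem of calculus
  applies.\<close>

lemma resolvent_integrable:
  fixes T :: "'a::{complex_normed_vector, banach} \<Rightarrow>\<^sub>L 'a"
  assumes T: "T \<in> bounded_ops" and g: "valid_path g" "path_image g \<inter> spectrum T = {}"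
  shows "(\<lambda>t. vector_derivative g (at t within {0..1}) *\<^sub>C resolvent T (g t)) integrable_on {0..1}"
proof -
  let ?f = "\<lambda>t. vector_derivative g (at t within {0..1}) *\<^sub>C resolvent T (g t)"
  obtain K where K: "finite K" "\<And>t. t \<in> {0..1} - K \<Longrightarrow> g differentiable at t" and cont: "continuous_on {0..1} g"
    using g(1) unfolding valid_path_def piecewise_C1_differentiable_on_def C1_differentiable_on_eq by blast
  have "?f integrable_on cbox 0 1"
  proof (intro integrable_on_little_subintervals ballI)
    fix x :: real assume x: "x \<in> cbox 0 1"
    then have "g x \<notin> spectrum T" using g(2) by (auto simp: path_image_def disjoint_iff)
    then obtain d F where d: "d > 0"
      and F: "\<And>z. z \<in> ball (g x) d \<Longrightarrow> (F has_derivative (\<lambda>h. h *\<^sub>C resolvent T z)) (at z)"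
      using resolvent_local_primitive[OF T] by blast
    obtain e where e: "e > 0" "\<And>t. t \<in> {0..1} \<Longrightarrow> dist t x < e \<Longrightarrow> dist (g t) (g x) < d"
      using cont x d unfolding continuous_on_iff cbox_interval by blast
    show "\<exists>e>0. \<forall>u v. x \<in> cbox u v \<and> cbox u v \<subseteq> ball x e \<and> cbox u v \<subseteq> cbox 0 1 \<longrightarrow> ?f integrable_on cbox u v"
    proof (intro exI[of _ e] conjI allI impI e(1), elim conjE)
      fix u v assume xuv: "x \<in> cbox u v" and sub: "cbox u v \<subseteq> ball x e" "cbox u v \<subseteq> cbox 0 1"
      have uv: "u \<le> v" "0 \<le> u" "v \<le> 1" using xuv sub(2) by auto
      have gt: "g t \<in> ball (g x) d" if "t \<in> {u..v}" for t
        using e(2)[of t] that sub by (auto simp: dist_commute subset_iff)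
      have "(?f has_integral ((F \<circ> g) v - (F \<circ> g) u)) {u..v}"
      proof (rule fundamental_theorem_of_calculus_interior_strong[OF K(1) uv(1)])
        fix t assume t: "t \<in> {u<..<v} - K"
        then have t01: "0 < t" "t < 1" using uv by auto
        have "(g has_vector_derivative vector_derivative g (at t)) (at t)"
          using K(2)[of t] t t01 by (auto simp: vector_derivative_works)
        then have "(g has_derivative (\<lambda>h. h *\<^sub>R vector_derivative g (at t))) (at t)"
          by (simp add: has_vector_derivative_def)
        from diff_chain_at[OF this F[OF gt]] t
        have "(F \<circ> g has_derivative (\<lambda>h. h *\<^sub>R (vector_derivative g (at t) *\<^sub>C resolvent T (g t)))) (at t)"
          by (simp add: o_def scaleR_scaleC scaleC_scaleC scaleR_conv_of_real)
        then show "(F \<circ> g has_vector_derivative ?f t) (at t)"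
          using t01 by (simp add: has_vector_derivative_def at_within_Icc_at)
      next
        have "continuous_on (ball (g x) d) F"
          using F by (intro continuous_at_imp_continuous_on) (blast intro: has_derivative_continuous)
        moreover have "continuous_on {u..v} g" by (rule continuous_on_subset[OF cont]) (use uv in auto)
        ultimately show "continuous_on {u..v} (F \<circ> g)"
          using gt by (intro continuous_on_compose) (auto intro: continuous_on_subset)
      qed
      then show "?f integrable_on cbox u v" by auto
    qed
  qed
  then show ?thesis by simp
qed

section \<open>Matrix coefficients\<close>

lemma cinner_add_right: "cinner x (y + z) = cinner x y + cinner x (z :: 'a::chilbert_space)"
  by (metis cinner_add_left cinner_commute complex_cnj_add)

lemma cinner_scaleR_left: "cinner (r *\<^sub>R x) y = r *\<^sub>R cinner x (y :: 'a::chilbert_space)"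
  by (simp add: scaleR_scaleC cinner_scaleC_left scaleR_conv_of_real)

text \<open>A crude form of the Cauchy-Schwarz inequality, read off from the expansion of the
  squared norm of \<open>x + y\<close>; it is used to show that the functionals
  \<open>cinner _ y\<close> are bounded.\<close>

lemma Re_cinner_bound: "\<bar>Re (cinner x y)\<bar> \<le> (norm x + norm y)\<^sup>2" for x y :: "'a::chilbert_space"
proof -
  have "complex_of_real ((norm (x + y))\<^sup>2) = cinner (x + y) (x + y)" by (rule cinner_self[symmetric])
  also have "\<dots> = cinner x x + cinner y y + (cinner x y + cnj (cinner x y))"
    by (simp add: cinner_add_left cinner_add_right cinner_commute[of y x])
  also have "\<dots> = complex_of_real ((norm x)\<^sup>2 + (norm y)\<^sup>2 + 2 * Re (cinner x y))"
    by (simp add: cinner_self complex_add_cnj)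
  finally have eq: "(norm (x + y))\<^sup>2 = (norm x)\<^sup>2 + (norm y)\<^sup>2 + 2 * Re (cinner x y)"
    by (simp only: of_real_eq_iff)
  have "(norm (x + y))\<^sup>2 \<le> (norm x + norm y)\<^sup>2"
    by (intro power_mono norm_triangle_ineq) auto
  moreover have "0 \<le> (norm (x + y))\<^sup>2" by simp
  moreover have "(norm x)\<^sup>2 + (norm y)\<^sup>2 + 2 * (norm x * norm y) = (norm x + norm y)\<^sup>2"
    by (simp add: power2_sum)
  moreover have "0 \<le> norm x * norm y" "0 \<le> (norm x)\<^sup>2" "0 \<le> (norm y)\<^sup>2" by auto
  ultimately show ?thesis unfolding eq by linarith
qed

text \<open>Normalising \<open>x\<close> to a unit vector \<open>u\<close> makes the crude bound
  homogeneous. The imaginary part is the real part for \<open>\<i> u\<close> up to sign, hence the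
  factor 2.\<close>

lemma bounded_linear_cinner_left: "bounded_linear (\<lambda>x. cinner x (y :: 'a::chilbert_space))"
proof (rule bounded_linear_intro[where K = "2 * (1 + norm y)\<^sup>2"])
  fix x
  show "norm (cinner x y) \<le> norm x * (2 * (1 + norm y)\<^sup>2)"
  proof (cases "x = 0")
    case True
    have "cinner 0 y = 0" using cinner_scaleC_left[of 0 "0 :: 'a" y] by simp
    with True show ?thesis by simp
  next
    case False
    define u where "u = inverse (norm x) *\<^sub>R x"
    have u: "norm u = 1" using False by (simp add: u_def)
    have x: "x = norm x *\<^sub>R u" using False by (simp add: u_def)
    have "\<bar>Re (cinner u y)\<bar> \<le> (1 + norm y)\<^sup>2" using Re_cinner_bound[of u y] u by simp
    moreover have "\<bar>Im (cinner u y)\<bar> \<le> (1 + norm y)\<^sup>2"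
      using Re_cinner_bound[of "\<i> *\<^sub>C u" y] u by (simp add: cinner_scaleC_left norm_scaleC)
    ultimately have "norm (cinner u y) \<le> 2 * (1 + norm y)\<^sup>2"
      using cmod_le[of "cinner u y"] by linarith
    then have "norm x * norm (cinner u y) \<le> norm x * (2 * (1 + norm y)\<^sup>2)"
      by (intro mult_left_mono) auto
    moreover have "norm (cinner x y) = norm x * norm (cinner u y)"
      by (subst x) (simp add: cinner_scaleR_left)
    ultimately show ?thesis by simp
  qed
qed (simp_all add: cinner_add_left cinner_scaleR_left)

text \<open>The matrix coefficients are bounded functionals that separate operators. Through them
  identities between operator-valued integrals reduce to scalar complex analysis.\<close>

definition coef :: "'a::chilbert_space \<Rightarrow> 'a \<Rightarrow> ('a \<Rightarrow>\<^sub>L 'a) \<Rightarrow> complex" where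
  "coef x y A = cinner (blinfun_apply A x) y"

lemma bounded_linear_coef: "bounded_linear (coef x y)"
  unfolding coef_def
  by (rule bounded_linear_compose[OF bounded_linear_cinner_left blinfun.bounded_linear_left])

lemma coef_scaleC: "coef x y (c *\<^sub>C A) = c * coef x y A"
  by (simp add: coef_def scaleC_blinfun_apply cinner_scaleC_left)

lemmas coef_diff = linear_diff[OF bounded_linear.linear[OF bounded_linear_coef]]
lemmas coef_add = linear_add[OF bounded_linear.linear[OF bounded_linear_coef]]

lemma coef_compose: "coef x y (A o\<^sub>L B) = coef (blinfun_apply B x) y A"
  by (simp add: coef_def)

lemma coef_eqI:
  assumes "\<And>x y. coef x y A = coef x y B" shows "A = B"
proof (rule blinfun_eqI)
  fix x
  have "cinner (blinfun_apply (A - B) x) (blinfun_apply (A - B) x) = 0"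
    using assms[of x "blinfun_apply (A - B) x"] coef_diff[of x "blinfun_apply (A - B) x" A B]
    by (simp add: coef_def)
  then have "blinfun_apply (A - B) x = 0"
    unfolding cinner_self by simp
  then show "blinfun_apply A x = blinfun_apply B x" by (simp add: blinfun.diff_left)
qed

text \<open>By the resolvent identity the difference quotient at \<open>z0\<close> is the
  coefficient of \<open>- R(z) R(z0)\<close>, which converges by continuity of the
  resolvent.\<close>

lemma holomorphic_on_coef_resolvent:
  fixes T :: "'a::chilbert_space \<Rightarrow>\<^sub>L 'a"
  assumes T: "T \<in> bounded_ops" and S: "S \<inter> spectrum T = {}"
  shows "(\<lambda>z. coef x y (resolvent T z)) holomorphic_on S"
proof -
  have "(\<lambda>z. coef x y (resolvent T z)) field_differentiable (at z0)" if "z0 \<notin> spectrum T" for z0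
  proof -
    have "isCont (\<lambda>z. coef x y (- (resolvent T z o\<^sub>L resolvent T z0))) z0"
      by (intro bounded_linear.isCont[OF bounded_linear_coef] continuous_intros
          bounded_bilinear.isCont[OF bounded_bilinear_blinfun_compose] isCont_resolvent[OF T that])
    then have "((\<lambda>z. coef x y (- (resolvent T z o\<^sub>L resolvent T z0)))
        \<longlongrightarrow> coef x y (- (resolvent T z0 o\<^sub>L resolvent T z0))) (at z0)"
      by (simp add: isCont_def)
    moreover have "\<forall>\<^sub>F z in at z0. coef x y (- (resolvent T z o\<^sub>L resolvent T z0))
        = (coef x y (resolvent T z) - coef x y (resolvent T z0)) / (z - z0)"
    proof -
      have "open (- spectrum T)" using closed_spectrum[OF T] by auto
      then have ev: "\<forall>\<^sub>F z in at z0. z \<in> - spectrum T - {z0}"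
        using that by (intro eventually_at_in_open) auto
      show ?thesis
        using ev
      proof eventually_elim
        case (elim z)
        then have z: "z \<notin> spectrum T" "z \<noteq> z0" by auto
        have "coef x y (resolvent T z) - coef x y (resolvent T z0)
            = (z0 - z) * coef x y (resolvent T z o\<^sub>L resolvent T z0)"
          using resolvent_identity[OF T z(1) that] by (metis coef_diff coef_scaleC)
        moreover have "coef x y (- (resolvent T z o\<^sub>L resolvent T z0)) = - coef x y (resolvent T z o\<^sub>L resolvent T z0)"
          by (rule linear_neg[OF bounded_linear.linear[OF bounded_linear_coef]])
        ultimately show ?case using z(2) by (simp add: field_simps)
      qed
    qed
    ultimately have "((\<lambda>z. (coef x y (resolvent T z) - coef x y (resolvent T z0)) / (z - z0))
        \<longlongrightarrow> coef x y (- (resolvent T z0 o\<^sub>L resolvent T z0))) (at z0)"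
      by (rule Lim_transform_eventually)
    then show ?thesis
      unfolding field_differentiable_def has_field_derivative_iff by blast
  qed
  then show ?thesis
    using S unfolding holomorphic_on_def
    by (metis disjoint_iff field_differentiable_at_within)
qed

lemma coef_resolvent_integral:
  fixes T :: "'a::chilbert_space \<Rightarrow>\<^sub>L 'a"
  assumes T: "T \<in> bounded_ops"
    and G: "\<And>g. g \<in> set G \<Longrightarrow> valid_path g \<and> path_image g \<inter> spectrum T = {}"
  shows "coef x y (resolvent_integral T G) = (\<Sum>g\<leftarrow>G. contour_integral g (\<lambda>z. coef x y (resolvent T z)))"
proof -
  have one: "coef x y (integral {0..1} (\<lambda>t. vector_derivative g (at t within {0..1}) *\<^sub>C resolvent T (g t)))
      = contour_integral g (\<lambda>z. coef x y (resolvent T z))" if "g \<in> set G" for g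
  proof -
    define h where "h t = vector_derivative g (at t within {0..1}) *\<^sub>C resolvent T (g t)" for t
    have "h integrable_on {0..1}"
      using resolvent_integrable[OF T] G[OF that] by (simp add: h_def[abs_def])
    then have "((coef x y \<circ> h) has_integral coef x y (integral {0..1} h)) {0..1}"
      by (intro has_integral_linear[OF _ bounded_linear_coef] integrable_integral)
    then have "((\<lambda>z. coef x y (resolvent T z)) has_contour_integral coef x y (integral {0..1} h)) g"
      by (simp add: has_contour_integral_def h_def coef_scaleC o_def mult.commute)
    then show ?thesis unfolding h_def by (simp add: contour_integral_unique)
  qed
  have "coef x y (resolvent_integral T G)
      = (\<Sum>g\<leftarrow>G. coef x y (integral {0..1} (\<lambda>t. vector_derivative g (at t within {0..1}) *\<^sub>C resolvent T (g t))))"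
    unfolding resolvent_integral_def
    by (induction G) (simp_all add: coef_add linear_0[OF bounded_linear.linear[OF bounded_linear_coef]])
  then show ?thesis using one by (simp cong: map_cong)
qed

section \<open>Normalised integrals over circles about the origin\<close>

text \<open>\<open>cmean r F\<close> is \<open>1 / (2 \<pi> i)\<close> times the integral of \<open>F\<close> over the circle of radius \<open>r\<close>:
  the factor \<open>2 \<pi> i w\<close> is the derivative of the parametrisation \<open>w\<close>.\<close>

definition cmean :: "real \<Rightarrow> (complex \<Rightarrow> 'b) \<Rightarrow> 'b::{complex_normed_vector, banach}" where
  "cmean r F = integral {0..1} (\<lambda>t. circlepath 0 r t *\<^sub>C F (circlepath 0 r t))"

lemma norm_circlepath [simp]: "0 \<le> r \<Longrightarrow> cmod (circlepath 0 r t) = r"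
  by (simp add: circlepath norm_mult mult.assoc)

lemma circlepath_in_sphere: "0 \<le> r \<Longrightarrow> circlepath 0 r t \<in> sphere 0 r"
  by simp

lemma cmean_integrable:
  fixes F :: "complex \<Rightarrow> 'b::{complex_normed_vector, banach}"
  assumes "0 \<le> r" "continuous_on (sphere 0 r) F"
  shows "(\<lambda>t. circlepath 0 r t *\<^sub>C F (circlepath 0 r t)) integrable_on {0..1}"
proof (rule integrable_continuous_real)
  have c: "continuous_on {0..1} (circlepath 0 r)"
    unfolding circlepath by (intro continuous_intros)
  have "continuous_on {0..1} (\<lambda>t. F (circlepath 0 r t))"
    by (rule continuous_on_compose2[OF assms(2) c]) (use assms(1) circlepath_in_sphere in auto)
  then show "continuous_on {0..1} (\<lambda>t. circlepath 0 r t *\<^sub>C F (circlepath 0 r t))"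
    by (intro bounded_bilinear.continuous_on[OF bounded_bilinear_scaleC] c)
qed

text \<open>\<open>bounded_linear\<close> speaks of real scalars; complex homogeneity lets the
  weight \<open>circlepath 0 r t\<close> pass through \<open>h\<close>.\<close>

lemma cmean_linear:
  assumes "0 \<le> r" "continuous_on (sphere 0 r) F" and h: "bounded_linear h" "\<And>c v. h (c *\<^sub>C v) = c *\<^sub>C h v"
  shows "cmean r (\<lambda>z. h (F z)) = h (cmean r F)"
  using integral_linear[OF cmean_integrable[OF assms(1,2)] h(1)] by (simp add: cmean_def o_def h(2))

lemma cmean_coef:
  assumes "0 \<le> r" "continuous_on (sphere 0 r) F"
  shows "2 * of_real pi * \<i> * coef x y (cmean r F) = contour_integral (circlepath 0 r) (\<lambda>z. coef x y (F z))"
proof -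
  have "coef x y (cmean r F) = integral {0..1} (\<lambda>t. circlepath 0 r t * coef x y (F (circlepath 0 r t)))"
    using integral_linear[OF cmean_integrable[OF assms] bounded_linear_coef]
    by (simp add: cmean_def o_def coef_scaleC)
  then show ?thesis
    unfolding contour_integral_integral vector_derivative_circlepath
    by (simp add: circlepath mult_ac flip: integral_mult_right)
qed

lemma cmean_coef_div:
  assumes "0 \<le> r" "continuous_on (sphere 0 r) F"
  shows "coef x y (cmean r F) = contour_integral (circlepath 0 r) (\<lambda>z. coef x y (F z)) / (2 * of_real pi * \<i>)"
  using cmean_coef[OF assms, of x y] by (simp add: field_simps)

lemma cmean_diff:
  assumes "0 \<le> r" "continuous_on (sphere 0 r) F" "continuous_on (sphere 0 r) G"
  shows "cmean r (\<lambda>z. F z - G z) = cmean r F - cmean r G"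
  unfolding cmean_def scaleC_diff_right
  by (rule integral_diff) (use cmean_integrable assms in auto)

lemma cmean_cong:
  assumes "0 \<le> r" "\<And>z. z \<in> sphere 0 r \<Longrightarrow> F z = G z" shows "cmean r F = cmean r G"
  unfolding cmean_def by (intro integral_cong) (use assms circlepath_in_sphere in auto)

lemma norm_cmean_le:
  assumes r: "0 \<le> r" and "continuous_on (sphere 0 r) F" and B: "\<And>z. z \<in> sphere 0 r \<Longrightarrow> norm (F z) \<le> B"
  shows "norm (cmean r F) \<le> r * B"
proof -
  have "norm (integral {0..1} (\<lambda>t. circlepath 0 r t *\<^sub>C F (circlepath 0 r t))) \<le> integral {0..1} (\<lambda>t::real. r * B)"
  proof (rule integral_norm_bound_integral)
    fix t :: real
    show "norm (circlepath 0 r t *\<^sub>C F (circlepath 0 r t)) \<le> r * B"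
      using B[OF circlepath_in_sphere[OF r]] r by (simp add: norm_scaleC mult_left_mono)
  qed (use cmean_integrable assms in auto)
  then show ?thesis by (simp add: cmean_def)
qed

lemma cmean_scaleC_const:
  fixes A :: "'a::chilbert_space \<Rightarrow>\<^sub>L 'a"
  assumes "0 \<le> r" "continuous_on (sphere 0 r) \<phi>"
    and I: "(\<phi> has_contour_integral (2 * of_real pi * \<i> * c)) (circlepath 0 r)"
  shows "cmean r (\<lambda>z. \<phi> z *\<^sub>C A) = c *\<^sub>C A"
proof (rule coef_eqI)
  fix x y
  have cont: "continuous_on (sphere 0 r) (\<lambda>z. \<phi> z *\<^sub>C A)"
    by (intro bounded_bilinear.continuous_on[OF bounded_bilinear_scaleC] assms continuous_intros)
  have "((\<lambda>z. coef x y (\<phi> z *\<^sub>C A)) has_contour_integral (2 * of_real pi * \<i> * c * coef x y A)) (circlepath 0 r)"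
    unfolding coef_scaleC by (rule has_contour_integral_rmul[OF I])
  then show "coef x y (cmean r (\<lambda>z. \<phi> z *\<^sub>C A)) = coef x y (c *\<^sub>C A)"
    using cmean_coef[OF assms(1) cont, of x y] by (simp add: contour_integral_unique coef_scaleC)
qed

lemma cmean_resolvent_radius:
  fixes T :: "'a::chilbert_space \<Rightarrow>\<^sub>L 'a"
  assumes T: "T \<in> bounded_ops" and r: "0 < r" "r \<le> s"
    and free: "\<And>z. z \<in> spectrum T \<Longrightarrow> cmod z < r \<or> s < cmod z"
  shows "cmean r (resolvent T) = cmean s (resolvent T)"
proof (rule coef_eqI)
  fix x y
  define f where "f = (\<lambda>z. coef x y (resolvent T z))"
  have hom: "homotopic_loops (- spectrum T) (circlepath 0 r) (circlepath 0 s)"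
  proof (rule homotopic_loops_linear)
    fix t
    show "closed_segment (circlepath 0 r t) (circlepath 0 s t) \<subseteq> - spectrum T"
    proof
      fix z assume "z \<in> closed_segment (circlepath 0 r t) (circlepath 0 s t)"
      then obtain u where u: "0 \<le> u" "u \<le> 1" "z = (1 - u) *\<^sub>R circlepath 0 r t + u *\<^sub>R circlepath 0 s t"
        by (auto simp: in_segment)
      \<comment> \<open>The segment joining points of equal angle is radial, so each of its points
        lies on a circle of radius between \<open>r\<close> and \<open>s\<close>, where there is no
        spectrum.\<close>
      define a where "a = (1 - u) * r + u * s"
      have "z = circlepath 0 a t"
        unfolding u(3) a_def circlepath by (simp add: scaleR_conv_of_real algebra_simps)
      moreover have "r \<le> a" "a \<le> s"
        unfolding a_def using u r convex_bound_le[of r s s "1 - u" u] mult_left_mono[of r s u]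
        by (auto simp: algebra_simps)
      ultimately have "cmod z = a" "r \<le> a" "a \<le> s" using circlepath_in_sphere[of a t] r by auto
      then show "z \<in> - spectrum T" using free[of z] by auto
    qed
  qed auto
  have "contour_integral (circlepath 0 r) f = contour_integral (circlepath 0 s) f"
    unfolding f_def
    by (rule Cauchy_theorem_homotopic_loops[OF hom _ holomorphic_on_coef_resolvent[OF T]])
      (use closed_spectrum[OF T] in auto)
  moreover have "continuous_on (sphere 0 r) (resolvent T)" "continuous_on (sphere 0 s) (resolvent T)"
    by (rule continuous_on_resolvent[OF T]; use free r in force)+
  ultimately show "coef x y (cmean r (resolvent T)) = coef x y (cmean s (resolvent T))"
    using r by (simp add: cmean_coef_div f_def)
qed

text \<open>From \<open>T R(z) = z R(z) - 1\<close>: composing with \<open>T\<close> multiplies the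
  weight by \<open>z\<close>, at the cost of the normalised integral \<open>c\<close> of the weight.
  Nonnegative powers of \<open>z\<close> have \<open>c = 0\<close>, the weight \<open>1 / z\<close>
  has \<open>c = 1\<close>, and higher powers of \<open>1 / z\<close> again have
  \<open>c = 0\<close>.\<close>

lemma compose_cmean_resolvent:
  fixes T :: "'a::chilbert_space \<Rightarrow>\<^sub>L 'a"
  assumes T: "T \<in> bounded_ops" and r: "0 < r" and free: "sphere 0 r \<inter> spectrum T = {}"
    and \<phi>: "continuous_on (sphere 0 r) \<phi>" "(\<phi> has_contour_integral (2 * of_real pi * \<i> * c)) (circlepath 0 r)"
  shows "T o\<^sub>L cmean r (\<lambda>z. \<phi> z *\<^sub>C resolvent T z)
    = cmean r (\<lambda>z. (z * \<phi> z) *\<^sub>C resolvent T z) - c *\<^sub>C id_blinfun"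
proof -
  note cont = bounded_bilinear.continuous_on[OF bounded_bilinear_scaleC _ continuous_on_resolvent[OF T free]]
  have "T o\<^sub>L cmean r (\<lambda>z. \<phi> z *\<^sub>C resolvent T z) = cmean r (\<lambda>z. T o\<^sub>L (\<phi> z *\<^sub>C resolvent T z))"
    by (rule cmean_linear[symmetric])
      (use r T in \<open>auto intro!: cont \<phi> bounded_bilinear.bounded_linear_right[OF bounded_bilinear_blinfun_compose]
         compose_scaleC_right\<close>)
  also have "\<dots> = cmean r (\<lambda>z. (z * \<phi> z) *\<^sub>C resolvent T z - \<phi> z *\<^sub>C id_blinfun)"
  proof (rule cmean_cong)
    fix z :: complex assume "z \<in> sphere 0 r"
    then have z: "z \<notin> spectrum T" using free by auto
    show "T o\<^sub>L (\<phi> z *\<^sub>C resolvent T z) = (z * \<phi> z) *\<^sub>C resolvent T z - \<phi> z *\<^sub>C id_blinfun"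
      unfolding compose_scaleC_right[OF T] compose_resolvent[OF T z]
      by (simp add: scaleC_diff_right scaleC_scaleC mult.commute)
  qed (use r in simp)
  also have "\<dots> = cmean r (\<lambda>z. (z * \<phi> z) *\<^sub>C resolvent T z) - cmean r (\<lambda>z. \<phi> z *\<^sub>C id_blinfun)"
    by (rule cmean_diff) (use r \<phi>(1) in \<open>auto intro!: cont continuous_intros
        bounded_bilinear.continuous_on[OF bounded_bilinear_scaleC]\<close>)
  also have "cmean r (\<lambda>z. \<phi> z *\<^sub>C id_blinfun) = c *\<^sub>C (id_blinfun :: 'a \<Rightarrow>\<^sub>L 'a)"
    by (rule cmean_scaleC_const[OF _ \<phi>]) (use r in simp)
  finally show ?thesis .
qed

lemma op_power_compose_cmean:
  fixes T :: "'a::chilbert_space \<Rightarrow>\<^sub>L 'a"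
  assumes T: "T \<in> bounded_ops" and r: "0 < r" and free: "sphere 0 r \<inter> spectrum T = {}"
  shows "op_power T n o\<^sub>L cmean r (resolvent T) = cmean r (\<lambda>z. z ^ n *\<^sub>C resolvent T z)"
proof (induction n)
  case (Suc n)
  have "((\<lambda>z. z ^ n) has_contour_integral 2 * of_real pi * \<i> * 0) (circlepath 0 r)"
    by (simp, rule Cauchy_theorem_convex_simple[of _ UNIV]) (auto intro!: holomorphic_intros)
  from compose_cmean_resolvent[OF T r free _ this] show ?case
    using Suc by (simp add: op_power_Suc blinfun_compose_assoc continuous_on_power)
qed (simp add: scaleC_one)

lemma geom_decay_cmean:
  fixes T :: "'a::chilbert_space \<Rightarrow>\<^sub>L 'a"
  assumes T: "T \<in> bounded_ops" and r: "0 < r" and free: "sphere 0 r \<inter> spectrum T = {}"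
  obtains K where "\<And>n. norm (op_power T n o\<^sub>L cmean r (resolvent T)) \<le> K * r ^ n"
proof -
  note cont = continuous_on_resolvent[OF T free]
  obtain B where B: "\<And>z. z \<in> sphere 0 r \<Longrightarrow> norm (resolvent T z) \<le> B"
    using compact_imp_bounded[OF compact_continuous_image[OF cont compact_sphere]]
    unfolding bounded_iff by blast
  have "norm (op_power T n o\<^sub>L cmean r (resolvent T)) \<le> (r * B) * r ^ n" for n
  proof -
    have "norm (cmean r (\<lambda>z. z ^ n *\<^sub>C resolvent T z)) \<le> r * (r ^ n * B)"
    proof (rule norm_cmean_le)
      fix z :: complex assume z: "z \<in> sphere 0 r"
      then show "norm (z ^ n *\<^sub>C resolvent T z) \<le> r ^ n * B"
        using B[OF z] r by (simp add: norm_scaleC norm_power mult_left_mono)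
    qed (use r in \<open>auto intro!: continuous_intros cont bounded_bilinear.continuous_on[OF bounded_bilinear_scaleC]\<close>)
    then show ?thesis by (simp add: op_power_compose_cmean[OF T r free] mult_ac)
  qed
  then show ?thesis by (rule that)
qed

section \<open>The Riesz idempotent\<close>

lemma has_contour_integral_cauchy_kernel:
  assumes "cmod w < r"
  shows "((\<lambda>u. 1 / (u - w)) has_contour_integral 2 * of_real pi * \<i> * 1) (circlepath 0 r)"
  using Cauchy_integral_circlepath_simple[of "\<lambda>_. 1" 0 r w] assms by simp

text \<open>The integral is the same over every larger circle. There
  \<open>R(z) - 1/z = (1/z) T R(z)\<close> is of order \<open>\<bar>z\<bar>^(-2)\<close>, so the
  distance to the identity is below any positive number.\<close>

lemma cmean_resolvent_large:
  fixes T :: "'a::chilbert_space \<Rightarrow>\<^sub>L 'a"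
  assumes T: "T \<in> bounded_ops" and r: "0 < r" and inside: "\<And>z. z \<in> spectrum T \<Longrightarrow> cmod z < r"
  shows "cmean r (resolvent T) = id_blinfun"
proof (rule ccontr)
  assume neg: "\<not> ?thesis"
  define d where "d = norm (cmean r (resolvent T) - id_blinfun)"
  have d: "d > 0" using neg by (simp add: d_def)
  \<comment> \<open>Chosen so that \<open>d * (s - norm T) \<ge> norm T + d\<close>, which
    contradicts the estimate \<open>d \<le> norm T / (s - norm T)\<close>.\<close>
  define s where "s = r + norm T + norm T / d + 1"
  have "norm T / d \<ge> 0" using d by simp
  then have s: "r \<le> s" "norm T < s" "0 < s" "norm T / d + 1 \<le> s - norm T"
    using r norm_ge_zero[of T] unfolding s_def by linarith+
  have free: "sphere 0 s \<inter> spectrum T = {}" using inside s by fastforce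
  have nz: "z \<noteq> 0" if "z \<in> sphere 0 s" for z :: complex using that s by auto
  have cont: "continuous_on (sphere 0 s) (resolvent T)" by (rule continuous_on_resolvent[OF T free])
  have cinv: "continuous_on (sphere 0 s) (\<lambda>z::complex. 1 / z)"
    by (intro continuous_intros) (use nz in auto)
  have cid: "continuous_on (sphere 0 s) (\<lambda>z. (1 / z) *\<^sub>C (id_blinfun :: 'a \<Rightarrow>\<^sub>L 'a))"
    by (intro bounded_bilinear.continuous_on[OF bounded_bilinear_scaleC] cinv continuous_on_const)
  have "cmean s (\<lambda>z. (1 / z) *\<^sub>C id_blinfun) = 1 *\<^sub>C (id_blinfun :: 'a \<Rightarrow>\<^sub>L 'a)"
    using has_contour_integral_cauchy_kernel[of 0 s] s by (intro cmean_scaleC_const cinv) auto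
  then have "cmean s (resolvent T) - id_blinfun = cmean s (\<lambda>z. resolvent T z - (1 / z) *\<^sub>C id_blinfun)"
    using cmean_diff[OF _ cont cid] s by (simp add: scaleC_one)
  moreover have "cmean r (resolvent T) = cmean s (resolvent T)"
    by (rule cmean_resolvent_radius[OF T r s(1)]) (use inside in auto)
  moreover have "norm (cmean s (\<lambda>z. resolvent T z - (1 / z) *\<^sub>C id_blinfun)) \<le> s * (norm T / (s - norm T) / s)"
  proof (rule norm_cmean_le)
    fix z :: complex assume z: "z \<in> sphere 0 s"
    have zs: "z \<notin> spectrum T" using free z by blast
    have "resolvent T z - (1 / z) *\<^sub>C id_blinfun = (1 / z) *\<^sub>C (T o\<^sub>L resolvent T z)"
      using nz[OF z] by (simp add: compose_resolvent[OF T zs] scaleC_simps)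
    then have "norm (resolvent T z - (1 / z) *\<^sub>C id_blinfun) = norm (T o\<^sub>L resolvent T z) / s"
      using z by (simp add: norm_scaleC norm_divide)
    also have "\<dots> \<le> norm T * (1 / (s - norm T)) / s"
      using resolvent_large(2)[OF T, of z] z s
      by (intro divide_right_mono norm_blinfun_compose_mono) auto
    finally show "norm (resolvent T z - (1 / z) *\<^sub>C id_blinfun) \<le> norm T / (s - norm T) / s" by simp
  qed (use s in \<open>auto intro!: continuous_on_diff cont cid\<close>)
  ultimately have "d \<le> norm T / (s - norm T)"
    using s by (simp add: d_def)
  then have "d * (s - norm T) \<le> norm T" using s by (simp add: pos_le_divide_eq)
  moreover have "norm T + d \<le> d * (s - norm T)"
    using mult_left_mono[OF s(4), of d] d by (simp add: distrib_left)
  ultimately show False using d by linarith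
qed

text \<open>The resolvent identity under the integral. The right-hand side makes sense for every
  \<open>z\<close> in the open disc, spectral or not; it provides the holomorphic extension of
  \<open>R(z) (1 - Q)\<close> across the inner spectrum.\<close>

lemma resolvent_complement_formula:
  fixes T :: "'a::chilbert_space \<Rightarrow>\<^sub>L 'a"
  assumes T: "T \<in> bounded_ops" and r: "0 < r" and free: "sphere 0 r \<inter> spectrum T = {}"
    and z: "cmod z < r" "z \<notin> spectrum T"
  shows "resolvent T z o\<^sub>L (id_blinfun - cmean r (resolvent T))
    = cmean r (\<lambda>w. (1 / (w - z)) *\<^sub>C resolvent T w)"
proof -
  let ?R = "resolvent T"
  have nz: "w - z \<noteq> 0" if "w \<in> sphere 0 r" for w using that z by auto
  have cont: "continuous_on (sphere 0 r) ?R" by (rule continuous_on_resolvent[OF T free])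
  have ck: "continuous_on (sphere 0 r) (\<lambda>w. 1 / (w - z))"
    by (intro continuous_intros) (use nz in auto)
  note cs = bounded_bilinear.continuous_on[OF bounded_bilinear_scaleC ck]
  have r0: "0 \<le> r" using r by simp
  have "?R z o\<^sub>L cmean r ?R = cmean r (\<lambda>w. ?R z o\<^sub>L ?R w)"
    by (rule cmean_linear[OF r0 cont bounded_bilinear.bounded_linear_right[OF bounded_bilinear_blinfun_compose], symmetric])
      (rule compose_scaleC_right[OF resolvent_in_bounded_ops[OF z(2)]])
  also have "\<dots> = cmean r (\<lambda>w. (1 / (w - z)) *\<^sub>C ?R z - (1 / (w - z)) *\<^sub>C ?R w)"
  proof (rule cmean_cong[OF r0])
    fix w :: complex assume w: "w \<in> sphere 0 r"
    then have ws: "w \<notin> spectrum T" using free by blast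
    show "?R z o\<^sub>L ?R w = (1 / (w - z)) *\<^sub>C ?R z - (1 / (w - z)) *\<^sub>C ?R w"
      unfolding scaleC_diff_right[symmetric] resolvent_identity[OF T z(2) ws] scaleC_scaleC
      using nz[OF w] by (simp add: scaleC_one)
  qed
  also have "\<dots> = cmean r (\<lambda>w. (1 / (w - z)) *\<^sub>C ?R z) - cmean r (\<lambda>w. (1 / (w - z)) *\<^sub>C ?R w)"
    by (rule cmean_diff[OF r0 cs[OF continuous_on_const] cs[OF cont]])
  also have "cmean r (\<lambda>w. (1 / (w - z)) *\<^sub>C ?R z) = 1 *\<^sub>C ?R z"
    by (rule cmean_scaleC_const[OF r0 ck has_contour_integral_cauchy_kernel[OF z(1)]])
  finally show ?thesis by (simp add: compose_diff_right scaleC_one)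
qed

lemma sum_list_sum_swap: "(\<Sum>x\<leftarrow>xs. \<Sum>i\<in>I. f x i) = (\<Sum>i\<in>I. \<Sum>x\<leftarrow>xs. f x i :: 'a::comm_monoid_add)"
  by (induction xs) (simp_all add: sum.distrib)

text \<open>Off the finite set \<open>E\<close> the function \<open>z \<mapsto> R(z) (1 - Q)\<close> extends holomorphically across the
  rest of the spectrum, so each path of the cycle may be treated separately by the residue
  theorem, whatever it does near the rest of the spectrum.\<close>

lemma riesz_integral_absorbs:
  fixes T :: "'a::chilbert_space \<Rightarrow>\<^sub>L 'a"
  assumes T: "T \<in> bounded_ops" and sep: "separating_cycle T E G"
    and E: "finite E" "E \<subseteq> spectrum T" and r: "0 \<le> s" "s < r"
    and outer: "\<And>e. e \<in> E \<Longrightarrow> r < cmod e"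
    and inner: "\<And>z. z \<in> spectrum T - E \<Longrightarrow> cmod z \<le> s"
  shows "((1 / (2 * of_real pi * \<i>)) *\<^sub>C resolvent_integral T G) o\<^sub>L (id_blinfun - cmean r (resolvent T))
    = id_blinfun - cmean r (resolvent T)" (is "?P o\<^sub>L ?C = _")
proof (rule coef_eqI)
  fix x y
  have r0: "0 < r" "0 \<le> r" using r by auto
  have free: "sphere 0 r \<inter> spectrum T = {}"
  proof (rule ccontr)
    assume "sphere 0 r \<inter> spectrum T \<noteq> {}"
    then obtain z where "z \<in> spectrum T" "z \<in> sphere 0 r" by blast
    then show False using outer[of z] inner[of z] r by (cases "z \<in> E") auto
  qed
  note contR = continuous_on_resolvent[OF T free]
  define f where "f z = coef (blinfun_apply ?C x) y (resolvent T z)" for z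
  \<comment> \<open>The Cauchy-type integral that gives the extension inside the disc; the exponent
    1 fits the theorem on differentiating such integrals.\<close>
  define g where "g z = contour_integral (circlepath 0 r) (\<lambda>w. coef x y (resolvent T w) / (w - z) ^ 1)" for z
  have f_eq_g: "f z = g z / (2 * of_real pi * \<i>)" if z: "cmod z < r" "z \<notin> spectrum T" for z
  proof -
    have cont: "continuous_on (sphere 0 r) (\<lambda>w. (1 / (w - z)) *\<^sub>C resolvent T w)"
      by (intro bounded_bilinear.continuous_on[OF bounded_bilinear_scaleC] contR continuous_intros)
        (use z in auto)
    have "f z = coef x y (resolvent T z o\<^sub>L ?C)" by (simp add: f_def coef_compose)
    also have "\<dots> = coef x y (cmean r (\<lambda>w. (1 / (w - z)) *\<^sub>C resolvent T w))"
      by (simp only: resolvent_complement_formula[OF T r0(1) free z])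
    finally show ?thesis
      unfolding cmean_coef_div[OF r0(2) cont] g_def coef_scaleC by simp
  qed
  have contf: "continuous_on (path_image (circlepath 0 r)) (\<lambda>w. coef x y (resolvent T w))"
    using r0 bounded_linear.continuous_on[OF bounded_linear_coef contR] by simp
  have "g field_differentiable (at z)" if z: "z \<in> ball 0 r" for z
  proof -
    have "((\<lambda>u. coef x y (resolvent T u) / (u - w) ^ 1) has_contour_integral g w) (circlepath 0 r)"
      if "w \<in> ball 0 r" for w
    proof -
      have "continuous_on (path_image (circlepath 0 r)) (\<lambda>u. coef x y (resolvent T u) / (u - w) ^ 1)"
        by (intro continuous_intros contf) (use that r0 in auto)
      then show ?thesis
        unfolding g_def by (intro has_contour_integral_integral contour_integrable_continuous_circlepath)
    qed
    from Cauchy_next_derivative_circlepath(2)[OF contf this _ z] show ?thesis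
      unfolding field_differentiable_def by auto
  qed
  then have holg: "g holomorphic_on ball 0 r"
    unfolding holomorphic_on_def using field_differentiable_at_within by blast
  \<comment> \<open>Both formulas agree off the spectrum. The disc of radius \<open>r\<close> and
    the points of modulus above \<open>s\<close> outside \<open>E\<close> together exhaust the
    complement of \<open>E\<close>, so \<open>F\<close> has only finitely many
    singularities.\<close>
  define F where "F z = (if cmod z < r then g z / (2 * of_real pi * \<i>) else f z)" for z
  have Ff: "F z = f z" if "z \<notin> spectrum T" for z
    using f_eq_g[OF _ that] by (simp add: F_def)
  have "F holomorphic_on ball 0 r \<union> (- cball 0 s - E)"
  proof (rule holomorphic_on_Un)
    have "(\<lambda>z. g z / (2 * of_real pi * \<i>)) holomorphic_on ball 0 r"
      by (intro holomorphic_intros holg) auto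
    then show "F holomorphic_on ball 0 r"
      by (rule holomorphic_transform) (simp add: F_def)
    have disj: "(- cball 0 s - E) \<inter> spectrum T = {}" using inner by fastforce
    have "f holomorphic_on (- cball 0 s - E)"
      unfolding f_def by (rule holomorphic_on_coef_resolvent[OF T disj])
    then show "F holomorphic_on (- cball 0 s - E)"
      by (rule holomorphic_transform) (metis Ff disj disjoint_iff)
    show "open (- cball 0 s - E)" using E(1) by (intro open_Diff finite_imp_closed) auto
  qed auto
  moreover have "UNIV - E \<subseteq> ball 0 r \<union> (- cball 0 s - E)"
    using r outer by fastforce
  ultimately have holF: "F holomorphic_on UNIV - E" by (rule holomorphic_on_subset)
  have res: "contour_integral \<gamma> f = 2 * of_real pi * \<i> * (\<Sum>e\<in>E. winding_number \<gamma> e * residue F e)"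
    if \<gamma>: "valid_path \<gamma>" "pathfinish \<gamma> = pathstart \<gamma>" "path_image \<gamma> \<inter> spectrum T = {}" for \<gamma>
  proof -
    have "contour_integral \<gamma> f = contour_integral \<gamma> F"
    proof (rule contour_integral_cong[OF refl])
      fix z assume "z \<in> path_image \<gamma>"
      then have "z \<notin> spectrum T" using \<gamma>(3) by blast
      then show "f z = F z" by (simp add: Ff)
    qed
    also have "\<dots> = 2 * pi * \<i> * (\<Sum>e\<in>E. winding_number \<gamma> e * residue F e)"
      by (rule Residue_theorem[OF open_UNIV connected_UNIV E(1) holF \<gamma>(1,2)]) (use \<gamma>(3) E(2) in auto)
    finally show ?thesis by simp
  qed
  \<comment> \<open>A circle around the whole spectrum, on which the resolvent integrates to the
    identity. It identifies the sum of the residues at \<open>E\<close> with the coefficient of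
    \<open>1 - Q\<close>, and the cycle has the same winding numbers about \<open>E\<close>.\<close>
  define R where "R = norm T + r + 1"
  have R: "0 < R" "\<And>z. z \<in> spectrum T \<Longrightarrow> cmod z < R"
  proof -
    show "0 < R" using r0 norm_ge_zero[of T] unfolding R_def by linarith
    show "cmod z < R" if "z \<in> spectrum T" for z
      using resolvent_large(1)[OF T, of z] that r0 unfolding R_def by linarith
  qed
  have freeR: "sphere 0 R \<inter> spectrum T = {}" using R by fastforce
  have "contour_integral (circlepath 0 R) f = 2 * of_real pi * \<i> * coef (blinfun_apply ?C x) y (cmean R (resolvent T))"
    unfolding f_def by (rule cmean_coef[symmetric]) (use R continuous_on_resolvent[OF T freeR] in auto)
  also have "\<dots> = 2 * of_real pi * \<i> * coef x y ?C"
    using cmean_resolvent_large[OF T R] by (simp add: coef_def)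
  finally have big: "contour_integral (circlepath 0 R) f = 2 * of_real pi * \<i> * coef x y ?C" .
  have "contour_integral (circlepath 0 R) f = 2 * of_real pi * \<i> * (\<Sum>e\<in>E. winding_number (circlepath 0 R) e * residue F e)"
    by (rule res) (use freeR R in auto)
  also have "\<dots> = 2 * of_real pi * \<i> * (\<Sum>e\<in>E. residue F e)"
    using R E(2) by (auto simp: winding_number_circlepath intro!: sum.cong)
  finally have sumres: "(\<Sum>e\<in>E. residue F e) = coef x y ?C" using big by simp
  have G: "\<And>\<gamma>. \<gamma> \<in> set G \<Longrightarrow> valid_path \<gamma> \<and> pathfinish \<gamma> = pathstart \<gamma> \<and> path_image \<gamma> \<inter> spectrum T = {}"
    and wind: "\<And>z. z \<in> spectrum T \<Longrightarrow> (\<Sum>\<gamma>\<leftarrow>G. winding_number \<gamma> z) = (if z \<in> E then 1 else 0)"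
    using sep by (auto simp: separating_cycle_def)
  have "coef (blinfun_apply ?C x) y (resolvent_integral T G) = (\<Sum>\<gamma>\<leftarrow>G. contour_integral \<gamma> f)"
    unfolding f_def by (rule coef_resolvent_integral[OF T]) (use G in blast)
  also have "\<dots> = (\<Sum>\<gamma>\<leftarrow>G. 2 * of_real pi * \<i> * (\<Sum>e\<in>E. winding_number \<gamma> e * residue F e))"
    by (intro arg_cong[of _ _ sum_list] map_cong refl res) (use G in auto)
  also have "\<dots> = 2 * of_real pi * \<i> * (\<Sum>e\<in>E. (\<Sum>\<gamma>\<leftarrow>G. winding_number \<gamma> e) * residue F e)"
    by (simp only: sum_list_const_mult sum_list_sum_swap sum_list_mult_const)
  also have "\<dots> = 2 * of_real pi * \<i> * (\<Sum>e\<in>E. residue F e)"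
  proof -
    have "(\<Sum>\<gamma>\<leftarrow>G. winding_number \<gamma> e) = 1" if "e \<in> E" for e using wind[of e] that E(2) by auto
    then show ?thesis by simp
  qed
  finally have "coef (blinfun_apply ?C x) y (resolvent_integral T G) = 2 * of_real pi * \<i> * coef x y ?C"
    by (simp only: sumres)
  then show "coef x y (?P o\<^sub>L ?C) = coef x y ?C"
    by (simp add: coef_compose coef_scaleC)
qed

text \<open>Around each \<open>e\<close> in \<open>E\<close> lies a circle of half a lower bound
  \<open>d e\<close> for its distance to the other spectral points. Existence is what makes the
  \<open>SOME\<close> in \<open>riesz_idempotent\<close> meaningful.\<close>

lemma separating_cycle_exists:
  fixes T :: "'a::complex_normed_vector \<Rightarrow>\<^sub>L 'a"
  assumes E: "finite E" "E \<subseteq> spectrum T" and iso: "\<And>z. z \<in> E \<Longrightarrow> \<not> z islimpt spectrum T"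
  shows "\<exists>G. separating_cycle T E G"
proof -
  have "\<exists>d>0. \<forall>z\<in>spectrum T. z \<noteq> e \<longrightarrow> d \<le> dist z e" if "e \<in> E" for e
    using iso[OF that] unfolding islimpt_approachable by (metis not_less)
  then obtain d where d: "\<And>e. e \<in> E \<Longrightarrow> d e > 0"
    "\<And>e z. e \<in> E \<Longrightarrow> z \<in> spectrum T \<Longrightarrow> z \<noteq> e \<Longrightarrow> d e \<le> dist z e" by metis
  obtain xs where xs: "set xs = E" "distinct xs" using finite_distinct_list[OF E(1)] by blast
  define G where "G = map (\<lambda>e. circlepath e (d e / 2)) xs"
  have "valid_path \<gamma> \<and> pathfinish \<gamma> = pathstart \<gamma> \<and> path_image \<gamma> \<inter> spectrum T = {}" if \<gamma>: "\<gamma> \<in> set G" for \<gamma>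
  proof -
    obtain e where e: "e \<in> E" "\<gamma> = circlepath e (d e / 2)" using \<gamma> xs by (auto simp: G_def)
    have "z \<notin> spectrum T" if "z \<in> sphere e (d e / 2)" for z
    proof
      assume z: "z \<in> spectrum T"
      have "z \<noteq> e" using that d(1)[OF e(1)] by auto
      then show False using that d(1)[OF e(1)] d(2)[OF e(1) z] by (simp add: dist_commute)
    qed
    then show ?thesis using e d(1)[OF e(1)] by auto
  qed
  moreover have "(\<Sum>\<gamma>\<leftarrow>G. winding_number \<gamma> z) = (if z \<in> E then 1 else 0)" if z: "z \<in> spectrum T" for z
  proof -
    have wn: "winding_number (circlepath e (d e / 2)) z = (if e = z then 1 else 0)" if e: "e \<in> E" for e
    proof (cases "e = z")
      case True
      then show ?thesis using d(1)[OF e] by (simp add: winding_number_circlepath)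
    next
      case False
      then have "z \<notin> cball e (d e / 2)" using d(1)[OF e] d(2)[OF e z] by (auto simp: dist_commute)
      then have "winding_number (circlepath e (d e / 2)) z = 0"
        using d(1)[OF e] by (intro winding_number_zero_outside[of _ "cball e (d e / 2)"]) auto
      then show ?thesis using False by simp
    qed
    have "(\<Sum>\<gamma>\<leftarrow>G. winding_number \<gamma> z) = (\<Sum>e\<in>E. winding_number (circlepath e (d e / 2)) z)"
      by (simp add: G_def o_def sum_list_distinct_conv_sum_set[OF xs(2)] xs(1))
    also have "\<dots> = (\<Sum>e\<in>E. if e = z then 1 else 0)" using wn by (intro sum.cong) auto
    also have "\<dots> = (if z \<in> E then 1 else 0)" using E(1) by simp
    finally show ?thesis .
  qed
  ultimately have "separating_cycle T E G" unfolding separating_cycle_def by blast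
  then show ?thesis ..
qed

lemma geom_decay_of_complement:
  fixes T :: "'a::chilbert_space \<Rightarrow>\<^sub>L 'a"
  assumes T: "T \<in> bounded_ops" and r: "0 < r" "r < 1" and free: "sphere 0 r \<inter> spectrum T = {}"
    and p: "poly_op p T o\<^sub>L (id_blinfun - cmean r (resolvent T)) = 0"
  shows "geom_decay T (poly_op p T)"
proof -
  obtain K where K: "\<And>n. norm (op_power T n o\<^sub>L cmean r (resolvent T)) \<le> K * r ^ n"
    by (rule geom_decay_cmean[OF T r(1) free]) blast
  have "poly_op p T = poly_op p T o\<^sub>L cmean r (resolvent T)"
    using p by (simp add: compose_diff_right)
  then have "op_power T n o\<^sub>L poly_op p T = poly_op p T o\<^sub>L (op_power T n o\<^sub>L cmean r (resolvent T))" for n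
    by (metis blinfun_compose_assoc poly_op_power_commute[OF T])
  then have "norm (op_power T n o\<^sub>L poly_op p T) \<le> (norm (poly_op p T) * K) * r ^ n" for n
    using norm_blinfun_compose_mono[OF order_refl K[of n], of "poly_op p T"] by (simp add: mult.assoc)
  then show ?thesis unfolding geom_decay_def using r by (metis less_imp_le)
qed

theorem algebraic_on_peripheral_imp_null_orbit_reflexive:
  fixes T :: "'a::chilbert_space \<Rightarrow>\<^sub>L 'a"
  assumes T: "T \<in> bounded_ops" and rad: "spectral_radius T = 1"
    and E_def: "E = spectrum T \<inter> {z. cmod z = 1}"
    and iso: "\<And>z. z \<in> E \<Longrightarrow> \<not> z islimpt spectrum T"
    and alg: "algebraic_on T (spectral_subspace T E)"
  shows "null_orbit_reflexive T"
proof -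
  have comp: "compact (spectrum T)" by (rule compact_spectrum[OF T])
  have le1: "cmod z \<le> 1" if "z \<in> spectrum T" for z
  proof -
    have "bdd_above (cmod ` spectrum T)"
      by (intro bounded_imp_bdd_above compact_imp_bounded compact_continuous_image comp continuous_intros)
    then have "cmod z \<le> Sup (cmod ` spectrum T)" using that by (intro cSup_upper) auto
    then show ?thesis using rad by (simp add: spectral_radius_def)
  qed
  have "compact E"
  proof -
    have "E = spectrum T \<inter> sphere 0 1" by (auto simp: E_def)
    then show ?thesis using comp by (simp add: compact_Int)
  qed
  \<comment> \<open>\<open>E\<close> is compact and none of its points is a limit point of the
    spectrum.\<close>
  then have "finite (E \<inter> spectrum T)" using iso by (rule finite_not_islimpt_in_compact)
  moreover have Esub: "E \<subseteq> spectrum T" by (auto simp: E_def)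
  ultimately have fin: "finite E" by (simp add: Int_absorb2)
  \<comment> \<open>A limit point of the rest is a limit point of the spectrum, hence not in
    \<open>E\<close>. So the rest is compact, and its maximal modulus \<open>s\<close> stays below
    1.\<close>
  have "closed (spectrum T - E)"
    unfolding closed_limpt
    using iso closed_spectrum[OF T] closed_limpt islimpt_subset[of _ "spectrum T - E" "spectrum T"] by blast
  then have compK: "compact (spectrum T - E)"
    using comp by (metis Diff_subset bounded_subset compact_eq_bounded_closed)
  obtain s where s: "0 \<le> s" "s < 1" "\<And>z. z \<in> spectrum T - E \<Longrightarrow> cmod z \<le> s"
  proof (cases "spectrum T - E = {}")
    case True
    show ?thesis by (rule that[of 0]) (use True in auto)
  next
    case False
    have "continuous_on (spectrum T - E) cmod" by (intro continuous_intros)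
    from continuous_attains_sup[OF compK False this] obtain w
      where w: "w \<in> spectrum T - E" "\<And>z. z \<in> spectrum T - E \<Longrightarrow> cmod z \<le> cmod w" by blast
    moreover have "cmod w < 1" using w(1) le1[of w] by (auto simp: E_def)
    ultimately show ?thesis using that[of "cmod w"] by simp
  qed
  define r where "r = (1 + s) / 2"
  have r: "s < r" "0 < r" "r < 1" using s by (auto simp: r_def)
  have outer: "r < cmod e" if "e \<in> E" for e using that r by (simp add: E_def)
  have free: "sphere 0 r \<inter> spectrum T = {}"
  proof (rule ccontr)
    assume "sphere 0 r \<inter> spectrum T \<noteq> {}"
    then obtain z where "z \<in> spectrum T" "z \<in> sphere 0 r" by blast
    then show False using outer[of z] s(3)[of z] r by (cases "z \<in> E") auto
  qed
  define G where "G = (SOME G. separating_cycle T E G)"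
  have sep: "separating_cycle T E G"
    unfolding G_def by (rule someI_ex[OF separating_cycle_exists[OF fin Esub iso]])
  have P: "riesz_idempotent T E o\<^sub>L (id_blinfun - cmean r (resolvent T)) = id_blinfun - cmean r (resolvent T)"
    unfolding riesz_idempotent_def G_def[symmetric]
    by (rule riesz_integral_absorbs[OF T sep fin Esub s(1) r(1) outer s(3)])
  obtain p where p: "p \<noteq> 0" "\<And>x. x \<in> spectral_subspace T E \<Longrightarrow> blinfun_apply (poly_op p T) x = 0"
    using alg by (auto simp: algebraic_on_def)
  have "poly_op p T o\<^sub>L riesz_idempotent T E = 0"
    using p(2) by (intro blinfun_eqI) (simp add: spectral_subspace_def)
  then have "poly_op p T o\<^sub>L (id_blinfun - cmean r (resolvent T)) = 0"
    by (subst P[symmetric]) (simp flip: blinfun_compose_assoc)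
  then have "geom_decay T (poly_op p T)"
    by (rule geom_decay_of_complement[OF T r(2,3) free])
  then show ?thesis
    using geom_decay_imp_null_orbit_reflexive[OF complete_UNIV T p(1)] by blast
qed

section \<open>Compact operators\<close>

lemma compact_op_convergent_subsequence:
  assumes T: "compact_op T" and u: "\<And>n::nat. norm (u n) \<le> 1"
  obtains r y where "strict_mono r" "(\<lambda>n. blinfun_apply T (u (r n))) \<longlonglongrightarrow> y"
proof -
  have K: "compact (closure (blinfun_apply T ` cball 0 1))" using T by (simp add: compact_op_def)
  have "\<forall>n. blinfun_apply T (u n) \<in> closure (blinfun_apply T ` cball 0 1)"
    using u closure_subset[of "blinfun_apply T ` cball 0 1"] by auto
  then obtain y r where "strict_mono r" "((\<lambda>n. blinfun_apply T (u n)) \<circ> r) \<longlonglongrightarrow> y"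
    by (rule seq_compactE[OF compact_imp_seq_compact[OF K]])
  then show ?thesis unfolding o_def by (rule that)
qed

lemma compact_op_no_separated_sequence:
  assumes T: "compact_op T" and u: "\<And>n::nat. norm (u n) \<le> 1" and d: "0 < d"
    and sep: "\<And>m n. m < n \<Longrightarrow> d \<le> norm (blinfun_apply T (u n) - blinfun_apply T (u m))"
  shows False
proof -
  obtain r l where r: "strict_mono r" "(\<lambda>n. blinfun_apply T (u (r n))) \<longlonglongrightarrow> l"
    by (rule compact_op_convergent_subsequence[OF T u])
  from metric_CauchyD[OF LIMSEQ_imp_Cauchy[OF r(2)] d] obtain N
    where N: "\<And>m n. m \<ge> N \<Longrightarrow> n \<ge> N \<Longrightarrow> dist (blinfun_apply T (u (r m))) (blinfun_apply T (u (r n))) < d"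
    by blast
  have "r N < r (Suc N)" using r(1) by (simp add: strict_mono_def)
  from sep[OF this] N[of "Suc N" N] show False by (simp add: dist_norm)
qed

text \<open>Riesz's lemma: a nearly closest point \<open>v\<close> of \<open>V\<close> to
  \<open>w\<close> is subtracted and the difference normalised. The vector is kept in the form
  \<open>c (w - v)\<close> so that its membership in a larger subspace can be read off.\<close>

lemma riesz_almost_orthogonal:
  fixes V :: "'a::real_normed_vector set"
  assumes V: "subspace V" "closed V" and w: "w \<notin> V" and \<theta>: "\<theta> < 1"
  obtains v c where "v \<in> V" "norm (c *\<^sub>R (w - v)) = 1" "\<And>v'. v' \<in> V \<Longrightarrow> \<theta> \<le> norm (c *\<^sub>R (w - v) - v')"
proof -
  have ne: "V \<noteq> {}" using V(1) subspace_0 by blast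
  define d where "d = infdist w V"
  have d: "d > 0" unfolding d_def by (rule infdist_pos_not_in_closed[OF V(2) ne w])
  \<comment> \<open>Raises \<open>\<theta>\<close> to a positive number below 1, by which the
    distance can be divided.\<close>
  define s where "s = max \<theta> (1 / 2)"
  have s: "0 < s" "s < 1" "\<theta> \<le> s" using \<theta> by (auto simp: s_def)
  have "d < d / s" using d s by (simp add: less_divide_eq)
  then have "\<exists>v\<in>V. dist w v < d / s"
    unfolding d_def using ne by (subst (asm) infdist_notempty) (auto simp: cINF_less_iff)
  then obtain v where v: "v \<in> V" "norm (w - v) < d / s" by (auto simp: dist_norm)
  have pos: "norm (w - v) > 0" using v w by auto
  define c where "c = inverse (norm (w - v))"
  have c: "c > 0" using pos by (simp add: c_def)
  show ?thesis
  proof (rule that[OF v(1), of c])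
    show "norm (c *\<^sub>R (w - v)) = 1" using pos by (simp add: c_def)
    fix v' assume v': "v' \<in> V"
    have "v + inverse c *\<^sub>R v' \<in> V" using V(1) v(1) v' by (simp add: subspace_add subspace_scale)
    then have "d \<le> norm (w - (v + inverse c *\<^sub>R v'))" unfolding d_def using infdist_le by (metis dist_norm)
    then have "c * d \<le> norm (c *\<^sub>R (w - (v + inverse c *\<^sub>R v')))" using c by (simp add: mult_left_mono)
    also have "c *\<^sub>R (w - (v + inverse c *\<^sub>R v')) = c *\<^sub>R (w - v) - v'"
      using c by (simp add: algebra_simps)
    finally have "c * d \<le> norm (c *\<^sub>R (w - v) - v')" .
    moreover have "s \<le> c * d"
      using v(2) s pos by (simp add: c_def field_simps)
    ultimately show "\<theta> \<le> norm (c *\<^sub>R (w - v) - v')" using s by linarith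
  qed
qed

lemma complex_subspace_imp_subspace: "complex_vector.subspace V \<Longrightarrow> subspace V"
  unfolding complex_vector.subspace_def subspace_def by (simp add: scaleR_scaleC)

lemma riesz_almost_orthogonal_in:
  assumes V: "complex_vector.subspace V" "closed V" and W: "complex_vector.subspace W" "V \<subseteq> W" "V \<noteq> W"
    and \<theta>: "\<theta> < 1"
  obtains u where "u \<in> W" "norm u = 1" "\<And>v. v \<in> V \<Longrightarrow> \<theta> \<le> norm (u - v)"
proof -
  obtain w where w: "w \<in> W" "w \<notin> V" using W by blast
  obtain v c where v: "v \<in> V" "norm (c *\<^sub>R (w - v)) = 1" "\<And>v'. v' \<in> V \<Longrightarrow> \<theta> \<le> norm (c *\<^sub>R (w - v) - v')"
    by (rule riesz_almost_orthogonal[OF complex_subspace_imp_subspace[OF V(1)] V(2) w(2) \<theta>]) blast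
  have "c *\<^sub>R (w - v) \<in> W"
    using w v(1) W(2) complex_subspace_imp_subspace[OF W(1)] by (blast intro: subspace_diff subspace_scale)
  then show ?thesis using v(2,3) by (rule that)
qed

lemma norm_scaleC_plus_subspace_ge:
  assumes V: "complex_vector.subspace V" and v: "v \<in> V" and l: "0 < d" "d \<le> cmod l"
    and u: "\<And>v. v \<in> V \<Longrightarrow> 1 / 2 \<le> norm (u - v)"
  shows "d / 2 \<le> norm (l *\<^sub>C u + v)"
proof -
  have l0: "l \<noteq> 0" using l by auto
  have "- (inverse l *\<^sub>C v) \<in> V"
    using V v by (simp add: complex_vector.subspace_neg complex_vector.subspace_scale)
  from u[OF this] have "cmod l * (1 / 2) \<le> cmod l * norm (u + inverse l *\<^sub>C v)"
    by (intro mult_left_mono) auto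
  also have "\<dots> = norm (l *\<^sub>C u + v)"
    using l0 by (simp add: scaleC_simps flip: norm_scaleC)
  finally show ?thesis using l(2) by simp
qed

text \<open>If every inclusion were strict, take unit vectors \<open>u n\<close> in
  \<open>V (Suc n)\<close> at distance at least \<open>1/2\<close> from \<open>V n\<close>. For
  \<open>m < n\<close> the difference \<open>T (u n) - T (u m)\<close> is \<open>l n\<close> times
  \<open>u n\<close> plus an element of \<open>V n\<close>, so the images are \<open>d / 2\<close>
  apart, against compactness.\<close>

lemma compact_op_increasing_chain:
  assumes T: "compact_op T" and V: "\<And>n::nat. complex_vector.subspace (V n)" "\<And>n. closed (V n)"
    and mono: "\<And>n. V n \<subseteq> V (Suc n)" and d: "0 < d" "\<And>n. d \<le> cmod (l n)"
    and inv: "\<And>n x. x \<in> V n \<Longrightarrow> blinfun_apply T x \<in> V n"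
    and shift: "\<And>n x. x \<in> V (Suc n) \<Longrightarrow> blinfun_apply T x - l n *\<^sub>C x \<in> V n"
  shows "\<exists>n. V (Suc n) = V n"
proof (rule ccontr)
  assume neg: "\<nexists>n. V (Suc n) = V n"
  have le: "V m \<subseteq> V n" if "m \<le> n" for m n using lift_Suc_mono_le[of V, OF mono that] .
  have "\<exists>u. u \<in> V (Suc n) \<and> norm u = 1 \<and> (\<forall>v\<in>V n. 1 / 2 \<le> norm (u - v))" for n
  proof -
    have ne: "V n \<noteq> V (Suc n)" using neg by metis
    show ?thesis
      by (rule riesz_almost_orthogonal_in[OF V(1) V(2) V(1) mono ne, of "1 / 2"]) auto
  qed
  then obtain u where u: "\<And>n. u n \<in> V (Suc n)" "\<And>n. norm (u n) = 1"
    "\<And>n v. v \<in> V n \<Longrightarrow> 1 / 2 \<le> norm (u n - v)" by metis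
  show False
  proof (rule compact_op_no_separated_sequence[OF T])
    show "norm (u n) \<le> 1" for n using u(2)[of n] by simp
    show "0 < d / 2" using d by simp
    fix m n :: nat assume mn: "m < n"
    have "u m \<in> V n" using u(1)[of m] le[of "Suc m" n] mn by auto
    then have "(blinfun_apply T (u n) - l n *\<^sub>C u n) - blinfun_apply T (u m) \<in> V n"
      by (intro complex_vector.subspace_diff[OF V(1)] shift[OF u(1)] inv)
    from norm_scaleC_plus_subspace_ge[OF V(1) this d(1) d(2) u(3), of n n]
    show "d / 2 \<le> norm (blinfun_apply T (u n) - blinfun_apply T (u m))" by simp
  qed
qed

text \<open>The mirror image: \<open>u m\<close> lies in \<open>V m\<close>, almost orthogonal to
  \<open>V (Suc m)\<close>, and \<open>T (u m) - T (u n)\<close> is \<open>l\<close> times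
  \<open>u m\<close> plus an element of \<open>V (Suc m)\<close>.\<close>

lemma compact_op_decreasing_chain:
  assumes T: "compact_op T" and V: "\<And>n::nat. complex_vector.subspace (V n)" "\<And>n. closed (V n)"
    and mono: "\<And>n. V (Suc n) \<subseteq> V n" and l: "l \<noteq> 0"
    and inv: "\<And>n x. x \<in> V n \<Longrightarrow> blinfun_apply T x \<in> V n"
    and shift: "\<And>n x. x \<in> V n \<Longrightarrow> blinfun_apply T x - l *\<^sub>C x \<in> V (Suc n)"
  shows "\<exists>n. V (Suc n) = V n"
proof (rule ccontr)
  assume neg: "\<nexists>n. V (Suc n) = V n"
  have le: "V n \<subseteq> V m" if "m \<le> n" for m n using lift_Suc_antimono_le[of V, OF mono that] .
  have "\<exists>u. u \<in> V n \<and> norm u = 1 \<and> (\<forall>v\<in>V (Suc n). 1 / 2 \<le> norm (u - v))" for n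
  proof -
    have ne: "V (Suc n) \<noteq> V n" using neg by metis
    show ?thesis
      by (rule riesz_almost_orthogonal_in[OF V(1) V(2) V(1) mono ne, of "1 / 2"]) auto
  qed
  then obtain u where u: "\<And>n. u n \<in> V n" "\<And>n. norm (u n) = 1"
    "\<And>n v. v \<in> V (Suc n) \<Longrightarrow> 1 / 2 \<le> norm (u n - v)" by metis
  show False
  proof (rule compact_op_no_separated_sequence[OF T])
    show "norm (u n) \<le> 1" for n using u(2)[of n] by simp
    show "0 < cmod l / 2" using l by simp
    fix m n :: nat assume mn: "m < n"
    have "u n \<in> V (Suc m)" using u(1)[of n] le[of "Suc m" n] mn by auto
    then have mem: "(blinfun_apply T (u m) - l *\<^sub>C u m) - blinfun_apply T (u n) \<in> V (Suc m)"
      by (intro complex_vector.subspace_diff[OF V(1)] shift[OF u(1)] inv)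
    have "cmod l / 2 \<le> norm (l *\<^sub>C u m + ((blinfun_apply T (u m) - l *\<^sub>C u m) - blinfun_apply T (u n)))"
      by (rule norm_scaleC_plus_subspace_ge[OF V(1) mem _ order_refl u(3)]) (use l in auto)
    then show "cmod l / 2 \<le> norm (blinfun_apply T (u n) - blinfun_apply T (u m))"
      by (simp add: norm_minus_commute)
  qed
qed

section \<open>Nonzero spectral values of compact operators are eigenvalues\<close>

lemma compact_op_bounded_below:
  fixes T :: "'a::complex_normed_vector \<Rightarrow>\<^sub>L 'a"
  assumes T: "compact_op T" and z: "z \<noteq> 0" and inj: "\<And>x. blinfun_apply T x = z *\<^sub>C x \<Longrightarrow> x = 0"
  shows "\<exists>c>0. \<forall>x. c * norm x \<le> norm (blinfun_apply (T - z *\<^sub>C id_blinfun) x)"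
proof (rule ccontr)
  define A where "A = T - z *\<^sub>C id_blinfun"
  have Ax: "blinfun_apply A x = blinfun_apply T x - z *\<^sub>C x" for x
    by (simp add: A_def blinfun.diff_left scaleC_blinfun_apply)
  assume "\<not> ?thesis"
  then have neg: "\<exists>x. \<not> c * norm x \<le> norm (blinfun_apply A x)" if "c > 0" for c
    using that unfolding A_def[symmetric] by blast
  have "\<exists>u. norm u = 1 \<and> norm (blinfun_apply A u) < inverse (of_nat (Suc n))" for n
  proof -
    obtain x where x: "norm (blinfun_apply A x) < inverse (of_nat (Suc n)) * norm x"
      using neg[of "inverse (of_nat (Suc n))"] by (auto simp: not_le)
    then have "x \<noteq> 0" by auto
    then have "norm (blinfun_apply A x) / norm x < inverse (of_nat (Suc n))"
      using x pos_divide_less_eq[of "norm x"] by simp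
    then show ?thesis
      using \<open>x \<noteq> 0\<close> by (intro exI[of _ "inverse (norm x) *\<^sub>R x"])
        (simp add: blinfun.scaleR_right divide_inverse mult.commute)
  qed
  then obtain u where u: "\<And>n. norm (u n) = 1" "\<And>n. norm (blinfun_apply A (u n)) < inverse (of_nat (Suc n))"
    by metis
  have "norm (u n) \<le> 1" for n by (simp add: u(1))
  then obtain r y where r: "strict_mono r" "(\<lambda>n. blinfun_apply T (u (r n))) \<longlonglongrightarrow> y"
    by (rule compact_op_convergent_subsequence[OF T])
  have "(\<lambda>n. blinfun_apply A (u n)) \<longlonglongrightarrow> 0"
    by (rule Lim_null_comparison[OF always_eventually LIMSEQ_inverse_real_of_nat])
      (use u(2) less_imp_le in blast)
  then have A0: "(\<lambda>n. blinfun_apply A (u (r n))) \<longlonglongrightarrow> 0"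
    using LIMSEQ_subseq_LIMSEQ[OF _ r(1)] unfolding o_def by blast
  \<comment> \<open>Since \<open>u = (T u - A u) / z\<close>, convergence of \<open>T u\<close>
    along the subsequence carries over to \<open>u\<close>; the limit is a unit eigenvector, which
    injectivity forbids.\<close>
  have "(\<lambda>n. inverse z *\<^sub>C (blinfun_apply T (u (r n)) - blinfun_apply A (u (r n)))) \<longlonglongrightarrow> inverse z *\<^sub>C (y - 0)"
    by (intro bounded_linear.tendsto[OF bounded_linear_scaleC] tendsto_diff A0 r(2))
  then have ulim: "(\<lambda>n. u (r n)) \<longlonglongrightarrow> inverse z *\<^sub>C y"
    using z by (simp add: Ax scaleC_scaleC scaleC_one)
  have "blinfun_apply T (inverse z *\<^sub>C y) = y"
    by (rule LIMSEQ_unique[OF blinfun.tendsto[OF tendsto_const ulim] r(2)])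
  then have "blinfun_apply T (inverse z *\<^sub>C y) = z *\<^sub>C (inverse z *\<^sub>C y)"
    using z by (simp add: scaleC_scaleC scaleC_one)
  then have "inverse z *\<^sub>C y = 0" by (rule inj)
  moreover have "norm (inverse z *\<^sub>C y) = 1"
    by (rule LIMSEQ_unique[OF tendsto_norm[OF ulim]]) (simp add: u(1))
  ultimately show False by (metis norm_zero zero_neq_one)
qed

lemma is_inverse_opI_bij:
  assumes A: "A \<in> bounded_ops" and c: "c > 0" "\<And>x. c * norm x \<le> norm (blinfun_apply A x)"
    and surj: "surj (blinfun_apply A)"
  shows "\<exists>B. is_inverse_op A B"
proof -
  have inj: "inj (blinfun_apply A)"
  proof (rule injI)
    fix x y assume "blinfun_apply A x = blinfun_apply A y"
    then have "c * norm (x - y) \<le> 0" using c(2)[of "x - y"] by (simp add: blinfun.diff_right)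
    then show "x = y" using c(1) by (simp add: mult_le_0_iff)
  qed
  define g where "g = inv (blinfun_apply A)"
  have Ag: "blinfun_apply A (g y) = y" for y unfolding g_def by (rule surj_f_inv_f[OF surj])
  have gA: "g (blinfun_apply A x) = x" for x unfolding g_def by (rule inv_f_f[OF inj])
  have gI: "g y = x" if "blinfun_apply A x = y" for x y using gA that by auto
  have "bounded_linear g"
  proof (rule bounded_linear_intro[where K = "inverse c"])
    show "g (x + y) = g x + g y" for x y by (rule gI) (simp add: blinfun.add_right Ag)
    show "g (t *\<^sub>R x) = t *\<^sub>R g x" for t x by (rule gI) (simp add: blinfun.scaleR_right Ag)
    show "norm (g x) \<le> norm x * inverse c" for x
      using c(2)[of "g x"] c(1) by (simp add: Ag field_simps)
  qed
  then have app: "blinfun_apply (Blinfun g) = g" by (rule bounded_linear_Blinfun_apply)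
  have "g (k *\<^sub>C x) = k *\<^sub>C g x" for k x by (rule gI) (simp add: bounded_opsD[OF A] Ag)
  then have "is_inverse_op A (Blinfun g)"
    unfolding is_inverse_op_def bounded_ops_def
    by (auto simp: app Ag gA intro!: blinfun_eqI)
  then show ?thesis ..
qed

text \<open>Suppose \<open>z\<close> is not an eigenvalue. Then \<open>A = T - z\<close> is bounded
  below, so the ranges of its powers are closed and their decreasing chain becomes stationary. From
  \<open>A^n y = A^(n+1) x\<close> injectivity of \<open>A^n\<close> gives \<open>y = A x\<close>,
  so \<open>A\<close> is onto and invertible.\<close>

lemma compact_op_spectrum_eigenvector:
  fixes T :: "'a::{complex_normed_vector, banach} \<Rightarrow>\<^sub>L 'a"
  assumes T: "compact_op T" and z: "z \<in> spectrum T" "z \<noteq> 0"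
  shows "\<exists>x. x \<noteq> 0 \<and> blinfun_apply T x = z *\<^sub>C x"
proof (rule ccontr)
  assume neg: "\<not> ?thesis"
  have Tops: "T \<in> bounded_ops" using T by (simp add: compact_op_def)
  define A where "A = T - z *\<^sub>C id_blinfun"
  have A: "A \<in> bounded_ops" using Tops by (auto simp: A_def)
  obtain c where c: "c > 0" "\<And>x. c * norm x \<le> norm (blinfun_apply A x)"
    using compact_op_bounded_below[OF T z(2)] neg unfolding A_def by blast
  have AT: "A o\<^sub>L T = T o\<^sub>L A"
    using Tops by (simp add: A_def compose_simps compose_scaleC_left compose_scaleC_right)
  have bb: "c ^ n * norm x \<le> norm (blinfun_apply (op_power A n) x)" for n x
  proof (induction n)
    case (Suc n)
    have "c ^ Suc n * norm x \<le> c * norm (blinfun_apply (op_power A n) x)"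
      using Suc c(1) by (simp add: mult.assoc)
    also have "\<dots> \<le> norm (blinfun_apply (op_power A (Suc n)) x)"
      using c(2) by (simp add: op_power_Suc)
    finally show ?case .
  qed simp
  define V where "V n = range (blinfun_apply (op_power A n))" for n
  have "\<exists>n. V (Suc n) = V n"
  proof (rule compact_op_decreasing_chain[OF T _ _ _ z(2)])
    fix n
    show "complex_vector.subspace (V n)"
      unfolding V_def complex_vector.subspace_def
      by (auto simp: image_iff simp flip: blinfun.add_right bounded_opsD[OF op_power_in_bounded_ops[OF A]])
        (metis blinfun.zero_right)
    have "complete (V n)"
      unfolding V_def
      by (rule complete_isometric_image[of "c ^ n"])
        (use c(1) bb in \<open>auto simp: blinfun.bounded_linear_right complete_UNIV\<close>)
    then show "closed (V n)" by (rule complete_imp_closed)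
    show "V (Suc n) \<subseteq> V n" by (auto simp: V_def op_power_Suc2)
    fix x assume "x \<in> V n"
    then obtain y where y: "x = blinfun_apply (op_power A n) y" by (auto simp: V_def)
    have "T o\<^sub>L op_power A n = op_power A n o\<^sub>L T" using AT by (intro op_power_commute) simp
    then have "blinfun_apply T x = blinfun_apply (op_power A n) (blinfun_apply T y)"
      unfolding y by (metis blinfun_apply_blinfun_compose)
    then show "blinfun_apply T x \<in> V n" by (simp add: V_def)
    have "blinfun_apply T x - z *\<^sub>C x = blinfun_apply A x"
      by (simp add: A_def blinfun.diff_left scaleC_blinfun_apply)
    also have "\<dots> = blinfun_apply (op_power A (Suc n)) y" by (simp add: y op_power_Suc)
    finally show "blinfun_apply T x - z *\<^sub>C x \<in> V (Suc n)" by (simp add: V_def)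
  qed
  then obtain n where n: "V (Suc n) = V n" by blast
  have "surj (blinfun_apply A)"
  proof (rule surjI)
    fix y
    have "blinfun_apply (op_power A n) y \<in> V (Suc n)" unfolding n by (simp add: V_def)
    then obtain x where "blinfun_apply (op_power A n) y = blinfun_apply (op_power A (Suc n)) x"
      by (auto simp: V_def)
    then have "blinfun_apply (op_power A n) (y - blinfun_apply A x) = 0"
      by (simp add: op_power_Suc2 blinfun.diff_right)
    then have "c ^ n * norm (y - blinfun_apply A x) \<le> 0" using bb[of n "y - blinfun_apply A x"] by simp
    moreover have "c ^ n > 0" using c(1) by simp
    ultimately have "y = blinfun_apply A x" by (simp add: mult_le_0_iff)
    then show "blinfun_apply A (SOME x. y = blinfun_apply A x) = y" by (metis (mono_tags) someI)
  qed
  then obtain B where B: "is_inverse_op A B" using is_inverse_opI_bij[OF A c] by blast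
  have "z *\<^sub>C id_blinfun - T = - A" by (simp add: A_def)
  then have "is_inverse_op (z *\<^sub>C id_blinfun - T) (- B)"
    using B by (auto simp: is_inverse_op_def compose_minus_left compose_minus_right)
  then show False using resolvent_eqI(1) z(1) by blast
qed

lemma poly_op_eigenvector:
  assumes T: "T \<in> bounded_ops" and x: "blinfun_apply T x = z *\<^sub>C x"
  shows "blinfun_apply (poly_op p T) x = poly p z *\<^sub>C x"
proof (induction p)
  case (pCons a p)
  then show ?case
    using T x by (simp add: poly_op_pCons blinfun.add_left scaleC_blinfun_apply scaleC_add_left
        bounded_opsD scaleC_scaleC mult.commute)
qed simp

text \<open>For distinct \<open>l 0\<close>, \<open>l 1\<close>, ... the kernels of
  \<open>(T - l 0) ... (T - l (n - 1))\<close> would form a strictly increasing chain: an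
  eigenvector for \<open>l n\<close> lies in kernel \<open>n + 1\<close> but not in kernel
  \<open>n\<close>, where the polynomial has a nonzero value at \<open>l n\<close>.\<close>

lemma compact_op_finite_spectrum:
  fixes T :: "'a::{complex_normed_vector, banach} \<Rightarrow>\<^sub>L 'a"
  assumes T: "compact_op T" and d: "0 < d"
  shows "finite {z \<in> spectrum T. d \<le> cmod z}"
proof (rule ccontr)
  assume "infinite {z \<in> spectrum T. d \<le> cmod z}"
  then obtain l :: "nat \<Rightarrow> complex" where l: "inj l" "range l \<subseteq> {z \<in> spectrum T. d \<le> cmod z}"
    using infinite_countable_subset by blast
  have Tops: "T \<in> bounded_ops" using T by (simp add: compact_op_def)
  define p where "p n = (\<Prod>i<n. [:- l i, 1:])" for n
  have p_Suc: "p (Suc n) = p n * [:- l n, 1:]" for n by (simp add: p_def)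
  define V where "V n = {x. blinfun_apply (poly_op (p n) T) x = 0}" for n
  have sp: "poly_op (p (Suc n)) T = poly_op (p n) T o\<^sub>L (T - l n *\<^sub>C id_blinfun)" for n
    by (simp only: p_Suc poly_op_mult[OF Tops] poly_op_linear[OF Tops])
  have sp': "poly_op (p (Suc n)) T = (T - l n *\<^sub>C id_blinfun) o\<^sub>L poly_op (p n) T" for n
    unfolding p_Suc mult.commute[of "p n"] by (rule poly_op_split_root[OF Tops])
  have "\<exists>n. V (Suc n) = V n"
  proof (rule compact_op_increasing_chain[OF T])
    fix n
    show "complex_vector.subspace (V n)"
      unfolding V_def complex_vector.subspace_def
      using bounded_opsD[OF poly_op_in_bounded_ops[OF Tops]] by (auto simp: blinfun.add_right)
    show "closed (V n)"
      unfolding V_def by (intro closed_Collect_eq continuous_intros)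
    show "V n \<subseteq> V (Suc n)" by (auto simp: V_def sp')
    show "0 < d" by (rule d)
    show "d \<le> cmod (l n)" using l(2) by auto
    fix x
    show "blinfun_apply T x \<in> V n" if "x \<in> V n"
    proof -
      have "blinfun_apply (poly_op (p n) T) (blinfun_apply T x) = blinfun_apply T (blinfun_apply (poly_op (p n) T) x)"
        using poly_op_commute_self[OF Tops, of "p n"] by (metis blinfun_apply_blinfun_compose)
      then show ?thesis using that by (simp add: V_def)
    qed
    show "blinfun_apply T x - l n *\<^sub>C x \<in> V n" if "x \<in> V (Suc n)"
      using that by (simp add: V_def sp blinfun.diff_left scaleC_blinfun_apply)
  qed
  then obtain n where n: "V (Suc n) = V n" by blast
  have "l n \<in> {z \<in> spectrum T. d \<le> cmod z}" using l(2) by blast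
  then have ln: "l n \<in> spectrum T" "l n \<noteq> 0" using d by auto
  obtain e where e: "e \<noteq> 0" "blinfun_apply T e = l n *\<^sub>C e"
    using compact_op_spectrum_eigenvector[OF T ln] by blast
  have "e \<in> V (Suc n)"
    using e(2) by (simp add: V_def sp blinfun.diff_left scaleC_blinfun_apply)
  then have "poly (p n) (l n) *\<^sub>C e = 0"
    unfolding n by (simp add: V_def poly_op_eigenvector[OF Tops e(2)])
  moreover have "poly (p n) (l n) \<noteq> 0"
    using l(1) by (auto simp: p_def poly_prod inj_def)
  ultimately show False
    using e(1) by (metis norm_scaleC norm_zero mult_eq_0_iff norm_eq_zero)
qed

section \<open>Compact idempotents have finite rank\<close>

lemma compact_op_compose:
  assumes T: "compact_op T" and A: "A \<in> bounded_ops" shows "compact_op (T o\<^sub>L A)"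
proof -
  define M where "M = norm A + 1"
  have M: "M > 0" unfolding M_def using norm_ge_zero[of A] by linarith
  let ?K = "(\<lambda>x. M *\<^sub>R x) ` closure (blinfun_apply T ` cball 0 1)"
  have K: "compact ?K"
    using T by (intro compact_continuous_image continuous_intros) (simp add: compact_op_def)
  have "blinfun_apply (T o\<^sub>L A) ` cball 0 1 \<subseteq> ?K"
  proof
    fix y assume "y \<in> blinfun_apply (T o\<^sub>L A) ` cball 0 1"
    then obtain x where x: "norm x \<le> 1" "y = blinfun_apply T (blinfun_apply A x)" by auto
    define u where "u = inverse M *\<^sub>R blinfun_apply A x"
    have "norm (blinfun_apply A x) \<le> norm A * 1"
      by (rule order_trans[OF norm_blinfun]) (use x in \<open>auto intro: mult_left_le\<close>)
    then have "norm u \<le> 1" using M by (simp add: u_def M_def field_simps)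
    then have "blinfun_apply T u \<in> closure (blinfun_apply T ` cball 0 1)"
      using closure_subset[of "blinfun_apply T ` cball 0 1"] by auto
    moreover have "y = M *\<^sub>R blinfun_apply T u"
      using M by (simp add: u_def x blinfun.scaleR_right)
    ultimately show "y \<in> ?K" by blast
  qed
  then have "closure (blinfun_apply (T o\<^sub>L A) ` cball 0 1) \<subseteq> ?K"
    by (intro closure_minimal compact_imp_closed K)
  then have "compact (closure (blinfun_apply (T o\<^sub>L A) ` cball 0 1))"
    using compact_Int_closed[OF K closed_closure] by (metis Int_absorb1)
  then show ?thesis using T A by (auto simp: compact_op_def)
qed

lemma compact_idempotent_finite_rank:
  assumes C: "compact_op C" and idem: "C o\<^sub>L C = C"
  obtains F where "finite F" "range (blinfun_apply C) = complex_vector.span F"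
proof -
  have Cops: "C \<in> bounded_ops" using C by (simp add: compact_op_def)
  have fix_C: "blinfun_apply C x = x" if "x \<in> range (blinfun_apply C)" for x
    using that idem by (metis blinfun_apply_blinfun_compose imageE)
  let ?S = "blinfun_apply C ` cball 0 1"
  have "compact (closure ?S)" using C by (simp add: compact_op_def)
  moreover have "closure ?S \<subseteq> (\<Union>x\<in>?S. ball x (1 / 2))"
  proof
    fix y assume "y \<in> closure ?S"
    then obtain x where x: "x \<in> ?S" "dist x y < 1 / 2"
      unfolding closure_approachable by (metis half_gt_zero zero_less_one)
    then have "y \<in> ball x (1 / 2)" by simp
    with x(1) show "y \<in> (\<Union>x\<in>?S. ball x (1 / 2))" by blast
  qed
  ultimately obtain F where F: "F \<subseteq> ?S" "finite F" "closure ?S \<subseteq> (\<Union>x\<in>F. ball x (1 / 2))"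
    by (rule compactE_image[OF _ open_ball])
  have sub: "complex_vector.subspace (range (blinfun_apply C))"
    unfolding complex_vector.subspace_def
    by (auto simp: image_iff simp flip: blinfun.add_right bounded_opsD[OF Cops])
      (metis blinfun.zero_right)
  have span_le: "complex_vector.span F \<subseteq> range (blinfun_apply C)"
    using F(1) by (intro complex_vector.span_minimal sub) auto
  have "complex_vector.span F = range (blinfun_apply C)"
  proof (rule ccontr)
    assume ne: "complex_vector.span F \<noteq> range (blinfun_apply C)"
    \<comment> \<open>\<open>C\<close> fixes its range, so \<open>u\<close> belongs to the image of
      the unit ball and lies within \<open>1/2\<close> of a centre in \<open>F\<close>. Any number
      strictly between \<open>1/2\<close> and 1 could replace \<open>3/4\<close>.\<close>
    obtain u where u: "u \<in> range (blinfun_apply C)" "norm u = 1"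
      "\<And>v. v \<in> complex_vector.span F \<Longrightarrow> 3 / 4 \<le> norm (u - v)"
      by (rule riesz_almost_orthogonal_in[OF complex_vector.subspace_span
            complete_imp_closed[OF complete_complex_span[OF F(2)]] sub span_le ne, of "3 / 4"]) auto
    have "u \<in> ?S" using fix_C[OF u(1)] u(2) by (intro image_eqI[of _ _ u]) auto
    then have "u \<in> (\<Union>x\<in>F. ball x (1 / 2))" using F(3) closure_subset[of ?S] by blast
    then obtain f where f: "f \<in> F" "dist f u < 1 / 2" by auto
    have "3 / 4 \<le> norm (u - f)" by (intro u(3) complex_vector.span_base f(1))
    then show False using f(2) by (simp add: dist_norm norm_minus_commute)
  qed
  then show ?thesis using F(2) that by blast
qed

section \<open>Circle integrals of the resolvent of a compact operator\<close>

lemma cmean_resolvent_in_bounded_ops: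
  fixes T :: "'a::chilbert_space \<Rightarrow>\<^sub>L 'a"
  assumes T: "T \<in> bounded_ops" and r: "0 \<le> r" and free: "sphere 0 r \<inter> spectrum T = {}"
    and \<phi>: "continuous_on (sphere 0 r) \<phi>"
  shows "cmean r (\<lambda>z. \<phi> z *\<^sub>C resolvent T z) \<in> bounded_ops"
proof -
  let ?F = "\<lambda>z. \<phi> z *\<^sub>C resolvent T z"
  have cont: "continuous_on (sphere 0 r) ?F"
    by (intro bounded_bilinear.continuous_on[OF bounded_bilinear_scaleC] \<phi> continuous_on_resolvent[OF T free])
  have ev: "blinfun_apply (cmean r ?F) x = cmean r (\<lambda>z. blinfun_apply (?F z) x)" for x
    by (rule cmean_linear[OF r cont blinfun.bounded_linear_left, symmetric]) (rule scaleC_blinfun_apply)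
  have "blinfun_apply (cmean r ?F) (c *\<^sub>C x) = c *\<^sub>C blinfun_apply (cmean r ?F) x" for c x
  proof -
    have contx: "continuous_on (sphere 0 r) (\<lambda>z. blinfun_apply (?F z) x)"
      by (rule bounded_linear.continuous_on[OF blinfun.bounded_linear_left cont])
    have "blinfun_apply (cmean r ?F) (c *\<^sub>C x) = cmean r (\<lambda>z. c *\<^sub>C blinfun_apply (?F z) x)"
      unfolding ev
    proof (rule cmean_cong[OF r])
      fix z :: complex assume "z \<in> sphere 0 r"
      then have "z \<notin> spectrum T" using free by blast
      then have "?F z \<in> bounded_ops" using resolvent_in_bounded_ops by blast
      then show "blinfun_apply (?F z) (c *\<^sub>C x) = c *\<^sub>C blinfun_apply (?F z) x" by (rule bounded_opsD)
    qed
    also have "\<dots> = c *\<^sub>C cmean r (\<lambda>z. blinfun_apply (?F z) x)"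
      by (rule cmean_linear[OF r contx bounded_linear_scaleC]) (simp add: scaleC_scaleC mult.commute)
    finally show ?thesis by (simp only: ev)
  qed
  then show ?thesis by (simp add: bounded_ops_def)
qed

lemma cmean_resolvent_commute:
  fixes T :: "'a::chilbert_space \<Rightarrow>\<^sub>L 'a"
  assumes T: "T \<in> bounded_ops" and r: "0 \<le> r" and free: "sphere 0 r \<inter> spectrum T = {}"
  shows "cmean r (resolvent T) o\<^sub>L T = T o\<^sub>L cmean r (resolvent T)"
proof -
  note cont = continuous_on_resolvent[OF T free]
  have "cmean r (resolvent T) o\<^sub>L T = cmean r (\<lambda>z. resolvent T z o\<^sub>L T)"
    by (rule cmean_linear[OF r cont bounded_bilinear.bounded_linear_left[OF bounded_bilinear_blinfun_compose], symmetric])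
      (rule compose_scaleC_left)
  also have "\<dots> = cmean r (\<lambda>z. T o\<^sub>L resolvent T z)"
  proof (rule cmean_cong[OF r])
    fix z :: complex assume "z \<in> sphere 0 r"
    then have z: "z \<notin> spectrum T" using free by blast
    show "resolvent T z o\<^sub>L T = T o\<^sub>L resolvent T z"
      by (simp only: resolvent_compose[OF T z] compose_resolvent[OF T z])
  qed
  also have "\<dots> = T o\<^sub>L cmean r (resolvent T)"
    by (rule cmean_linear[OF r cont bounded_bilinear.bounded_linear_right[OF bounded_bilinear_blinfun_compose]])
      (rule compose_scaleC_right[OF T])
  finally show ?thesis .
qed

text \<open>Exponents from 2 upwards have a primitive off the origin; the double \<open>Suc\<close>
  excludes \<open>1 / z\<close>.\<close>

lemma has_contour_integral_inverse_power:
  assumes "0 < r"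
  shows "((\<lambda>z. (1 / z) ^ Suc (Suc n)) has_contour_integral 0) (circlepath 0 r)"
proof -
  have "((\<lambda>z. - (inverse (of_nat (Suc n)) * (1 / z) ^ Suc n)) has_field_derivative (1 / z) ^ Suc (Suc n))
      (at z within sphere 0 r)" if "z \<in> sphere 0 r" for z :: complex
  proof -
    have z: "z \<noteq> 0" using that assms by auto
    have nz: "of_nat (Suc n) \<noteq> (0 :: complex)" by (simp only: of_nat_eq_0_iff nat.simps simp_thms)
    have deriv: "((\<lambda>z. - (inverse (of_nat (Suc n)) * (1 / z) ^ Suc n)) has_field_derivative
        - (inverse (of_nat (Suc n)) * (of_nat (Suc n) * ((1 / z) ^ n * (- 1 / (z * z)))))) (at z within sphere 0 r)"
      using z by (auto intro!: derivative_eq_intros simp del: of_nat_Suc power_Suc)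
    have eq: "- (inverse (of_nat (Suc n)) * (of_nat (Suc n) * ((1 / z) ^ n * (- 1 / (z * z))))) = (1 / z) ^ Suc (Suc n)"
      using nz z by (simp del: of_nat_Suc add: mult.assoc[symmetric])
    show ?thesis using deriv unfolding eq .
  qed
  then show ?thesis
    by (rule Cauchy_theorem_primitive) (use assms in auto)
qed

lemma compact_op_spectral_gap:
  fixes T :: "'a::{complex_normed_vector, banach} \<Rightarrow>\<^sub>L 'a"
  assumes "compact_op T"
  obtains a b where "0 < a" "a < b" "b < 1" "\<And>z. z \<in> spectrum T \<Longrightarrow> cmod z < a \<or> b < cmod z"
proof -
  define F where "F = insert (1 / 2) {x \<in> cmod ` {z \<in> spectrum T. 1 / 2 \<le> cmod z}. x < 1}"
  have F: "finite F" "F \<noteq> {}"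
    using compact_op_finite_spectrum[OF assms, of "1 / 2"] by (auto simp: F_def)
  define m where "m = Max F"
  have "m \<in> F" unfolding m_def by (rule Max_in[OF F])
  then have m1: "m < 1" by (auto simp: F_def)
  have m0: "1 / 2 \<le> m" unfolding m_def by (rule Max_ge[OF F(1)]) (simp add: F_def)
  \<comment> \<open>\<open>m\<close> is the largest modulus below 1 recorded in \<open>F\<close>.
    These points cut the interval from \<open>m\<close> to 1 into thirds, so the closed annulus
    between them meets no spectrum.\<close>
  define a b where "a = (2 * m + 1) / 3" and "b = (m + 2) / 3"
  have ab: "m < a" "a < b" "b < 1" using m1 by (auto simp: a_def b_def)
  have "cmod z < a \<or> b < cmod z" if z: "z \<in> spectrum T" for z
  proof (rule ccontr)
    assume "\<not> ?thesis"
    then have "a \<le> cmod z" "cmod z \<le> b" by auto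
    then have "cmod z \<in> F" using z ab m0 by (auto simp: F_def)
    then have "cmod z \<le> m" unfolding m_def by (rule Max_ge[OF F(1)])
    then show False using \<open>a \<le> cmod z\<close> ab by linarith
  qed
  then show ?thesis using that[of a b] ab m0 by auto
qed

lemma compact_op_null_orbit_reflexive:
  fixes T :: "'a::chilbert_space \<Rightarrow>\<^sub>L 'a"
  assumes compact: "compact_op T"
  shows "null_orbit_reflexive T"
proof -
  have T: "T \<in> bounded_ops" using compact by (simp add: compact_op_def)
  obtain a b where ab: "0 < a" "a < b" "b < 1" and gap: "\<And>z. z \<in> spectrum T \<Longrightarrow> cmod z < a \<or> b < cmod z"
    by (rule compact_op_spectral_gap[OF compact]) blast
  have free_a: "sphere 0 a \<inter> spectrum T = {}" and free_b: "sphere 0 b \<inter> spectrum T = {}"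
    using gap ab by fastforce+
  have b0: "0 < b" "0 \<le> b" using ab by auto
  define Q where "Q = cmean a (resolvent T)"
  have Qb: "Q = cmean b (resolvent T)"
    unfolding Q_def by (rule cmean_resolvent_radius[OF T ab(1)]) (use ab gap in auto)
  define C where "C = id_blinfun - Q"
  \<comment> \<open>Negative moments of the resolvent: \<open>- Y n\<close> acts as an inverse of
    \<open>T^n\<close> on the range of \<open>C\<close>, in the sense that
    \<open>T^n Y_n = - C\<close> for \<open>n \<ge> 1\<close>.\<close>
  define Y where "Y n = cmean b (\<lambda>z. (1 / z) ^ n *\<^sub>C resolvent T z)" for n
  have cpow: "continuous_on (sphere 0 b) (\<lambda>z :: complex. (1 / z) ^ n)" for n :: nat
    by (intro continuous_intros) (use b0 in auto)
  have Y_ops: "Y n \<in> bounded_ops" for n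
    unfolding Y_def by (rule cmean_resolvent_in_bounded_ops[OF T b0(2) free_b cpow])
  have Q_ops: "Q \<in> bounded_ops" using Y_ops[of 0] by (simp add: Y_def Qb scaleC_one)
  have C_ops: "C \<in> bounded_ops" using Q_ops by (auto simp: C_def)
  have shift: "cmean b (\<lambda>z. (z * (1 / z) ^ Suc n) *\<^sub>C resolvent T z) = Y n" for n
    unfolding Y_def
  proof (rule cmean_cong[OF b0(2)])
    fix z :: complex assume "z \<in> sphere 0 b"
    then have "z \<noteq> 0" using b0 by auto
    then show "(z * (1 / z) ^ Suc n) *\<^sub>C resolvent T z = (1 / z) ^ n *\<^sub>C resolvent T z" by simp
  qed
  have "((\<lambda>z. (1 / z) ^ Suc 0) has_contour_integral 2 * of_real pi * \<i> * 1) (circlepath 0 b)"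
    using has_contour_integral_cauchy_kernel[of 0 b] b0 by simp
  from compose_cmean_resolvent[OF T b0(1) free_b cpow this]
  have TY1: "T o\<^sub>L Y (Suc 0) = - C"
    unfolding shift by (simp add: Y_def[of "Suc 0"] Y_def[of 0] C_def Qb scaleC_one)
  have TY: "T o\<^sub>L Y (Suc (Suc n)) = Y (Suc n)" for n
  proof -
    have "((\<lambda>z. (1 / z) ^ Suc (Suc n)) has_contour_integral 2 * of_real pi * \<i> * 0) (circlepath 0 b)"
      using has_contour_integral_inverse_power[OF b0(1), of n] by simp
    from compose_cmean_resolvent[OF T b0(1) free_b cpow this] show ?thesis
      unfolding shift by (simp add: Y_def)
  qed
  have pow_Y: "op_power T (Suc n) o\<^sub>L Y (Suc n) = - C" for n
  proof (induction n)
    case 0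
    then show ?case by (simp add: op_power_Suc TY1)
  next
    case (Suc n)
    then show ?case
      by (simp only: op_power_Suc2[of T "Suc n"] blinfun_compose_assoc TY)
  qed
  have QT: "Q o\<^sub>L T = T o\<^sub>L Q"
    unfolding Q_def by (rule cmean_resolvent_commute[OF T _ free_a]) (use ab in simp)
  obtain K where K: "\<And>n. norm (op_power T n o\<^sub>L Q) \<le> K * a ^ n"
    unfolding Q_def by (rule geom_decay_cmean[OF T ab(1) free_a]) blast
  obtain B where B: "\<And>z. z \<in> sphere 0 b \<Longrightarrow> norm (resolvent T z) \<le> B"
    using compact_imp_bounded[OF compact_continuous_image[OF continuous_on_resolvent[OF T free_b] compact_sphere]]
    unfolding bounded_iff by blast
  have normY: "norm (Y n) \<le> b * ((1 / b) ^ n * B)" for n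
    unfolding Y_def
  proof (rule norm_cmean_le[OF b0(2)])
    fix z :: complex assume z: "z \<in> sphere 0 b"
    then show "norm ((1 / z) ^ n *\<^sub>C resolvent T z) \<le> (1 / b) ^ n * B"
      using B[OF z] b0 by (simp add: norm_scaleC norm_power norm_divide mult_left_mono divide_right_mono power_divide)
  qed (intro bounded_bilinear.continuous_on[OF bounded_bilinear_scaleC] cpow continuous_on_resolvent[OF T free_b])
  \<comment> \<open>\<open>Q C = - (T^n Q) Y_n\<close> up to commuting factors. The first factor is
    \<open>O(a^n)\<close> by the inner circle and \<open>Y_n\<close> is \<open>O(b^(-n))\<close> by
    the outer one, so \<open>a < b\<close> forces \<open>Q C = 0\<close>, and \<open>C\<close> is
    idempotent.\<close>
  have "norm (Q o\<^sub>L C) \<le> (K * b * B) * (a / b) ^ Suc n" for n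
  proof -
    have "Q o\<^sub>L (op_power T (Suc n) o\<^sub>L Y (Suc n)) = (op_power T (Suc n) o\<^sub>L Q) o\<^sub>L Y (Suc n)"
      by (simp only: op_power_commute[OF QT] flip: blinfun_compose_assoc)
    then have "norm (Q o\<^sub>L C) = norm ((op_power T (Suc n) o\<^sub>L Q) o\<^sub>L Y (Suc n))"
      unfolding pow_Y compose_minus_right by (metis norm_minus_cancel)
    also have "\<dots> \<le> (K * a ^ Suc n) * (b * ((1 / b) ^ Suc n * B))"
      by (rule norm_blinfun_compose_mono[OF K normY])
    also have "\<dots> = (K * b * B) * (a / b) ^ Suc n"
      by (simp add: power_divide)
    finally show ?thesis .
  qed
  moreover have "(\<lambda>n. (K * b * B) * (a / b) ^ Suc n) \<longlonglongrightarrow> (K * b * B) * 0"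
    using ab by (intro tendsto_mult tendsto_const LIMSEQ_Suc LIMSEQ_power_zero) simp
  ultimately have "norm (Q o\<^sub>L C) \<le> (K * b * B) * 0"
    by (intro LIMSEQ_le_const) auto
  then have QC: "Q o\<^sub>L C = 0" by simp
  have idem: "C o\<^sub>L C = C"
    using QC by (subst C_def) (simp add: compose_diff_left)
  \<comment> \<open>The first negative moment exhibits \<open>C\<close> as \<open>T\<close> composed
    with a bounded operator.\<close>
  have "C = T o\<^sub>L (- Y (Suc 0))" using TY1 by (simp add: compose_minus_right)
  then have "compact_op C" using compact_op_compose[OF compact, of "- Y (Suc 0)"] Y_ops by auto
  then obtain F where F: "finite F" "range (blinfun_apply C) = complex_vector.span F"
    using compact_idempotent_finite_rank[OF _ idem] by blast
  have CT: "C o\<^sub>L T = T o\<^sub>L C" by (simp add: C_def compose_diff_left compose_diff_right QT)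
  have "blinfun_apply T x \<in> complex_vector.span F" if x: "x \<in> complex_vector.span F" for x
  proof -
    obtain y where "x = blinfun_apply C y" using x unfolding F(2)[symmetric] by blast
    then have "blinfun_apply T x = blinfun_apply C (blinfun_apply T y)"
      using CT by (metis blinfun_apply_blinfun_compose)
    then show ?thesis unfolding F(2)[symmetric] by blast
  qed
  from annihilating_poly_span[OF T F(1) this] obtain p where
    p: "p \<noteq> 0" "\<And>x. x \<in> complex_vector.span F \<Longrightarrow> blinfun_apply (poly_op p T) x = 0" by blast
  have "poly_op p T o\<^sub>L C = 0"
    using p(2) unfolding F(2)[symmetric] by (intro blinfun_eqI) simp
  then have "geom_decay T (poly_op p T)"
    unfolding C_def Q_def
    by (intro geom_decay_of_complement[OF T ab(1) _ free_a]) (use ab in auto)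
  then show ?thesis
    using geom_decay_imp_null_orbit_reflexive[OF complete_UNIV T p(1)] by blast
qed

theorem theorem25:
  shows "(\<forall>(T :: 'a::chilbert_space \<Rightarrow>\<^sub>L 'a) E.
            T \<in> bounded_ops \<longrightarrow> spectral_radius T = 1 \<longrightarrow>
            E = spectrum T \<inter> {z. cmod z = 1} \<longrightarrow>
            (\<forall>z\<in>E. \<not> z islimpt spectrum T) \<longrightarrow>
            algebraic_on T (spectral_subspace T E) \<longrightarrow>
            null_orbit_reflexive T)
       \<and> (\<forall>T :: 'a \<Rightarrow>\<^sub>L 'a. compact_op T \<or> algebraic_op T \<longrightarrow> null_orbit_reflexive T)
       \<and> (complex_finite_dimensional TYPE('b::complex_normed_vector) \<longrightarrow>
            (\<forall>T :: 'b \<Rightarrow>\<^sub>L 'b. T \<in> bounded_ops \<longrightarrow> null_orbit_reflexive T))"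
proof (intro conjI allI impI)
  fix T :: "'a \<Rightarrow>\<^sub>L 'a" and E
  assume T: "T \<in> bounded_ops" "spectral_radius T = 1" "E = spectrum T \<inter> {z. cmod z = 1}"
    and iso: "\<forall>z\<in>E. \<not> z islimpt spectrum T" and alg: "algebraic_on T (spectral_subspace T E)"
  show "null_orbit_reflexive T"
    by (rule algebraic_on_peripheral_imp_null_orbit_reflexive[OF T _ alg]) (use iso in blast)
next
  fix T :: "'a \<Rightarrow>\<^sub>L 'a" assume "compact_op T \<or> algebraic_op T"
  then show "null_orbit_reflexive T"
    using compact_op_null_orbit_reflexive algebraic_imp_null_orbit_reflexive[OF complete_UNIV] by blast
next
  fix T :: "'b \<Rightarrow>\<^sub>L 'b" assume "complex_finite_dimensional TYPE('b)" "T \<in> bounded_ops"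
  then show "null_orbit_reflexive T" by (rule finite_dimensional_null_orbit_reflexive)
qed

end
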